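(* Let $S=k[x_1,\ldots,x_n]$ be a polynomial ring over a field $k$, $q\geq2$, let $I=(L^i(v))\subset S$ be an initial squarefree lexsegment ideal, where $v=x_{j_1}\cdots x_{j_q}$ with $2\le j_1<\cdots<j_q\le n$, and let $\Delta$ be the simplicial complex on the vertex set $[n]$ such that $I=I_\Delta$. Then: (a) The Krull dimension of the Stanley–Reisner ring of $\Delta$ is $n-j_1$. (b) The depth of the Stanley–Reisner ring of $\Delta$ is $q-1$. (c) The simplicial complex $\Delta$ is pure if and only if $v=x_{n-q+1}\cdots x_n$. Moreover, $\Delta$ is a pure simplicial complex if and only if $\Delta$ is Cohen–Macaulay.
   Context: Monomials are ordered by the lexicographic order with $x_1>x_2>\cdots>x_n$. For a squarefree monomial $v$ of degree $q$, $L^i(v)=\{w: w\text{ a squarefree monomial of degree }q,\ w\geq_{lex}v\}$. $I_\Delta$ is the Stanley–Reisner ideal of $\Delta$, generated by the $x_G=\prod_{i\in G}x_i$ with $G\notin\Delta$; $k[\Delta]=S/I_\Delta$ is the Stanley–Reisner ring; here a vertex of $[n]$ need only satisfy that the faces of $\Delta$ are the $G\subset[n]$ with $x_G\notin I$. $\Delta$ is pure if all its facets have the same dimension, and Cohen–Macaulay if $k[\Delta]$ is a Cohen–Macaulay ring. *)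

theory Defs
  imports "HOL-Library.Poly_Mapping" "HOL-Library.Extended_Nat" "HOL-Algebra.QuotRing" "HOL-Algebra.Ring_Divisibility"
begin

section \<open>Krull dimension, grade, Cohen--Macaulay rings\<close>

definition prime_chain :: "('a, 'b) ring_scheme \<Rightarrow> nat \<Rightarrow> (nat \<Rightarrow> 'a set) \<Rightarrow> bool" where
  "prime_chain R r P \<longleftrightarrow>
     (\<forall>i\<le>r. primeideal (P i) R) \<and> (\<forall>i<r. P i \<subset> P (Suc i))"

text \<open>With values in \<^typ>\<open>enat\<close>, the zero ring is given dimension 0.\<close>

definition krull_dim :: "('a, 'b) ring_scheme \<Rightarrow> enat" where
  "krull_dim R = Sup {enat r | r. \<exists>P. prime_chain R r P}"

definition height :: "('a, 'b) ring_scheme \<Rightarrow> 'a set \<Rightarrow> enat" where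
  "height R Q = Sup {enat r | r. \<exists>P. prime_chain R r P \<and> P r = Q}"

text \<open>
  The second conjunct says that \<open>xs ! i\<close> is a nonzerodivisor modulo the ideal generated by
  its predecessors, the third that the quotient by all of \<open>xs\<close> is nonzero.
\<close>

definition regular_sequence :: "('a, 'b) ring_scheme \<Rightarrow> 'a list \<Rightarrow> bool" where
  "regular_sequence R xs \<longleftrightarrow>
     set xs \<subseteq> carrier R \<and>
     (\<forall>i<length xs. \<forall>a\<in>carrier R.
        xs ! i \<otimes>\<^bsub>R\<^esub> a \<in> genideal R (set (take i xs)) \<longrightarrow> a \<in> genideal R (set (take i xs))) \<and>
     genideal R (set xs) \<noteq> carrier R"

definition grade :: "('a, 'b) ring_scheme \<Rightarrow> 'a set \<Rightarrow> enat" where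
  "grade R J = Sup {enat (length xs) | xs. regular_sequence R xs \<and> set xs \<subseteq> J}"

text \<open>
  For a maximal ideal \<open>M\<close> of a noetherian ring, \<open>grade R M\<close> is the depth and \<open>height R M\<close>
  the dimension of the localization at \<open>M\<close>.
\<close>

definition cohen_macaulay_ring :: "('a, 'b) ring_scheme \<Rightarrow> bool" where
  "cohen_macaulay_ring R \<longleftrightarrow>
     cring R \<and> noetherian_ring R \<and> (\<forall>M. maximalideal M R \<longrightarrow> grade R M = height R M)"


section \<open>Monomials and polynomial rings\<close>

text \<open>
  A monomial is identified with its exponent vector, so that products of monomials are sums.
  Polynomials in all variables \<open>x\<^sub>0, x\<^sub>1, \<dots>\<close> form the type \<open>(nat \<Rightarrow>\<^sub>0 nat) \<Rightarrow>\<^sub>0 'k\<close>; the ring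
  \<open>k[x\<^sub>1, \<dots>, x\<^sub>n]\<close> is its subring of polynomials involving only \<open>x\<^sub>1, \<dots>, x\<^sub>n\<close>.
\<close>

type_synonym monomial = "nat \<Rightarrow>\<^sub>0 nat"

definition poly_ring :: "'k::field itself \<Rightarrow> nat \<Rightarrow> (monomial \<Rightarrow>\<^sub>0 'k) ring" where
  "poly_ring K n =
     \<lparr>carrier = {p. \<forall>m\<in>Poly_Mapping.keys p. Poly_Mapping.keys m \<subseteq> {1..n}},
      monoid.mult = (*), one = 1, zero = 0, add = (+)\<rparr>"

definition monomial_poly :: "'k::field itself \<Rightarrow> monomial \<Rightarrow> (monomial \<Rightarrow>\<^sub>0 'k)" where
  "monomial_poly K m = Poly_Mapping.single m 1"

definition squarefree_product :: "nat set \<Rightarrow> monomial" where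
  "squarefree_product G = (\<Sum>i\<in>G. Poly_Mapping.single i 1)"

definition monomial_degree :: "monomial \<Rightarrow> nat" where
  "monomial_degree m = (\<Sum>i\<in>Poly_Mapping.keys m. Poly_Mapping.lookup m i)"

definition squarefree_monomials :: "nat \<Rightarrow> nat \<Rightarrow> monomial set" where
  "squarefree_monomials n q =
     {m. Poly_Mapping.keys m \<subseteq> {1..n} \<and> (\<forall>i. Poly_Mapping.lookup m i \<le> 1) \<and> monomial_degree m = q}"

text \<open>
  The library order on \<^typ>\<open>monomial\<close> compares the exponents at the smallest index where they
  differ; it is the lexicographic order with \<open>x\<^sub>1 > x\<^sub>2 > \<dots> > x\<^sub>n\<close>.
\<close>

definition initial_lexsegment :: "nat \<Rightarrow> monomial \<Rightarrow> monomial set" where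
  "initial_lexsegment n v = {w \<in> squarefree_monomials n (monomial_degree v). w \<ge> v}"

definition initial_lexsegment_ideal ::
    "'k::field itself \<Rightarrow> nat \<Rightarrow> monomial \<Rightarrow> (monomial \<Rightarrow>\<^sub>0 'k) set" where
  "initial_lexsegment_ideal K n v =
     genideal (poly_ring K n) (monomial_poly K ` initial_lexsegment n v)"


section \<open>Simplicial complexes and Stanley--Reisner rings\<close>

text \<open>Elements of the vertex set are not required to be faces.\<close>

definition simplicial_complex :: "nat \<Rightarrow> nat set set \<Rightarrow> bool" where
  "simplicial_complex n \<Delta> \<longleftrightarrow>
     (\<forall>F\<in>\<Delta>. F \<subseteq> {1..n}) \<and> (\<forall>F\<in>\<Delta>. \<forall>G. G \<subseteq> F \<longrightarrow> G \<in> \<Delta>)"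

definition facets :: "nat set set \<Rightarrow> nat set set" where
  "facets \<Delta> = {F \<in> \<Delta>. \<forall>G\<in>\<Delta>. F \<subseteq> G \<longrightarrow> G = F}"

definition face_dim :: "nat set \<Rightarrow> int" where
  "face_dim F = int (card F) - 1"

definition pure :: "nat set set \<Rightarrow> bool" where
  "pure \<Delta> \<longleftrightarrow> (\<forall>F\<in>facets \<Delta>. \<forall>G\<in>facets \<Delta>. face_dim F = face_dim G)"

definition stanley_reisner_ideal ::
    "'k::field itself \<Rightarrow> nat \<Rightarrow> nat set set \<Rightarrow> (monomial \<Rightarrow>\<^sub>0 'k) set" where
  "stanley_reisner_ideal K n \<Delta> =
     genideal (poly_ring K n)
       {monomial_poly K (squarefree_product G) | G. G \<subseteq> {1..n} \<and> G \<notin> \<Delta>}"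

definition stanley_reisner_ring ::
    "'k::field itself \<Rightarrow> nat \<Rightarrow> nat set set \<Rightarrow> (monomial \<Rightarrow>\<^sub>0 'k) set ring" where
  "stanley_reisner_ring K n \<Delta> = poly_ring K n Quot stanley_reisner_ideal K n \<Delta>"

definition graded_maximal_ideal ::
    "'k::field itself \<Rightarrow> nat \<Rightarrow> nat set set \<Rightarrow> (monomial \<Rightarrow>\<^sub>0 'k) set set" where
  "graded_maximal_ideal K n \<Delta> =
     genideal (stanley_reisner_ring K n \<Delta>)
       {stanley_reisner_ideal K n \<Delta> +>\<^bsub>poly_ring K n\<^esub> monomial_poly K (Poly_Mapping.single i 1)
         | i. i \<in> {1..n}}"

text \<open>
  The depth of the graded ring \<open>k[\<Delta>]\<close> is the maximal length of a regular sequence in its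
  graded maximal ideal, as for a local ring.
\<close>

definition stanley_reisner_depth :: "'k::field itself \<Rightarrow> nat \<Rightarrow> nat set set \<Rightarrow> enat" where
  "stanley_reisner_depth K n \<Delta> =
     grade (stanley_reisner_ring K n \<Delta>) (graded_maximal_ideal K n \<Delta>)"

definition cohen_macaulay_complex :: "'k::field itself \<Rightarrow> nat \<Rightarrow> nat set set \<Rightarrow> bool" where
  "cohen_macaulay_complex K n \<Delta> \<longleftrightarrow> cohen_macaulay_ring (stanley_reisner_ring K n \<Delta>)"

end

theory Submission
  imports Defs
begin

text \<open>
  Put \<open>d = q - 1\<close>.  The hypothesis on the ideal enters only through the combinatorics of \<open>\<Delta>\<close>:
  a set of vertices is a nonface if and only if it contains a \<open>q\<close>-element set that is
  lexicographically at least \<open>{j\<^sub>1, \<dots>, j\<^sub>q}\<close>.  Hence all sets of at most \<open>d\<close> vertices are faces,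
  faces have at most \<open>n - j\<^sub>1\<close> elements, \<open>{j\<^sub>1 + 1, \<dots>, n}\<close> is a face, \<open>{1, n - q + 3, \<dots>, n}\<close> is a
  facet with only \<open>d\<close> elements (this needs \<open>j\<^sub>1 \<ge> 2\<close>), and \<open>\<Delta>\<close> is shifted: replacing a vertex of a
  face by a larger one gives a face again.  In particular \<open>\<Delta>\<close> is pure if and only if
  \<open>n - j\<^sub>1 = d\<close>, which forces \<open>{j\<^sub>1, \<dots>, j\<^sub>q}\<close> to be the last \<open>q\<close> vertices.

  \<^bold>\<open>Dimension.\<close>  The face ideals of \<open>{j\<^sub>1 + 1, \<dots>, n} \<supset> {j\<^sub>1 + 2, \<dots>, n} \<supset> \<dots>\<close> form a chain of primes of
  length \<open>n - j\<^sub>1\<close>.  Conversely, in a chain \<open>P\<^sub>0 \<subset> \<dots> \<subset> P\<^sub>r\<close> elements \<open>a\<^sub>i \<in> P\<^sub>i - P\<^sub>i\<^sub>-\<^sub>1\<close> are algebraically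
  independent modulo \<open>P\<^sub>0\<close>, so that \<open>k[\<Delta>]\<close> contains at least \<open>e\<^sup>r\<close> independent elements of degree
  \<open>O(e)\<close>.  Modulo the Stanley--Reisner ideal only monomials supported on faces remain, and there
  are \<open>O(e\<^sup>f)\<close> of them, where \<open>f\<close> is the size of the largest face; so \<open>r \<le> f\<close>.

  \<^bold>\<open>Lower bound for the depth.\<close>  A shifted complex is shellable: \<open>k[\<Delta>]\<close> has a filtration whose
  quotients are \<open>S / P\<^sub>F\<close>, one for each facet \<open>F\<close>, with \<open>P\<^sub>F\<close> generated by the variables outside \<open>F\<close>.
  A sequence which is weakly regular on all these quotients is weakly regular on \<open>k[\<Delta>]\<close>.  The
  sequence used here is \<open>h\<^sub>1, \<dots>, h\<^sub>d\<close>, the complete homogeneous symmetric polynomials evaluated at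
  \<open>y\<^sub>1, \<dots>, y\<^sub>n\<close>, where \<open>y\<^sub>i\<close> is a nonzero polynomial in \<open>x\<^sub>i\<close> without constant term.  Modulo \<open>P\<^sub>F\<close> and
  \<open>h\<^sub>1, \<dots>, h\<^sub>r\<^sub>-\<^sub>1\<close> one may drop from \<open>h\<^sub>r\<close> all \<open>y\<^sub>i\<close> except those at the \<open>r\<close>-th and later vertices of \<open>F\<close>; what
  remains has a power of the variable of the \<open>r\<close>-th vertex as its leading monomial, and polynomials
  with pairwise coprime leading monomials form a weakly regular sequence.  Since \<open>k\<close> may be finite, linear forms would
  not do in general.  For \<open>y\<^sub>i = x\<^sub>i\<close> this gives depth at least \<open>d\<close>.

  \<^bold>\<open>Upper bound for the depth.\<close>  The annihilator of \<open>x\<^sub>F\<close> in \<open>k[\<Delta>]\<close> is \<open>P\<^sub>F\<close> for every facet \<open>F\<close>.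
  In a noetherian ring a regular sequence of length \<open>r\<close> in a prime \<open>m\<close> gives rise to a
  chain of length \<open>r\<close> of primes in \<open>m\<close> that starts at any prescribed associated prime contained in
  \<open>m\<close>.  For a facet \<open>F\<close> with \<open>d\<close> elements such chains have length at most \<open>d\<close>.

  \<^bold>\<open>Cohen--Macaulayness.\<close>  If \<open>\<Delta>\<close> is not pure, the graded maximal ideal has grade \<open>d\<close> and height at
  least \<open>n - j\<^sub>1 > d\<close>.  If \<open>\<Delta>\<close> is pure, let \<open>N\<close> be any maximal ideal.  By Zariski's lemma \<open>N\<close> contains a
  nonzero polynomial in each variable, hence suitable \<open>y\<^sub>1, \<dots>, y\<^sub>n\<close>, and therefore \<open>h\<^sub>1, \<dots>, h\<^sub>d\<close>.  So
  \<open>d \<le> grade N \<le> height N \<le> dim k[\<Delta>] = d\<close>.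
\<close>

section \<open>Weakly regular sequences\<close>

definition adjoin :: "('a, 'b) ring_scheme \<Rightarrow> 'a set \<Rightarrow> 'a \<Rightarrow> 'a set" where
  "adjoin R N x = {a \<oplus>\<^bsub>R\<^esub> r \<otimes>\<^bsub>R\<^esub> x | a r. a \<in> N \<and> r \<in> carrier R}"

definition colon :: "('a, 'b) ring_scheme \<Rightarrow> 'a set \<Rightarrow> 'a \<Rightarrow> 'a set" where
  "colon R N z = {a \<in> carrier R. a \<otimes>\<^bsub>R\<^esub> z \<in> N}"

text \<open>
  Each member is a nonzerodivisor modulo \<open>N\<close> and its predecessors; the quotient by all members may
  vanish.  Carrying the ideal along as a parameter turns arguments on regular sequences into
  inductions on the list.
\<close>

primrec weakly_regular :: "('a, 'b) ring_scheme \<Rightarrow> 'a set \<Rightarrow> 'a list \<Rightarrow> bool" where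
  "weakly_regular R N [] \<longleftrightarrow> True"
| "weakly_regular R N (x # xs) \<longleftrightarrow>
     (\<forall>a\<in>carrier R. x \<otimes>\<^bsub>R\<^esub> a \<in> N \<longrightarrow> a \<in> N) \<and> weakly_regular R (adjoin R N x) xs"

context cring
begin

lemma ideal_zero: "ideal N R \<Longrightarrow> \<zero> \<in> N"
  by (rule additive_subgroup.zero_closed[OF ideal.axioms(1)])

lemma ideal_add: "ideal N R \<Longrightarrow> a \<in> N \<Longrightarrow> b \<in> N \<Longrightarrow> a \<oplus> b \<in> N"
  by (rule additive_subgroup.a_closed[OF ideal.axioms(1)])

lemma ideal_carrier: "ideal N R \<Longrightarrow> a \<in> N \<Longrightarrow> a \<in> carrier R"
  by (rule ideal.Icarr)

lemma ideal_mult: "ideal N R \<Longrightarrow> a \<in> N \<Longrightarrow> r \<in> carrier R \<Longrightarrow> r \<otimes> a \<in> N"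
  by (rule ideal.I_l_closed)

lemma ideal_mult': "ideal N R \<Longrightarrow> a \<in> N \<Longrightarrow> r \<in> carrier R \<Longrightarrow> a \<otimes> r \<in> N"
  by (rule ideal.I_r_closed)

lemma ideal_minus: "ideal N R \<Longrightarrow> a \<in> N \<Longrightarrow> b \<in> N \<Longrightarrow> a \<ominus> b \<in> N"
  unfolding a_minus_def
  by (intro ideal_add additive_subgroup.a_inv_closed ideal.axioms(1))

lemma ideal_diff_iff:
  assumes "ideal N R" "a \<in> carrier R" "b \<in> carrier R" "a \<ominus> b \<in> N"
  shows "a \<in> N \<longleftrightarrow> b \<in> N"
proof
  assume "a \<in> N"
  moreover have "b = a \<ominus> (a \<ominus> b)" using assms by algebra
  ultimately show "b \<in> N" using assms ideal_minus by metis
next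
  assume "b \<in> N"
  moreover have "a = (a \<ominus> b) \<oplus> b" using assms by algebra
  ultimately show "a \<in> N" using assms ideal_add by metis
qed

lemma ideal_if_closed:
  assumes "N \<subseteq> carrier R" "\<zero> \<in> N"
    and "\<And>a b. a \<in> N \<Longrightarrow> b \<in> N \<Longrightarrow> a \<oplus> b \<in> N"
    and "\<And>a r. a \<in> N \<Longrightarrow> r \<in> carrier R \<Longrightarrow> r \<otimes> a \<in> N"
  shows "ideal N R"
proof (rule idealI[OF ring_axioms])
  show "subgroup N (add_monoid R)"
  proof (rule add.subgroupI)
    fix a assume a: "a \<in> N"
    then have "\<ominus> \<one> \<otimes> a \<in> N" using assms(4) by simp
    moreover have "\<ominus> \<one> \<otimes> a = \<ominus> a" using a assms(1) by (simp add: l_minus subset_iff)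
    ultimately show "\<ominus> a \<in> N" by simp
  qed (use assms in auto)
  show "a \<otimes> r \<in> N" if "a \<in> N" "r \<in> carrier R" for a r
    using assms(1) assms(4)[OF that] that m_comm[of a r] by auto
qed (use assms in auto)

lemma adjoin_ideal:
  assumes N: "ideal N R" and x: "x \<in> carrier R"
  shows "ideal (adjoin R N x) R"
proof (rule ideal_if_closed)
  show "adjoin R N x \<subseteq> carrier R"
    using x ideal_carrier[OF N] unfolding adjoin_def by auto
  show "\<zero> \<in> adjoin R N x"
    unfolding adjoin_def using x ideal_zero[OF N] by (force intro!: exI[of _ \<zero>])
next
  fix u w assume "u \<in> adjoin R N x" "w \<in> adjoin R N x"
  then obtain a b r s where *: "a \<in> N" "b \<in> N" "r \<in> carrier R" "s \<in> carrier R"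
     "u = a \<oplus> r \<otimes> x" "w = b \<oplus> s \<otimes> x" unfolding adjoin_def by blast
  then have "u \<oplus> w = (a \<oplus> b) \<oplus> (r \<oplus> s) \<otimes> x"
    using x ideal_carrier[OF N, of a] ideal_carrier[OF N, of b] by algebra
  then show "u \<oplus> w \<in> adjoin R N x" unfolding adjoin_def using * ideal_add[OF N] by blast
next
  fix u s assume "u \<in> adjoin R N x" and s: "s \<in> carrier R"
  then obtain a r where *: "a \<in> N" "r \<in> carrier R"
     "u = a \<oplus> r \<otimes> x" unfolding adjoin_def by blast
  then have "s \<otimes> u = s \<otimes> a \<oplus> (s \<otimes> r) \<otimes> x"
    using x s ideal_carrier[OF N, of a] by algebra
  then show "s \<otimes> u \<in> adjoin R N x" unfolding adjoin_def using * s ideal_mult[OF N] by blast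
qed

lemma adjoin_superset:
  assumes N: "ideal N R" and x: "x \<in> carrier R"
  shows "N \<subseteq> adjoin R N x"
proof
  fix a assume a: "a \<in> N"
  then have "a = a \<oplus> \<zero> \<otimes> x" using x ideal_carrier[OF N] by simp
  then show "a \<in> adjoin R N x" unfolding adjoin_def using a by blast
qed

lemma adjoin_self:
  assumes N: "ideal N R" and x: "x \<in> carrier R"
  shows "x \<in> adjoin R N x"
proof -
  have "x = \<zero> \<oplus> \<one> \<otimes> x" using x by simp
  then show ?thesis unfolding adjoin_def using ideal_zero[OF N] by blast
qed

lemma adjoin_minimal:
  assumes "ideal J R" "N \<subseteq> J" "x \<in> J"
  shows "adjoin R N x \<subseteq> J"
  unfolding adjoin_def using assms ideal_add[OF assms(1)] ideal_mult[OF assms(1)] by blast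

lemma adjoin_mono: "N \<subseteq> N' \<Longrightarrow> adjoin R N x \<subseteq> adjoin R N' x"
  unfolding adjoin_def by blast

lemma adjoin_commute:
  assumes N: "ideal N R" and xy: "x \<in> carrier R" "y \<in> carrier R"
  shows "adjoin R (adjoin R N x) y = adjoin R (adjoin R N y) x"
proof -
  have *: "adjoin R (adjoin R N x) y \<subseteq> adjoin R (adjoin R N y) x"
    if xy: "x \<in> carrier R" "y \<in> carrier R" for x y
    using adjoin_minimal[OF adjoin_ideal[OF adjoin_ideal[OF N that(2)] that(1)],
        of "adjoin R N x" y]
      adjoin_mono[OF adjoin_superset[OF N that(2)], of x] adjoin_self[OF N that(2)]
      adjoin_superset[OF adjoin_ideal[OF N that(2)] that(1)] by blast
  show ?thesis using *[OF xy] *[OF xy(2,1)] by blast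
qed

lemma genideal_empty: "genideal R {} = {\<zero>}"
proof
  show "genideal R {} \<subseteq> {\<zero>}" by (rule genideal_minimal[OF zeroideal]) simp
  show "{\<zero>} \<subseteq> genideal R {}" using ideal_zero[OF genideal_ideal[of "{}"]] by simp
qed

lemma adjoin_genideal:
  assumes A: "A \<subseteq> carrier R" and x: "x \<in> carrier R"
  shows "adjoin R (genideal R A) x = genideal R (insert x A)"
proof
  have A': "insert x A \<subseteq> carrier R" using assms by simp
  show "adjoin R (genideal R A) x \<subseteq> genideal R (insert x A)"
    using genideal_ideal[OF A'] genideal_self[OF A'] subset_Idl_subset[OF A', of A]
    by (intro adjoin_minimal) auto
  show "genideal R (insert x A) \<subseteq> adjoin R (genideal R A) x"
    using genideal_ideal[OF A] genideal_self[OF A] x adjoin_superset[OF genideal_ideal[OF A] x]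
      adjoin_self[OF genideal_ideal[OF A] x]
    by (intro genideal_minimal adjoin_ideal) auto
qed

text \<open>
  Connects the recursion on lists with the indexed definition of a regular sequence.
\<close>

lemma weakly_regular_genideal:
  assumes "A \<subseteq> carrier R" "set xs \<subseteq> carrier R"
  shows "weakly_regular R (genideal R A) xs \<longleftrightarrow>
    (\<forall>i<length xs. \<forall>a\<in>carrier R.
       xs ! i \<otimes> a \<in> genideal R (A \<union> set (take i xs)) \<longrightarrow> a \<in> genideal R (A \<union> set (take i xs)))"
  using assms
proof (induction xs arbitrary: A)
  case (Cons x xs)
  then have "weakly_regular R (genideal R (insert x A)) xs \<longleftrightarrow>
    (\<forall>i<length xs. \<forall>a\<in>carrier R.
       xs ! i \<otimes> a \<in> genideal R (insert x A \<union> set (take i xs)) \<longrightarrow>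
       a \<in> genideal R (insert x A \<union> set (take i xs)))"
    by simp
  then show ?case using Cons.prems adjoin_genideal[of A x]
    by (simp add: All_less_Suc2)
qed simp

lemma regular_sequence_iff_weakly_regular:
  assumes "set xs \<subseteq> carrier R"
  shows "regular_sequence R xs \<longleftrightarrow>
    weakly_regular R {\<zero>} xs \<and> genideal R (set xs) \<noteq> carrier R"
  using weakly_regular_genideal[of "{}" xs] assms
  by (simp add: regular_sequence_def genideal_empty)

lemma weakly_regular_carrier: "set xs \<subseteq> carrier R \<Longrightarrow> weakly_regular R (carrier R) xs"
proof (induction xs)
  case (Cons x xs)
  then have "adjoin R (carrier R) x = carrier R"
    using adjoin_superset[OF oneideal, of x] adjoin_ideal[OF oneideal, of x] ideal_carrier by auto
  with Cons show ?case by simp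
qed simp

text \<open>
  The sequence \<open>0 \<longrightarrow> R / (N : z) \<longrightarrow> R / N \<longrightarrow> R / (N + (z)) \<longrightarrow> 0\<close>, with first map multiplication by
  \<open>z\<close>, is exact.  If \<open>x\<close> is a nonzerodivisor on both ends, then it is one in the middle, and reducing
  modulo \<open>x\<close> keeps the sequence exact, because \<open>(N + (x)) : z = (N : z) + (x)\<close>; so induction applies.
\<close>

lemma weakly_regular_extension:
  assumes "ideal N R" "z \<in> carrier R" "set xs \<subseteq> carrier R"
    and "weakly_regular R (colon R N z) xs" "weakly_regular R (adjoin R N z) xs"
  shows "weakly_regular R N xs"
  using assms
proof (induction xs arbitrary: N)
  case (Cons x xs)
  note N = \<open>ideal N R\<close> and z = \<open>z \<in> carrier R\<close>
  have x: "x \<in> carrier R" using Cons.prems by simp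
  have "a \<in> N" if a: "a \<in> carrier R" and xa: "x \<otimes> a \<in> N" for a
  proof -
    have "a \<in> adjoin R N z" using Cons.prems a xa adjoin_superset[OF N z] by auto
    then obtain b r where b: "b \<in> N" and r: "r \<in> carrier R" and eq: "a = b \<oplus> r \<otimes> z"
      unfolding adjoin_def by blast
    note bc = ideal_carrier[OF N b]
    have "(x \<otimes> r) \<otimes> z = x \<otimes> a \<ominus> x \<otimes> b" unfolding eq using x z r bc by algebra
    then have "(x \<otimes> r) \<otimes> z \<in> N" using ideal_minus[OF N xa ideal_mult[OF N b x]] by simp
    then have "x \<otimes> r \<in> colon R N z" using x r by (simp add: colon_def)
    then have "r \<in> colon R N z" using Cons.prems r by auto
    then show "a \<in> N" unfolding eq colon_def using ideal_add[OF N b] by simp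
  qed
  moreover have "weakly_regular R (adjoin R N x) xs"
  proof (rule Cons.IH[OF adjoin_ideal[OF N x] z])
    have "colon R (adjoin R N x) z = adjoin R (colon R N z) x"
    proof (intro equalityI subsetI)
      fix c assume "c \<in> colon R (adjoin R N x) z"
      then obtain b s where c: "c \<in> carrier R" and b: "b \<in> N" and s: "s \<in> carrier R"
        and eq: "c \<otimes> z = b \<oplus> s \<otimes> x" unfolding colon_def adjoin_def by blast
      note bc = ideal_carrier[OF N b]
      have "x \<otimes> s = \<ominus> b \<oplus> c \<otimes> z" unfolding eq using x s bc by algebra
      then have "x \<otimes> s \<in> adjoin R N z" unfolding adjoin_def
        using c additive_subgroup.a_inv_closed[OF ideal.axioms(1)[OF N] b] by blast
      then have "s \<in> adjoin R N z" using Cons.prems s by simp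
      then obtain b' t where b': "b' \<in> N" and t: "t \<in> carrier R" and eq': "s = b' \<oplus> t \<otimes> z"
        unfolding adjoin_def by blast
      note bc' = ideal_carrier[OF N b']
      have "(c \<ominus> t \<otimes> x) \<otimes> z = c \<otimes> z \<ominus> t \<otimes> x \<otimes> z" using c t x z by algebra
      also have "\<dots> = b \<oplus> x \<otimes> b'" unfolding eq eq' using bc bc' t x z by algebra
      finally have "(c \<ominus> t \<otimes> x) \<otimes> z \<in> N"
        using ideal_add[OF N b ideal_mult[OF N b' x]] by simp
      then have "c \<ominus> t \<otimes> x \<in> colon R N z" using c t x by (simp add: colon_def)
      moreover have "c = (c \<ominus> t \<otimes> x) \<oplus> t \<otimes> x" using c t x by algebra
      ultimately show "c \<in> adjoin R (colon R N z) x" unfolding adjoin_def using t by blast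
    next
      fix c assume "c \<in> adjoin R (colon R N z) x"
      then obtain b s where c: "b \<in> carrier R" and b: "b \<otimes> z \<in> N" and s: "s \<in> carrier R"
        and eq: "c = b \<oplus> s \<otimes> x" unfolding colon_def adjoin_def by blast
      have "c \<otimes> z = b \<otimes> z \<oplus> (s \<otimes> z) \<otimes> x" unfolding eq using c s x z by algebra
      then show "c \<in> colon R (adjoin R N x) z"
        unfolding colon_def adjoin_def using b c s x z eq by blast
    qed
    then show "weakly_regular R (colon R (adjoin R N x) z) xs" using Cons.prems by simp
    show "weakly_regular R (adjoin R (adjoin R N x) z) xs"
      using Cons.prems adjoin_commute[OF N x z] by simp
  qed (use Cons.prems in auto)
  ultimately show ?case by simp
qed simp

lemma colon_ideal:
  assumes N: "ideal N R" and z: "z \<in> carrier R"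
  shows "ideal (colon R N z) R"
proof (rule ideal_if_closed)
  fix a b assume "a \<in> colon R N z" "b \<in> colon R N z"
  then show "a \<oplus> b \<in> colon R N z"
    using ideal_add[OF N, of "a \<otimes> z" "b \<otimes> z"] z by (simp add: colon_def l_distr)
next
  fix a r assume "a \<in> colon R N z" "r \<in> carrier R"
  then show "r \<otimes> a \<in> colon R N z"
    using ideal_mult[OF N, of "a \<otimes> z" r] z by (simp add: colon_def m_assoc)
qed (use ideal_zero[OF N] z in \<open>auto simp: colon_def\<close>)

end

section \<open>Regular sequences and chains of prime ideals\<close>

context cring
begin

text \<open>
  The maximal condition, the form in which the noetherian hypothesis is used.
\<close>

lemma ideal_family_maximal:
  assumes "noetherian_ring R" "F \<noteq> {}" "\<And>I. I \<in> F \<Longrightarrow> ideal I R"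
  shows "\<exists>M\<in>F. \<forall>I\<in>F. M \<subseteq> I \<longrightarrow> I = M"
proof (rule subset_Zorn_nonempty[OF assms(2)])
  fix C assume C: "C \<noteq> {}" "subset.chain F C"
  then have "subset.chain {I. ideal I R} C"
    using assms(3) by (auto simp: subset_chain_def)
  then have "\<Union>C \<in> C" using noetherian_ring.ideal_chain_is_trivial[OF assms(1) C(1)] by simp
  then show "\<Union>C \<in> F" using C by (auto simp: subset_chain_def)
qed

lemma colon_subset_colon_mult:
  assumes N: "ideal N R" and "a \<in> carrier R" "z \<in> carrier R"
  shows "colon R N z \<subseteq> colon R N (a \<otimes> z)"
proof
  fix x assume "x \<in> colon R N z"
  then show "x \<in> colon R N (a \<otimes> z)"
    using assms ideal_mult[OF N, of "x \<otimes> z" a] by (simp add: colon_def m_lcomm)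
qed

text \<open>
  An annihilator \<open>J : z\<close> which is maximal among those contained in \<open>m\<close> is prime, as for a local
  ring.  Since \<open>R\<close> is not localized at \<open>m\<close>, an element outside \<open>m\<close> plays the part of a unit: if
  \<open>J : az\<close> is not contained in \<open>m\<close>, then \<open>s a z \<in> J\<close> for some \<open>s \<notin> m\<close>, and \<open>J : sz\<close> is as good as \<open>J : z\<close>.
\<close>

lemma ex_prime_colon:
  assumes noeth: "noetherian_ring R" and m: "primeideal m R" and J: "ideal J R"
    and u: "u \<in> carrier R" "colon R J u \<subseteq> m"
  obtains z where "z \<in> carrier R" "colon R J u \<subseteq> colon R J z" "colon R J z \<subseteq> m"
    "primeideal (colon R J z) R"
proof -
  interpret m: primeideal m R by fact
  define F where "F = {colon R J w | w. w \<in> carrier R \<and> colon R J u \<subseteq> colon R J w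
  \<and> colon R J w \<subseteq> m}"
  have "\<exists>Q\<in>F. \<forall>I\<in>F. Q \<subseteq> I \<longrightarrow> I = Q"
    by (rule ideal_family_maximal[OF noeth]) (use u colon_ideal[OF J] in \<open>auto simp: F_def\<close>)
  then obtain Q where "Q \<in> F" and Q: "\<And>I. I \<in> F \<Longrightarrow> Q \<subseteq> I \<Longrightarrow> I = Q" by auto
  then obtain z where z: "z \<in> carrier R" "colon R J u \<subseteq> colon R J z" "colon R J z \<subseteq> m"
    "Q = colon R J z"
    by (auto simp: F_def)
  have max: "colon R J w = colon R J z" if "w \<in> carrier R" "colon R J z \<subseteq> colon R J w"
    "colon R J w \<subseteq> m" for w
    using Q[of "colon R J w"] that z(2) unfolding z(4) F_def by blast
  have "primeideal (colon R J z) R"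
  proof (rule primeidealI[OF colon_ideal[OF J z(1)] is_cring])
    show "carrier R \<noteq> colon R J z" using z m.I_notcarr m.a_subset by blast
    fix a b assume ab: "a \<in> carrier R" "b \<in> carrier R" "a \<otimes> b \<in> colon R J z"
    show "a \<in> colon R J z \<or> b \<in> colon R J z"
    proof (cases "colon R J (a \<otimes> z) \<subseteq> m")
      case True
      have "b \<in> colon R J (a \<otimes> z)"
        using ab z by (simp add: colon_def m_ac)
      moreover have "colon R J (a \<otimes> z) = colon R J z"
        using max[OF _ _ True] ab z colon_subset_colon_mult[OF J] by simp
      ultimately show ?thesis by simp
    next
      case False
      then obtain s where s: "s \<in> carrier R" "s \<otimes> (a \<otimes> z) \<in> J" "s \<notin> m"
        by (auto simp: colon_def)
      have "colon R J (s \<otimes> z) \<subseteq> m"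
      proof
        fix t assume t: "t \<in> colon R J (s \<otimes> z)"
        then have "t \<otimes> s \<in> colon R J z" "t \<in> carrier R" using s z by (auto simp: colon_def m_assoc)
        then show "t \<in> m" using z(3) s m.I_prime by blast
      qed
      then have "colon R J (s \<otimes> z) = colon R J z"
        using max s z colon_subset_colon_mult[OF J] by simp
      moreover have "a \<in> colon R J (s \<otimes> z)" using s ab z by (simp add: colon_def m_ac)
      ultimately show ?thesis by simp
    qed
  qed
  then show thesis using that z(1,2,3) by blast
qed

text \<open>
  Let \<open>P = J : z\<close>.  The elements killed by \<open>P\<close> modulo \<open>J\<close> form a nonzero finitely generated module,
  even after localization at \<open>m\<close>, so by Nakayama's lemma some such \<open>y\<close> does not lie in \<open>J + (x)\<close> locally
  at \<open>m\<close>.  Its annihilator modulo \<open>J + (x)\<close> contains both \<open>P\<close> and \<open>x \<notin> P\<close> and is contained in \<open>m\<close>, and it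
  can be enlarged to a prime annihilator.  In place of Nakayama's lemma, \<open>y\<close> is chosen such
  that the localization of \<open>J + (y)\<close> at \<open>m\<close> is maximal.
\<close>

lemma ex_larger_prime_colon:
  assumes noeth: "noetherian_ring R" and m: "primeideal m R" and J: "ideal J R"
    and z: "z \<in> carrier R" "colon R J z \<subseteq> m"
    and x: "x \<in> m" "\<And>a. a \<in> carrier R \<Longrightarrow> x \<otimes> a \<in> J \<Longrightarrow> a \<in> J"
  obtains z' where "z' \<in> carrier R" "colon R J z \<subset> colon R (adjoin R J x) z'"
    "colon R (adjoin R J x) z' \<subseteq> m" "primeideal (colon R (adjoin R J x) z') R"
proof -
  interpret m: primeideal m R by fact
  have xc: "x \<in> carrier R" using x(1) by (rule m.Icarr)
  note Jx = adjoin_ideal[OF J xc]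
  let ?P = "colon R J z"
  \<comment> \<open>The contraction of the localization of \<open>J + (w)\<close> at \<open>m\<close>.\<close>
  define sat where "sat w = {a \<in> carrier R. \<exists>s\<in>carrier R - m. s \<otimes> a \<in> adjoin R J w}" for w
  have sat_ideal: "ideal (sat w) R" if w: "w \<in> carrier R" for w
  proof (rule ideal_if_closed)
    note Jw = adjoin_ideal[OF J w]
    show "sat w \<subseteq> carrier R" by (auto simp: sat_def)
    have "\<one> \<in> carrier R - m" using m.I_notcarr m.one_imp_carrier by auto
    moreover have "\<one> \<otimes> \<zero> \<in> adjoin R J w" using ideal_zero[OF Jw] by simp
    ultimately show "\<zero> \<in> sat w" unfolding sat_def by blast
    fix a b assume "a \<in> sat w" "b \<in> sat w"
    then obtain s t where st: "s \<in> carrier R - m" "t \<in> carrier R - m"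
      "s \<otimes> a \<in> adjoin R J w" "t \<otimes> b \<in> adjoin R J w" and ab: "a \<in> carrier R" "b \<in> carrier R"
      by (auto simp: sat_def)
    have "(s \<otimes> t) \<otimes> (a \<oplus> b) = t \<otimes> (s \<otimes> a) \<oplus> s \<otimes> (t \<otimes> b)"
      using DiffD1[OF st(1)] DiffD1[OF st(2)] ab by algebra
    then have "(s \<otimes> t) \<otimes> (a \<oplus> b) \<in> adjoin R J w"
      using st ideal_add[OF Jw] ideal_mult[OF Jw] by simp
    moreover have "s \<otimes> t \<in> carrier R - m" using st m.I_prime[of s t] by auto
    ultimately show "a \<oplus> b \<in> sat w" unfolding sat_def using ab by blast
  next
    note Jw = adjoin_ideal[OF J w]
    fix a r assume "a \<in> sat w" and r: "r \<in> carrier R"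
    then obtain s where s: "s \<in> carrier R - m" "s \<otimes> a \<in> adjoin R J w" and a: "a \<in> carrier R"
      by (auto simp: sat_def)
    have "s \<otimes> (r \<otimes> a) = r \<otimes> (s \<otimes> a)" using s a r by (simp add: m_ac)
    then have "s \<otimes> (r \<otimes> a) \<in> adjoin R J w" using ideal_mult[OF Jw s(2) r] by simp
    then show "r \<otimes> a \<in> sat w" unfolding sat_def using s(1) a r by blast
  qed
  define F where "F = {sat w | w. w \<in> carrier R \<and> ?P \<subseteq> colon R J w \<and> colon R J w \<subseteq> m}"
  have "\<exists>Q\<in>F. \<forall>I\<in>F. Q \<subseteq> I \<longrightarrow> I = Q"
    by (rule ideal_family_maximal[OF noeth]) (use z sat_ideal in \<open>auto simp: F_def\<close>)
  then obtain Q where "Q \<in> F" and Q: "\<And>I. I \<in> F \<Longrightarrow> Q \<subseteq> I \<Longrightarrow> I = Q" by auto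
  then obtain y where y: "y \<in> carrier R" "?P \<subseteq> colon R J y" "colon R J y \<subseteq> m" "Q = sat y"
    by (auto simp: F_def)
  have max: "sat w = sat y" if "w \<in> carrier R" "?P \<subseteq> colon R J w" "colon R J w \<subseteq> m"
    "sat y \<subseteq> sat w" for w
    using Q[of "sat w"] that unfolding y(4) F_def by blast
  have "colon R (adjoin R J x) y \<subseteq> m"
  proof (rule ccontr)
    assume "\<not> ?thesis"
    then obtain s where s: "s \<in> carrier R" "s \<notin> m" "s \<otimes> y \<in> adjoin R J x"
      by (auto simp: colon_def)
    then obtain j w where j: "j \<in> J" and w: "w \<in> carrier R" and sy: "s \<otimes> y = j \<oplus> w \<otimes> x"
      unfolding adjoin_def by blast
    note jc = ideal_carrier[OF J j]
    \<comment> \<open>So \<open>w\<close> competes with \<open>y\<close>, and maximality makes \<open>w\<close> a multiple of \<open>y\<close> locally at \<open>m\<close>.\<close>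
    have "?P \<subseteq> colon R J w"
    proof
      fix p assume p: "p \<in> ?P"
      then have pc: "p \<in> carrier R" by (simp add: colon_def)
      have "p \<otimes> y \<in> J" using p y(2) by (auto simp: colon_def)
      moreover have "x \<otimes> (p \<otimes> w) = s \<otimes> (p \<otimes> y) \<ominus> p \<otimes> j"
      proof -
        have "s \<otimes> (p \<otimes> y) = p \<otimes> (s \<otimes> y)" using s y pc by (simp add: m_ac)
        then show ?thesis unfolding sy using pc jc w xc by algebra
      qed
      ultimately have "x \<otimes> (p \<otimes> w) \<in> J"
        using ideal_minus[OF J] ideal_mult[OF J] j s pc by simp
      then show "p \<in> colon R J w" using x(2) pc w by (simp add: colon_def)
    qed
    moreover have "colon R J w \<subseteq> m"
    proof
      fix a assume "a \<in> colon R J w"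
      then have a: "a \<in> carrier R" "a \<otimes> w \<in> J" by (auto simp: colon_def)
      have "(a \<otimes> s) \<otimes> y = a \<otimes> (s \<otimes> y)" using a s y by (simp add: m_ac)
      also have "\<dots> = a \<otimes> j \<oplus> (a \<otimes> w) \<otimes> x" unfolding sy using a jc w xc by algebra
      finally have "(a \<otimes> s) \<otimes> y \<in> J"
        using ideal_add[OF J] ideal_mult[OF J] ideal_mult'[OF J] a j xc by simp
      then have "a \<otimes> s \<in> m" using y(3) a s by (auto simp: colon_def)
      then show "a \<in> m" using m.I_prime a s by blast
    qed
    moreover have "sat y \<subseteq> sat w"
    proof
      fix b assume "b \<in> sat y"
      then obtain t i r where t: "t \<in> carrier R - m" and b: "b \<in> carrier R"
        and i: "i \<in> J" and r: "r \<in> carrier R" and tb: "t \<otimes> b = i \<oplus> r \<otimes> y"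
        unfolding sat_def adjoin_def by blast
      note ic = ideal_carrier[OF J i]
      have "(s \<otimes> t) \<otimes> b = s \<otimes> (t \<otimes> b)" using s t b by (simp add: m_assoc)
      also have "\<dots> = s \<otimes> i \<oplus> r \<otimes> (s \<otimes> y)" unfolding tb using s ic r y(1) by algebra
      also have "\<dots> = (s \<otimes> i \<oplus> r \<otimes> j) \<oplus> (r \<otimes> x) \<otimes> w"
        unfolding sy using s ic r w jc xc by algebra
      finally have "(s \<otimes> t) \<otimes> b \<in> adjoin R J w"
        unfolding adjoin_def using ideal_add[OF J] ideal_mult[OF J] s i r j xc by blast
      moreover have "s \<otimes> t \<in> carrier R - m" using s t m.I_prime[of s t] by auto
      ultimately show "b \<in> sat w" unfolding sat_def using b by blast
    qed
    ultimately have "sat w = sat y" using max w by blast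
    moreover have "w \<in> sat w"
      unfolding sat_def using w adjoin_self[OF J w] m.I_notcarr m.one_imp_carrier
      by (auto intro!: bexI[of _ \<one>])
    ultimately obtain t i r where t: "t \<in> carrier R - m"
        and i: "i \<in> J" and r: "r \<in> carrier R" and tw: "t \<otimes> w = i \<oplus> r \<otimes> y"
        unfolding sat_def adjoin_def by blast
    note ic = ideal_carrier[OF J i]
    note tc = DiffD1[OF t]
    have "(s \<otimes> t \<ominus> x \<otimes> r) \<otimes> y = t \<otimes> (s \<otimes> y) \<ominus> x \<otimes> r \<otimes> y"
      using s(1) tc xc r y(1) by algebra
    also have "\<dots> = t \<otimes> j \<oplus> x \<otimes> (t \<otimes> w) \<ominus> x \<otimes> r \<otimes> y"
      unfolding sy using s(1) tc xc r y(1) jc w by algebra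
    also have "\<dots> = t \<otimes> j \<oplus> x \<otimes> i"
      unfolding tw using s(1) tc xc r y(1) jc ic by algebra
    finally have "(s \<otimes> t \<ominus> x \<otimes> r) \<otimes> y \<in> J"
      using ideal_add[OF J] ideal_mult[OF J] t j xc i by simp
    then have "s \<otimes> t \<ominus> x \<otimes> r \<in> m" using y(3) s t xc r by (auto simp: colon_def)
    moreover have "x \<otimes> r \<in> m" using ideal_mult'[OF m.is_ideal x(1) r] .
    moreover have "s \<otimes> t \<in> carrier R" "x \<otimes> r \<in> carrier R" using s t xc r by auto
    ultimately have "s \<otimes> t \<in> m" using ideal_diff_iff[OF m.is_ideal] by blast
    then show False using s t m.I_prime[of s t] by auto
  qed
  then obtain z' where z': "z' \<in> carrier R" "colon R (adjoin R J x) y \<subseteq> colon R (adjoin R J x) z'"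
    "colon R (adjoin R J x) z' \<subseteq> m" "primeideal (colon R (adjoin R J x) z') R"
    using ex_prime_colon[OF noeth m Jx y(1)] by blast
  have "?P \<subseteq> colon R (adjoin R J x) z'"
    using y(2) z'(2) adjoin_superset[OF J xc] by (auto simp: colon_def)
  moreover have "x \<in> colon R (adjoin R J x) z'"
  proof -
    have "x \<otimes> y \<in> adjoin R J x" using ideal_mult'[OF Jx adjoin_self[OF J xc]] y(1) by simp
    then show ?thesis using z'(2) xc by (auto simp: colon_def)
  qed
  moreover have "x \<notin> ?P"
  proof
    assume "x \<in> ?P"
    then have "z \<in> J" using x(2) z(1) by (auto simp: colon_def)
    then have "\<one> \<in> ?P" using z by (simp add: colon_def)
    then show False using z(2) m.I_notcarr m.one_imp_carrier by blast
  qed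
  ultimately have "?P \<subset> colon R (adjoin R J x) z'" by blast
  then show thesis using that z'(1,3,4) by blast
qed

text \<open>
  Each step along the sequence replaces the annihilator prime by a strictly larger one.  With
  \<open>J : z\<close> of small dimension this bounds the depth from above; with any associated prime in \<open>m\<close>
  it bounds the grade of \<open>m\<close> by its height.
\<close>

theorem weakly_regular_prime_chain:
  assumes noeth: "noetherian_ring R" and m: "primeideal m R"
    and "ideal J R" "z \<in> carrier R" "primeideal (colon R J z) R" "colon R J z \<subseteq> m"
    and "weakly_regular R J xs" "set xs \<subseteq> m"
  shows "\<exists>Q. prime_chain R (length xs) Q \<and> Q 0 = colon R J z \<and> Q (length xs) \<subseteq> m"
  using assms(3-)
proof (induction xs arbitrary: J z)
  case Nil
  then show ?case by (intro exI[of _ "\<lambda>_. colon R J z"]) (auto simp: prime_chain_def)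
next
  case (Cons x xs)
  interpret m: primeideal m R by fact
  have xm: "x \<in> m" and xc: "x \<in> carrier R" using Cons.prems m.Icarr by auto
  obtain z' where z': "z' \<in> carrier R" "colon R J z \<subset> colon R (adjoin R J x) z'"
    "colon R (adjoin R J x) z' \<subseteq> m" "primeideal (colon R (adjoin R J x) z') R"
    using ex_larger_prime_colon[OF noeth m, of J z x] Cons.prems xm by auto
  obtain Q where Q: "prime_chain R (length xs) Q" "Q 0 = colon R (adjoin R J x) z'"
      "Q (length xs) \<subseteq> m"
    using Cons.IH[OF adjoin_ideal[OF Cons.prems(1) xc] z'(1,4,3)] Cons.prems by auto
  define Q' where "Q' i = (case i of 0 \<Rightarrow> colon R J z | Suc j \<Rightarrow> Q j)" for i
  have "prime_chain R (Suc (length xs)) Q'"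
    unfolding prime_chain_def
  proof (intro conjI allI impI)
    fix i assume "i \<le> Suc (length xs)"
    then show "primeideal (Q' i) R"
      using Q Cons.prems(3) by (auto simp: Q'_def prime_chain_def split: nat.split)
  next
    fix i assume "i < Suc (length xs)"
    then show "Q' i \<subset> Q' (Suc i)"
      using Q z'(2) by (cases i) (auto simp: Q'_def prime_chain_def)
  qed
  moreover have "Q' 0 = colon R J z" "Q' (Suc (length xs)) \<subseteq> m" using Q(3) by (simp_all add: Q'_def)
  ultimately show ?case by (intro exI[of _ Q']) simp
qed

end

section \<open>Ideals and surjective homomorphisms\<close>

locale surjective_ring_hom = ring_hom_cring R S h for R (structure) and S (structure) and h +
  assumes surj: "h ` carrier R = carrier S"
begin

definition contract :: "'c set \<Rightarrow> 'a set" where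
  "contract J = {a \<in> carrier R. h a \<in> J}"

lemma contract_ideal: "ideal J S \<Longrightarrow> ideal (contract J) R"
  unfolding contract_def by (rule ring.ideal_vimage)

lemma image_contract: "ideal J S \<Longrightarrow> h ` contract J = J"
proof (intro equalityI subsetI)
  fix y assume J: "ideal J S" and y: "y \<in> J"
  then have "y \<in> h ` carrier R" using surj S.ideal_carrier by simp
  then show "y \<in> h ` contract J" using y by (auto simp: contract_def)
qed (auto simp: contract_def)

lemma contract_strict_mono:
  assumes "ideal J S" "ideal J' S" "J \<subset> J'"
  shows "contract J \<subset> contract J'"
proof -
  have "contract J \<noteq> contract J'"
    using image_contract[OF assms(1)] image_contract[OF assms(2)] assms(3)
      by (metis psubsetE order_refl)
  then show ?thesis using assms(3) by (auto simp: contract_def)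
qed

lemma contract_adjoin:
  assumes N: "ideal N S" and x: "x \<in> carrier R"
  shows "contract (adjoin S N (h x)) = adjoin R (contract N) x"
proof (intro equalityI subsetI)
  fix a assume "a \<in> contract (adjoin S N (h x))"
  then obtain n r where a: "a \<in> carrier R" and n: "n \<in> N" and r: "r \<in> carrier S"
    and eq: "h a = n \<oplus>\<^bsub>S\<^esub> r \<otimes>\<^bsub>S\<^esub> h x" unfolding contract_def adjoin_def by blast
  obtain t where t: "t \<in> carrier R" "r = h t" using surj r by blast
  note nc = S.ideal_carrier[OF N n]
  have hx: "h x \<in> carrier S" "h t \<in> carrier S" using x t by auto
  have "h (a \<ominus> t \<otimes> x) = h a \<ominus>\<^bsub>S\<^esub> h t \<otimes>\<^bsub>S\<^esub> h x" using a t(1) x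
    unfolding R.minus_eq S.minus_eq by simp
  also have "\<dots> = n" unfolding eq t(2) using nc hx by algebra
  finally have "a \<ominus> t \<otimes> x \<in> contract N" unfolding contract_def using n a t x by simp
  moreover have "a = (a \<ominus> t \<otimes> x) \<oplus> t \<otimes> x" using a t(1) x by algebra
  ultimately show "a \<in> adjoin R (contract N) x" unfolding adjoin_def using t(1) by blast
next
  fix a assume "a \<in> adjoin R (contract N) x"
  then obtain n r where n: "n \<in> carrier R" "h n \<in> N" and r: "r \<in> carrier R"
    and eq: "a = n \<oplus> r \<otimes> x" unfolding contract_def adjoin_def by blast
  then have "h a = h n \<oplus>\<^bsub>S\<^esub> h r \<otimes>\<^bsub>S\<^esub> h x" using x by simp
  then show "a \<in> contract (adjoin S N (h x))"
    unfolding contract_def adjoin_def using n r x eq by blast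
qed

text \<open>
  Weak regularity on the quotient can be tested upstairs, where ideals of polynomials are more
  concrete than ideals of cosets.
\<close>

lemma weakly_regular_contract:
  assumes "ideal N S" "set xs \<subseteq> carrier R"
  shows "weakly_regular S N (map h xs) \<longleftrightarrow> weakly_regular R (contract N) xs"
  using assms
proof (induction xs arbitrary: N)
  case (Cons x xs)
  then have x: "x \<in> carrier R" by simp
  have "(\<forall>a\<in>carrier S. h x \<otimes>\<^bsub>S\<^esub> a \<in> N \<longrightarrow> a \<in> N) \<longleftrightarrow>
     (\<forall>a\<in>carrier R. x \<otimes> a \<in> contract N \<longrightarrow> a \<in> contract N)"
    using x unfolding surj[symmetric] by (simp add: contract_def)
  with Cons x show ?case
    using Cons.IH[OF S.adjoin_ideal[OF Cons.prems(1), of "h x"]]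
    by (simp add: contract_adjoin)
qed simp

lemma contract_colon:
  "z \<in> carrier R \<Longrightarrow> contract (colon S N (h z)) = colon R (contract N) z"
  by (auto simp: contract_def colon_def)

lemma contract_prime:
  assumes "primeideal P S"
  shows "primeideal (contract P) R"
proof -
  interpret P: primeideal P S by fact
  show ?thesis
  proof (rule primeidealI[OF contract_ideal[OF P.is_ideal] R.is_cring])
    have "\<one> \<notin> contract P"
      using P.one_imp_carrier P.I_notcarr by (auto simp: contract_def)
    then show "carrier R \<noteq> contract P" by auto
  next
    fix a b assume "a \<in> carrier R" "b \<in> carrier R" "a \<otimes> b \<in> contract P"
    then show "a \<in> contract P \<or> b \<in> contract P"
      using P.I_prime[of "h a" "h b"] by (auto simp: contract_def)
  qed
qed

lemma contract_prime_chain: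
  assumes "prime_chain S r P"
  shows "prime_chain R r (\<lambda>i. contract (P i))"
  unfolding prime_chain_def
proof (intro conjI allI impI)
  fix i assume "i \<le> r"
  then show "primeideal (contract (P i)) R"
    using assms contract_prime by (simp add: prime_chain_def)
next
  fix i assume "i < r"
  then have "primeideal (P i) S" "primeideal (P (Suc i)) S" "P i \<subset> P (Suc i)"
    using assms by (simp_all add: prime_chain_def)
  then show "contract (P i) \<subset> contract (P (Suc i))"
    by (intro contract_strict_mono primeideal.axioms(1))
qed

lemma image_ideal:
  assumes "ideal P R"
  shows "ideal (h ` P) S"
proof (rule S.ideal_if_closed)
  show "h ` P \<subseteq> carrier S" using R.ideal_carrier[OF assms] by auto
  show "\<zero>\<^bsub>S\<^esub> \<in> h ` P" using imageI[OF R.ideal_zero[OF assms], of h] by simp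
next
  fix u w assume "u \<in> h ` P" "w \<in> h ` P"
  then obtain a b where ab: "a \<in> P" "b \<in> P" "u = h a" "w = h b" by blast
  then have "u \<oplus>\<^bsub>S\<^esub> w = h (a \<oplus> b)" using R.ideal_carrier[OF assms] by simp
  then show "u \<oplus>\<^bsub>S\<^esub> w \<in> h ` P" using R.ideal_add[OF assms] ab by blast
next
  fix u s assume "u \<in> h ` P" "s \<in> carrier S"
  then obtain a r where ar: "a \<in> P" "u = h a" "r \<in> carrier R" "s = h r" using surj by blast
  then have "s \<otimes>\<^bsub>S\<^esub> u = h (r \<otimes> a)" using R.ideal_carrier[OF assms] by simp
  then show "s \<otimes>\<^bsub>S\<^esub> u \<in> h ` P" using R.ideal_mult[OF assms] ar by blast
qed

lemma contract_image:
  assumes P: "ideal P R" and ker: "a_kernel R S h \<subseteq> P"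
  shows "contract (h ` P) = P"
proof
  show "P \<subseteq> contract (h ` P)" using R.ideal_carrier[OF P] by (auto simp: contract_def)
  show "contract (h ` P) \<subseteq> P"
  proof
    fix a assume "a \<in> contract (h ` P)"
    then obtain p where a: "a \<in> carrier R" and p: "p \<in> P" and eq: "h a = h p"
      by (auto simp: contract_def)
    note pc = R.ideal_carrier[OF P p]
    have "h (a \<ominus> p) = h a \<oplus>\<^bsub>S\<^esub> \<ominus>\<^bsub>S\<^esub> h p" unfolding R.minus_eq using a pc by simp
    also have "\<dots> = \<zero>\<^bsub>S\<^esub>" unfolding eq using pc S.r_neg[of "h p"] by simp
    finally have "a \<ominus> p \<in> {x \<in> carrier R. h x = \<zero>\<^bsub>S\<^esub>}" using R.minus_closed[OF a pc] by blast
    then have "a \<ominus> p \<in> a_kernel R S h" unfolding a_kernel_def' .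
    then have "a \<ominus> p \<in> P" using ker by blast
    then show "a \<in> P" using R.ideal_diff_iff[OF P a pc] p by simp
  qed
qed

lemma image_prime:
  assumes P: "primeideal P R" and ker: "a_kernel R S h \<subseteq> P"
  shows "primeideal (h ` P) S"
proof -
  interpret P: primeideal P R by fact
  note eq = contract_image[OF P.is_ideal ker]
  show ?thesis
  proof (rule primeidealI[OF image_ideal[OF P.is_ideal] S.is_cring])
    show "carrier S \<noteq> h ` P"
    proof
      assume "carrier S = h ` P"
      then have "contract (h ` P) = carrier R" by (auto simp: contract_def)
      then show False using P.I_notcarr eq by simp
    qed
  next
    fix u w assume "u \<in> carrier S" "w \<in> carrier S" and uw: "u \<otimes>\<^bsub>S\<^esub> w \<in> h ` P"
    then obtain a b where ab: "a \<in> carrier R" "b \<in> carrier R" "u = h a" "w = h b"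
      using surj by blast
    then have "a \<otimes> b \<in> contract (h ` P)" using uw by (simp add: contract_def)
    then have "a \<in> P \<or> b \<in> P" unfolding eq using P.I_prime ab by blast
    then show "u \<in> h ` P \<or> w \<in> h ` P" using ab by blast
  qed
qed

lemma image_prime_chain:
  assumes "prime_chain R r P" "a_kernel R S h \<subseteq> P 0"
  shows "prime_chain S r (\<lambda>i. h ` P i)"
proof -
  have "P 0 \<subseteq> P i" if "i \<le> r" for i
    using that
  proof (induction i)
    case (Suc i)
    then have "P i \<subset> P (Suc i)" using assms(1) by (simp add: prime_chain_def)
    with Suc show ?case by simp
  qed simp
  then have ker: "a_kernel R S h \<subseteq> P i" if "i \<le> r" for i using assms(2) that by blast
  have eq: "contract (h ` P i) = P i" if "i \<le> r" for i
    using contract_image[OF primeideal.axioms(1) ker[OF that]] assms(1) that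
    by (simp add: prime_chain_def)
  show ?thesis
    unfolding prime_chain_def
  proof (intro conjI allI impI)
    fix i assume "i \<le> r"
    then show "primeideal (h ` P i) S" using image_prime ker assms(1) by (simp add: prime_chain_def)
  next
    fix i assume "i < r"
    then have "P i \<subset> P (Suc i)" using assms(1) by (simp add: prime_chain_def)
    moreover have "h ` P i \<noteq> h ` P (Suc i)"
    proof
      assume "h ` P i = h ` P (Suc i)"
      then have "contract (h ` P i) = contract (h ` P (Suc i))" by (rule arg_cong)
      then have "P i = P (Suc i)"
        unfolding eq[OF less_imp_le[OF \<open>i < r\<close>]] eq[OF Suc_leI[OF \<open>i < r\<close>]] .
      then show False using \<open>P i \<subset> P (Suc i)\<close> by simp
    qed
    ultimately show "h ` P i \<subset> h ` P (Suc i)" by blast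
  qed
qed

lemma image_noetherian:
  assumes "noetherian_ring R"
  shows "noetherian_ring S"
proof (rule S.noetherian_ringI)
  fix J assume J: "ideal J S"
  obtain A where A: "A \<subseteq> carrier R" "finite A" "contract J = genideal R A"
    using noetherian_ring.finetely_gen[OF assms contract_ideal[OF J]] by blast
  have hA: "h ` A \<subseteq> carrier S" using A by auto
  have "J = genideal S (h ` A)"
  proof
    have "A \<subseteq> contract (genideal S (h ` A))"
      using A(1) S.genideal_self[OF hA] by (auto simp: contract_def)
    then have "contract J \<subseteq> contract (genideal S (h ` A))"
      unfolding A(3) by (rule R.genideal_minimal[OF contract_ideal[OF S.genideal_ideal[OF hA]]])
    then show "J \<subseteq> genideal S (h ` A)"
      using image_contract[OF J] image_contract[OF S.genideal_ideal[OF hA]] by blast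
    have "A \<subseteq> contract J" using R.genideal_self[OF A(1)] A(3) by simp
    then show "genideal S (h ` A) \<subseteq> J"
      by (intro S.genideal_minimal[OF J]) (auto simp: contract_def)
  qed
  then show "\<exists>A\<subseteq>carrier S. finite A \<and> J = genideal S A"
    using hA A(2) by blast
qed

end

lemma (in cring) quotient_surjective_ring_hom:
  assumes "ideal I R"
  shows "surjective_ring_hom R (R Quot I) ((+>) I)"
proof -
  have "(+>) I ` carrier R = carrier (R Quot I)"
    unfolding FactRing_def A_RCOSETS_def' by auto
  then show ?thesis
    by (intro surjective_ring_hom.intro surjective_ring_hom_axioms.intro
        ideal.rcos_ring_hom_cring[OF assms is_cring])
qed

lemma (in cring) quotient_kernel:
  assumes "ideal I R"
  shows "a_kernel R (R Quot I) ((+>) I) = I"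
proof -
  have "I +> a = I \<longleftrightarrow> a \<in> I" if "a \<in> carrier R" for a
    using a_rcos_zero[OF assms] ideal.rcos_const_imp_mem[OF assms that] by blast
  then have "{a \<in> carrier R. I +> a = I} = I" using ideal_carrier[OF assms] by blast
  then show ?thesis unfolding a_kernel_def' by (simp add: FactRing_def)
qed

section \<open>Polynomials in given variables\<close>

abbreviation (input) "keys \<equiv> Poly_Mapping.keys"
abbreviation (input) "lookup \<equiv> Poly_Mapping.lookup"
abbreviation (input) "single \<equiv> Poly_Mapping.single"

text \<open>
  General \<open>A\<close> instead of \<open>{1..n}\<close> cover polynomials in a single variable and subrings generated by
  algebraically independent variables.
\<close>

definition polys :: "nat set \<Rightarrow> (monomial \<Rightarrow>\<^sub>0 'k::field) set" where
  "polys A = {p. \<forall>m\<in>keys p. keys m \<subseteq> A}"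

lemma keys_monomial_add:
  fixes a b :: monomial
  shows "keys (a + b) = keys a \<union> keys b"
  by (auto simp: in_keys_iff lookup_add)

lemma polys_mono: "A \<subseteq> B \<Longrightarrow> polys A \<subseteq> polys B"
  by (auto simp: polys_def)

lemma polys_0 [simp]: "0 \<in> polys A" and polys_1 [simp]: "1 \<in> polys A"
  by (auto simp: polys_def)

lemma polys_single [simp]: "keys m \<subseteq> A \<Longrightarrow> single m c \<in> polys A"
  by (auto simp: polys_def)

lemma polys_add [simp]: "p \<in> polys A \<Longrightarrow> q \<in> polys A \<Longrightarrow> p + q \<in> polys A"
  using keys_add[of p q] by (auto simp: polys_def)

lemma polys_uminus [simp]: "p \<in> polys A \<Longrightarrow> - p \<in> polys A"
  by (simp add: polys_def)

lemma polys_diff [simp]: "p \<in> polys A \<Longrightarrow> q \<in> polys A \<Longrightarrow> p - q \<in> polys A"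
  using polys_add[of p A "- q"] by simp

lemma polys_mult [simp]:
  assumes "p \<in> polys A" "q \<in> polys A"
  shows "p * q \<in> polys A"
  unfolding polys_def
proof safe
  fix m i assume m: "m \<in> keys (p * q)" and i: "i \<in> keys m"
  obtain a b where "a \<in> keys p" "b \<in> keys q" "m = a + b"
    using keys_mult[of p q] m by blast
  then show "i \<in> A" using assms i by (auto simp: polys_def keys_monomial_add)
qed

lemma polys_power [simp]: "p \<in> polys A \<Longrightarrow> p ^ k \<in> polys A"
  by (induction k) auto

lemma polys_sum: "(\<And>i. i \<in> I \<Longrightarrow> f i \<in> polys A) \<Longrightarrow> sum f I \<in> polys A"
  by (induction I rule: infinite_finite_induct) auto

lemma poly_ring_simps [simp]:
  "carrier (poly_ring K n) = polys {1..n}"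
  "mult (poly_ring K n) = (*)"
  "one (poly_ring K n) = 1"
  "zero (poly_ring K n) = 0"
  "add (poly_ring K n) = (+)"
  by (auto simp: poly_ring_def polys_def)

lemma poly_ring_cring: "cring (poly_ring K n)"
proof (rule cringI)
  show "abelian_group (poly_ring K n)"
    by (rule abelian_groupI) (auto simp: algebra_simps intro: exI[of _ "- _"] bexI[of _ "- _"])
  show "Group.comm_monoid (poly_ring K n)"
    by (rule comm_monoidI) (auto simp: algebra_simps)
qed (auto simp: algebra_simps)

lemma poly_ring_minus:
  assumes "a \<in> polys {1..n}" "b \<in> polys {1..n}"
  shows "a \<ominus>\<^bsub>poly_ring K n\<^esub> b = a - b"
proof -
  interpret cring "poly_ring K n" by (rule poly_ring_cring)
  have "\<ominus>\<^bsub>poly_ring K n\<^esub> b = - b" by (rule minus_equality) (use assms in auto)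
  then show ?thesis by (simp add: a_minus_def)
qed

lemma poly_ideal_subset: "ideal N (poly_ring K n) \<Longrightarrow> N \<subseteq> polys {1..n}"
  using cring.ideal_carrier[OF poly_ring_cring, of N K n] by auto

lemma poly_ideal_zero: "ideal N (poly_ring K n) \<Longrightarrow> 0 \<in> N"
  using cring.ideal_zero[OF poly_ring_cring, of N K n] by simp

lemma poly_ideal_add: "ideal N (poly_ring K n) \<Longrightarrow> a \<in> N \<Longrightarrow> b \<in> N \<Longrightarrow> a + b \<in> N"
  using cring.ideal_add[OF poly_ring_cring, of N K n a b] by simp

lemma poly_ideal_mult: "ideal N (poly_ring K n) \<Longrightarrow> a \<in> N \<Longrightarrow> r \<in> polys {1..n} \<Longrightarrow> r * a \<in> N"
  using cring.ideal_mult[OF poly_ring_cring, of N K n a r] by simp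

lemma poly_ideal_diff: "ideal N (poly_ring K n) \<Longrightarrow> a \<in> N \<Longrightarrow> b \<in> N \<Longrightarrow> a - b \<in> N"
  using cring.ideal_minus[OF poly_ring_cring, of N K n a b] poly_ideal_subset[of N K n]
  by (auto simp: poly_ring_minus subset_iff)

lemma poly_ideal_sum:
  "ideal N (poly_ring K n) \<Longrightarrow> (\<And>i. i \<in> I \<Longrightarrow> f i \<in> N) \<Longrightarrow> sum f I \<in> N"
  by (induction I rule: infinite_finite_induct) (auto intro: poly_ideal_zero poly_ideal_add)

lemma poly_idealI:
  assumes "N \<subseteq> polys {1..n}" "0 \<in> N" "\<And>a b. a \<in> N \<Longrightarrow> b \<in> N \<Longrightarrow> a + b \<in> N"
    "\<And>a r. a \<in> N \<Longrightarrow> r \<in> polys {1..n} \<Longrightarrow> r * a \<in> N"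
  shows "ideal N (poly_ring K n)"
  by (rule cring.ideal_if_closed[OF poly_ring_cring]) (use assms in auto)

lemma adjoin_poly_ring:
  "adjoin (poly_ring K n) N x = {a + r * x | a r. a \<in> N \<and> r \<in> polys {1..n}}"
  by (simp add: adjoin_def)

lemma colon_poly_ring:
  "colon (poly_ring K n) N z = {a \<in> polys {1..n}. a * z \<in> N}"
  by (simp add: colon_def)

section \<open>Leading monomials\<close>

text \<open>
  The leading monomial for the lexicographic order; it is meaningful only for nonzero polynomials.
\<close>

definition lm :: "(monomial \<Rightarrow>\<^sub>0 'k::field) \<Rightarrow> monomial" where
  "lm p = Max (keys p)"

definition mon_divides :: "monomial \<Rightarrow> monomial \<Rightarrow> bool" where
  "mon_divides a b \<longleftrightarrow> (\<forall>i. lookup a i \<le> lookup b i)"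

lemma mon_divides_imp_add: "mon_divides a b \<Longrightarrow> a + (b - a) = b"
  by (rule poly_mapping_eqI) (simp add: mon_divides_def lookup_add lookup_minus)

lemma mon_divides_add [simp]: "mon_divides a (a + b)"
  by (simp add: mon_divides_def lookup_add)

lemma mon_divides_trans: "mon_divides a b \<Longrightarrow> mon_divides b c \<Longrightarrow> mon_divides a c"
  by (meson mon_divides_def order_trans)

lemma monomial_less_iff:
  fixes a b :: monomial
  shows "a < b \<longleftrightarrow> (\<exists>k. lookup a k < lookup b k \<and>
     (\<forall>i<k. lookup a i = lookup b i))"
  by (simp add: less_poly_mapping.rep_eq less_fun_def)

lemma monomial_nonneg:
  fixes a :: monomial
  shows "0 \<le> a"
proof (rule ccontr)
  assume "\<not> 0 \<le> a"
  then have "a < 0" by simp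
  then show False by (simp add: monomial_less_iff)
qed

lemma mon_divides_imp_le:
  assumes "mon_divides a b"
  shows "a \<le> b"
proof -
  have "a + 0 \<le> a + (b - a)" by (rule add_left_mono) (rule monomial_nonneg)
  then show ?thesis using mon_divides_imp_add[OF assms] by simp
qed

lemma lm_in_keys: "p \<noteq> 0 \<Longrightarrow> lm p \<in> keys p"
  unfolding lm_def by (rule Max_in) auto

lemma lm_ge: "m \<in> keys p \<Longrightarrow> m \<le> lm p"
  unfolding lm_def by (rule Max_ge) auto

lemma lm_eqI: "m \<in> keys p \<Longrightarrow> (\<And>k. k \<in> keys p \<Longrightarrow> k \<le> m) \<Longrightarrow> lm p = m"
  unfolding lm_def by (rule Max_eqI) auto

lemma lm_single [simp]: "c \<noteq> 0 \<Longrightarrow> lm (single m c) = m"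
  by (rule lm_eqI) auto

definition lower_terms :: "(monomial \<Rightarrow>\<^sub>0 'k::field) \<Rightarrow> (monomial \<Rightarrow>\<^sub>0 'k)" where
  "lower_terms p = p - single (lm p) (lookup p (lm p))"

lemma lm_lower_terms: "p = single (lm p) (lookup p (lm p)) + lower_terms p"
  by (simp add: lower_terms_def)

lemma keys_lower_terms: "m \<in> keys (lower_terms p) \<Longrightarrow> m \<in> keys p \<and> m < lm p"
  using lm_ge[of m p]
  by (cases "m = lm p") (auto simp: lower_terms_def in_keys_iff lookup_minus lookup_single when_def)

lemma lm_mult:
  assumes "p \<noteq> 0" "q \<noteq> 0"
  shows "lm (p * q) = lm p + lm q"
    "lookup (p * q) (lm p + lm q) =
     lookup p (lm p) * lookup q (lm q)"
proof -
  let ?c = "lookup p (lm p)" and ?d = "lookup q (lm q)"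
  let ?r = "single (lm p) ?c * lower_terms q + lower_terms p * q"
  have eq: "p * q = single (lm p + lm q) (?c * ?d) + ?r"
  proof -
    have "p * q = (single (lm p) ?c + lower_terms p) * q"
      using lm_lower_terms[of p] by simp
    also have "\<dots> = single (lm p) ?c * (single (lm q) ?d + lower_terms q) + lower_terms p * q"
      using lm_lower_terms[of q] by (simp add: algebra_simps)
    also have "\<dots> = single (lm p + lm q) (?c * ?d) + ?r"
      by (simp add: algebra_simps mult_single)
    finally show ?thesis .
  qed
  have r: "m < lm p + lm q" if m: "m \<in> keys ?r" for m
  proof -
    consider "m \<in> keys (single (lm p) ?c * lower_terms q)" | "m \<in> keys (lower_terms p * q)"
      using keys_add[of "single (lm p) ?c * lower_terms q" "lower_terms p * q"] m by blast
    then show ?thesis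
    proof cases
      case 1
      then obtain a b where ab: "a \<in> keys (single (lm p) ?c)"
        "b \<in> keys (lower_terms q)" "m = a + b"
        using keys_mult[of "single (lm p) ?c" "lower_terms q"] by blast
      then have "a = lm p" by (simp split: if_splits)
      then show ?thesis using keys_lower_terms[OF ab(2)] ab(3) by (simp add: add_strict_left_mono)
    next
      case 2
      then obtain a b where ab: "a \<in> keys (lower_terms p)"
        "b \<in> keys q" "m = a + b"
        using keys_mult[of "lower_terms p" q] by blast
      then show ?thesis using keys_lower_terms[OF ab(1)] lm_ge[OF ab(2)]
        by (simp add: add_less_le_mono)
    qed
  qed
  have cd: "?c * ?d \<noteq> 0" using lm_in_keys[OF assms(1)] lm_in_keys[OF assms(2)]
    by (simp add: in_keys_iff)
  have "lookup ?r (lm p + lm q) = 0"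
    using r[of "lm p + lm q"] by (auto simp: in_keys_iff)
  then show lk: "lookup (p * q) (lm p + lm q) = ?c * ?d"
    unfolding eq by (simp add: lookup_add)
  show "lm (p * q) = lm p + lm q"
  proof (rule lm_eqI)
    show "lm p + lm q \<in> keys (p * q)" using lk cd by (simp add: in_keys_iff)
    fix k assume "k \<in> keys (p * q)"
    then have "k \<in> keys (single (lm p + lm q) (?c * ?d) + ?r)"
      using eq by simp
    then consider "k \<in> keys (single (lm p + lm q) (?c * ?d))" | "k \<in> keys ?r"
      using keys_add[of "single (lm p + lm q) (?c * ?d)" ?r] by blast
    then show "k \<le> lm p + lm q"
    proof cases
      case 1
      then show ?thesis by (simp split: if_splits)
    next
      case 2
      then show ?thesis by (intro less_imp_le r)
    qed
  qed
qed

lemma lm_add_distinct: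
  assumes "p \<noteq> 0" "q \<noteq> 0" "lm p \<noteq> lm q"
  shows "lm (p + q) = max (lm p) (lm q)"
proof -
  have *: "lm (p + q) = lm q" if pq: "lm p < lm q" "q \<noteq> 0" for p q :: "monomial \<Rightarrow>\<^sub>0 'a"
  proof (rule lm_eqI)
    have "lm q \<notin> keys p" using lm_ge[of "lm q" p] pq by auto
    then show "lm q \<in> keys (p + q)"
      using lm_in_keys[OF pq(2)] by (simp add: in_keys_iff lookup_add)
    fix k assume "k \<in> keys (p + q)"
    then have "k \<in> keys p \<or> k \<in> keys q" using keys_add[of p q] by blast
    then have "k \<le> lm p \<or> k \<le> lm q" using lm_ge by blast
    then show "k \<le> lm q" using pq(1) by (meson less_imp_le order_trans)
  qed
  show ?thesis
  proof (cases "lm p < lm q")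
    case True
    then show ?thesis using *[of p q] assms by (simp add: max_def)
  next
    case False
    then have "lm q < lm p" using assms(3) by simp
    then show ?thesis using *[of q p] assms by (simp add: max_def add.commute)
  qed
qed

section \<open>Dickson's lemma\<close>

lemma nat_seq_mono_subseq:
  fixes f :: "nat \<Rightarrow> nat"
  obtains \<phi> :: "nat \<Rightarrow> nat" where "strict_mono \<phi>" "mono (f \<circ> \<phi>)"
proof -
  obtain \<psi> :: "nat \<Rightarrow> nat" where \<psi>: "strict_mono \<psi>" "monoseq (\<lambda>n. f (\<psi> n))"
    using seq_monosub[of f] by blast
  from \<psi>(2) consider "\<forall>m. \<forall>n\<ge>m. f (\<psi> m) \<le> f (\<psi> n)" | "\<forall>m. \<forall>n\<ge>m. f (\<psi> n) \<le> f (\<psi> m)"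
    unfolding monoseq_def by blast
  then show thesis
  proof cases
    case 1
    then show thesis using \<psi>(1) that[of \<psi>] by (auto simp: mono_def)
  next
    case 2
    obtain N where N: "\<And>n. f (\<psi> N) \<le> f (\<psi> n)"
      using ex_has_least_nat[of "\<lambda>_. True" 0 "\<lambda>n. f (\<psi> n)"] by blast
    have eq: "f (\<psi> (N + i)) = f (\<psi> N)" for i using N[of "N + i"] 2 by (simp add: order_antisym)
    have "strict_mono (\<lambda>i. \<psi> (N + i))" using \<psi>(1) by (simp add: strict_mono_def)
    moreover have "mono (f \<circ> (\<lambda>i. \<psi> (N + i)))" using eq by (simp add: mono_def)
    ultimately show thesis by (rule that)
  qed
qed

lemma dickson_subseq:
  fixes s :: "nat \<Rightarrow> 'a \<Rightarrow> nat"
  assumes "finite A"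
  shows "\<exists>\<phi>::nat\<Rightarrow>nat. strict_mono \<phi> \<and> (\<forall>k\<in>A. mono (\<lambda>i. s (\<phi> i) k))"
  using assms
proof (induction A)
  case empty
  then show ?case by (intro exI[of _ id]) (simp add: strict_mono_def)
next
  case (insert a A)
  then obtain \<phi> :: "nat \<Rightarrow> nat" where \<phi>: "strict_mono \<phi>" "\<forall>k\<in>A. mono (\<lambda>i. s (\<phi> i) k)" by blast
  obtain \<psi> :: "nat \<Rightarrow> nat" where \<psi>: "strict_mono \<psi>" "mono ((\<lambda>i. s (\<phi> i) a) \<circ> \<psi>)"
    by (rule nat_seq_mono_subseq)
  have "strict_mono (\<phi> \<circ> \<psi>)" using \<phi>(1) \<psi>(1) by (simp add: strict_mono_def)
  moreover have "mono (\<lambda>i. s ((\<phi> \<circ> \<psi>) i) k)" if "k \<in> insert a A" for k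
    using that \<phi>(2) \<psi> by (auto simp: mono_def strict_mono_less_eq comp_def)
  ultimately show ?case by blast
qed

lemma dickson:
  fixes s :: "nat \<Rightarrow> monomial"
  assumes "finite A" "\<And>i. keys (s i) \<subseteq> A"
  obtains i j where "i < j" "mon_divides (s i) (s j)"
proof -
  obtain \<phi> :: "nat \<Rightarrow> nat" where \<phi>: "strict_mono \<phi>" "\<forall>k\<in>A. mono (\<lambda>i. lookup (s (\<phi> i)) k)"
    using dickson_subseq[OF assms(1), of "\<lambda>i. lookup (s i)"] by blast
  have "mon_divides (s (\<phi> 0)) (s (\<phi> 1))"
    unfolding mon_divides_def
  proof
    fix k
    show "lookup (s (\<phi> 0)) k \<le> lookup (s (\<phi> 1)) k"
    proof (cases "k \<in> A")
      case True
      then show ?thesis using \<phi>(2) by (simp add: mono_def)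
    next
      case False
      then have "k \<notin> keys (s (\<phi> 0))" using assms(2) by blast
      then show ?thesis by (simp add: in_keys_iff)
    qed
  qed
  moreover have "\<phi> 0 < \<phi> 1" using \<phi>(1) by (simp add: strict_mono_def)
  ultimately show thesis using that by blast
qed

text \<open>
  An infinite descending sequence would contain a monomial which divides a later, hence smaller one.
\<close>

lemma monomial_order_wf:
  assumes "finite A"
  shows "wf {(a :: monomial, b). a < b \<and> keys a \<subseteq> A \<and> keys b \<subseteq> A}"
  unfolding wf_iff_no_infinite_down_chain
proof
  assume "\<exists>s. \<forall>i. (s (Suc i), s i) \<in> {(a :: monomial, b). a < b \<and> keys a \<subseteq> A \<and> keys b \<subseteq> A}"
  then obtain s :: "nat \<Rightarrow> monomial" where s: "\<And>i. s (Suc i) < s i" "\<And>i. keys (s i) \<subseteq> A"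
    by auto
  obtain i j where ij: "i < j" "mon_divides (s i) (s j)"
    using dickson[OF assms, of s] s(2) by blast
  have "s j < s i" using ij(1)
  proof (induction rule: less_Suc_induct)
    case (1 i)
    then show ?case by (rule s(1))
  qed (rule less_trans)
  then show False using mon_divides_imp_le[OF ij(2)] by simp
qed

section \<open>Leading monomials of ideals\<close>

text \<open>
  The elements of \<open>Z\<close> are available for reduction modulo \<open>N\<close>, whether or not they suffice to
  detect membership in \<open>N\<close>.
\<close>

definition leading_monomials_in :: "(monomial \<Rightarrow>\<^sub>0 'k::field) set \<Rightarrow> monomial set \<Rightarrow> bool" where
  "leading_monomials_in N Z \<longleftrightarrow> (\<forall>z\<in>Z. \<exists>g\<in>N. g \<noteq> 0 \<and> lm g = z)"

text \<open>
  \<open>Z\<close> generates the initial ideal of \<open>N\<close>: polynomials in \<open>N\<close> with leading monomials \<open>Z\<close> form a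
  Groebner basis.
\<close>

definition generates_initial :: "(monomial \<Rightarrow>\<^sub>0 'k::field) set \<Rightarrow> monomial set \<Rightarrow> bool" where
  "generates_initial N Z \<longleftrightarrow> leading_monomials_in N Z \<and> (\<forall>p\<in>N. p \<noteq> 0 \<longrightarrow> (\<exists>z\<in>Z. mon_divides z (lm p)))"

lemma cancel_leading_term:
  assumes N: "ideal N (poly_ring K n)" and p: "p \<in> polys {1..n}" "p \<noteq> 0"
    and g: "g \<in> N" "g \<noteq> 0" "mon_divides (lm g) (lm p)"
  obtains p' where "p' \<in> polys {1..n}" "p - p' \<in> N" "p' = 0 \<or> lm p' < lm p"
proof -
  let ?c = "lookup p (lm p) / lookup g (lm g)"
  let ?t = "single (lm p - lm g) ?c"
  have gc: "lookup g (lm g) \<noteq> 0" and pc: "lookup p (lm p) \<noteq> 0"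
    using lm_in_keys[OF g(2)] lm_in_keys[OF p(2)] by (simp_all add: in_keys_iff)
  then have c: "?c \<noteq> 0" by simp
  have eq: "lm p - lm g + lm g = lm p" using mon_divides_imp_add[OF g(3)] by (simp add: add.commute)
  have t: "?t \<noteq> 0" "lm ?t = lm p - lm g" using c
    by (auto simp: poly_mapping_eq_iff fun_eq_iff lookup_single)
  have lmtg: "lm (?t * g) = lm p" "lookup (?t * g) (lm p) = lookup p (lm p)"
    using lm_mult[OF t(1) g(2)] t(2) eq gc by simp_all
  have "keys (lm p - lm g) \<subseteq> keys (lm p)"
    by (auto simp: in_keys_iff lookup_minus)
  moreover have "keys (lm p) \<subseteq> {1..n}"
    using lm_in_keys[OF p(2)] p(1) by (auto simp: polys_def)
  ultimately have "?t \<in> polys {1..n}" by (intro polys_single) blast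
  then have tg: "?t * g \<in> N" using poly_ideal_mult[OF N g(1)] by blast
  have "lm (p - ?t * g) < lm p" if "p - ?t * g \<noteq> 0"
  proof -
    let ?m = "lm (p - ?t * g)"
    have m: "?m \<in> keys (p - ?t * g)" using lm_in_keys that by blast
    then have "?m \<in> keys p \<or> ?m \<in> keys (?t * g)"
      by (auto simp: in_keys_iff lookup_minus)
    then have "?m \<le> lm p" using lm_ge[of ?m p] lm_ge[of ?m "?t * g"] lmtg(1) by auto
    moreover have "?m \<noteq> lm p" using m lmtg(2) by (auto simp: in_keys_iff lookup_minus)
    ultimately show ?thesis by simp
  qed
  moreover have "p - ?t * g \<in> polys {1..n}"
    using p(1) tg poly_ideal_subset[OF N] by auto
  ultimately show thesis using tg by (intro that[of "p - ?t * g"]) auto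
qed

text \<open>
  Only the leading monomial has to become irreducible: each reduction step lowers it, and the
  order is well-founded.
\<close>

lemma leading_reduction:
  assumes N: "ideal N (poly_ring K n)" and Z: "leading_monomials_in N Z" and a: "a \<in> polys {1..n}"
  shows "\<exists>a'\<in>polys {1..n}. a - a' \<in> N \<and> (a' = 0 \<or> (\<forall>z\<in>Z. \<not> mon_divides z (lm a')))"
proof -
  let ?r = "{(a :: monomial, b). a < b \<and> keys a \<subseteq> {1..n} \<and> keys b \<subseteq> {1..n}}"
  have lmk: "keys (lm p) \<subseteq> {1..n}" if "p \<in> polys {1..n}" "p \<noteq> 0" for p :: "monomial \<Rightarrow>\<^sub>0 'a"
    using lm_in_keys[OF that(2)] that(1) by (auto simp: polys_def)
  have "wf ?r" by (rule monomial_order_wf) simp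
  then show ?thesis using a
  proof (induction "lm a" arbitrary: a rule: wf_induct_rule)
    case less
    show ?case
    proof (cases "a = 0 \<or> (\<forall>z\<in>Z. \<not> mon_divides z (lm a))")
      case True
      then show ?thesis using less.prems poly_ideal_zero[OF N] by (intro bexI[of _ a]) auto
    next
      case False
      then obtain z where z: "z \<in> Z" "mon_divides z (lm a)" by blast
      then obtain g where "g \<in> N" "g \<noteq> 0" "lm g = z"
        using Z unfolding leading_monomials_in_def by blast
      with z have g: "g \<in> N" "g \<noteq> 0" "mon_divides (lm g) (lm a)" by simp_all
      obtain b where b: "b \<in> polys {1..n}" "a - b \<in> N" "b = 0 \<or> lm b < lm a"
        using cancel_leading_term[OF N less.prems _ g] False by blast
      show ?thesis
      proof (cases "b = 0")
        case True
        then show ?thesis using b by (intro bexI[of _ 0]) auto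
      next
        case nz: False
        then have "(lm b, lm a) \<in> ?r" using b lmk less.prems False by auto
        then obtain c where c: "c \<in> polys {1..n}" "b - c \<in> N"
          "c = 0 \<or> (\<forall>z\<in>Z. \<not> mon_divides z (lm c))"
          using less.hyps b(1) by blast
        have "a - c \<in> N" using poly_ideal_add[OF N b(2) c(2)] by simp
        then show ?thesis using c by blast
      qed
    qed
  qed
qed

text \<open>
  By Dickson's lemma finitely many leading monomials of elements of an ideal divide all the others,
  and reduction by the corresponding polynomials ends at zero.
\<close>

theorem poly_ring_noetherian: "noetherian_ring (poly_ring (K :: 'k::field itself) n)"
proof -
  interpret cring "poly_ring K n" by (rule poly_ring_cring)
  show ?thesis
  proof (rule noetherian_ringI)
    fix I assume I: "ideal I (poly_ring K n)"
    define L where "L = {lm p | p. p \<in> I \<and> p \<noteq> 0}"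
    have Lk: "keys l \<subseteq> {1..n}" if "l \<in> L" for l
      using that lm_in_keys poly_ideal_subset[OF I] unfolding L_def polys_def by blast
    have "\<exists>Z\<subseteq>L. finite Z \<and> (\<forall>l\<in>L. \<exists>z\<in>Z. mon_divides z l)"
    proof (rule ccontr)
      assume "\<not> ?thesis"
      then have *: "\<exists>l\<in>L. \<forall>z\<in>Z. \<not> mon_divides z l" if "finite Z" "Z \<subseteq> L" for Z
        using that by blast
      define pick where "pick Z = (SOME l. l \<in> L \<and> (\<forall>z\<in>Z. \<not> mon_divides z l))" for Z
      have pick: "pick Z \<in> L" "\<And>z. z \<in> Z \<Longrightarrow> \<not> mon_divides z (pick Z)" if "finite Z" "Z \<subseteq> L" for Z
        using someI_ex[of "\<lambda>l. l \<in> L \<and> (\<forall>z\<in>Z. \<not> mon_divides z l)"] *[OF that]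
        unfolding pick_def by blast+
      define T where "T = rec_nat ({} :: monomial set) (\<lambda>_ Z. insert (pick Z) Z)"
      have T0: "T 0 = {}" and TS: "T (Suc i) = insert (pick (T i)) (T i)" for i
        by (simp_all add: T_def)
      have fin: "finite (T i) \<and> T i \<subseteq> L" for i
        by (induction i) (auto simp: T0 TS pick)
      have mono: "T i \<subseteq> T j" if "i \<le> j" for i j
        by (rule lift_Suc_mono_le[OF _ that]) (auto simp: TS)
      obtain i j where ij: "i < j" "mon_divides (pick (T i)) (pick (T j))"
        using dickson[of "{1..n}" "\<lambda>i. pick (T i)"] Lk pick(1) fin by (metis finite_atLeastAtMost)
      have "pick (T i) \<in> T j" using mono[of "Suc i" j] ij(1) by (auto simp: TS)
      then show False using pick(2) fin ij(2) by blast
    qed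
    then obtain Z where Z: "Z \<subseteq> L" "finite Z" "\<forall>l\<in>L. \<exists>z\<in>Z. mon_divides z l" by blast
    have "\<forall>z\<in>Z. \<exists>p. p \<in> I \<and> p \<noteq> 0 \<and> lm p = z" using Z(1) unfolding L_def by blast
    then obtain g where g: "\<And>z. z \<in> Z \<Longrightarrow> g z \<in> I \<and> g z \<noteq> 0 \<and> lm (g z) = z" by metis
    have gI: "g ` Z \<subseteq> I" using g by auto
    have gc: "g ` Z \<subseteq> carrier (poly_ring K n)" using gI poly_ideal_subset[OF I] by simp
    let ?J = "genideal (poly_ring K n) (g ` Z)"
    note J = genideal_ideal[OF gc]
    have JI: "?J \<subseteq> I" by (rule genideal_minimal[OF I gI])
    have lead: "leading_monomials_in ?J Z"
      using g genideal_self[OF gc] unfolding leading_monomials_in_def by blast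
    have "I \<subseteq> ?J"
    proof
      fix a assume a: "a \<in> I"
      then obtain a' where a': "a - a' \<in> ?J" "a' = 0 \<or> (\<forall>z\<in>Z. \<not> mon_divides z (lm a'))"
        using leading_reduction[OF J lead, of a] poly_ideal_subset[OF I] by blast
      have "a - (a - a') \<in> I" using poly_ideal_diff[OF I a] a'(1) JI by blast
      then have "a' \<in> I" by simp
      then have "a' = 0" using a'(2) Z(3) unfolding L_def by blast
      then show "a \<in> ?J" using a'(1) by simp
    qed
    then have "I = ?J" using JI by blast
    then show "\<exists>A\<subseteq>carrier (poly_ring K n). finite A \<and> I = genideal (poly_ring K n) A"
      using gc Z(2) by blast
  qed
qed

lemma coprime_leading_monomial_dvd_add:
  assumes "mon_divides z (l + m)" "keys z \<inter> keys l = {}"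
  shows "mon_divides z m"
  unfolding mon_divides_def
proof
  fix i
  show "lookup z i \<le> lookup m i"
  proof (cases "i \<in> keys z")
    case True
    then have "i \<notin> keys l" using assms(2) by blast
    then show ?thesis using assms(1) by (simp add: mon_divides_def lookup_add in_keys_iff)
             (metis add_cancel_right_left)
  qed (simp add: in_keys_iff)
qed

text \<open>
  Adding to an ideal a polynomial \<open>f\<close> whose leading monomial is coprime to the initial ideal adds
  to the initial ideal just \<open>lm f\<close>, the coprime case of Buchberger's criterion.  In \<open>w + f a\<close> with
  \<open>w \<in> N\<close> one may take \<open>a\<close> reduced modulo \<open>N\<close>; by coprimality \<open>lm f + lm a\<close> is then not divisible by any
  leading monomial of \<open>N\<close>, so it does not cancel against \<open>lm w\<close>.
\<close>

lemma coprime_leading_monomial_step: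
  assumes N: "ideal N (poly_ring K n)" and Z: "generates_initial N Z"
    and f: "f \<in> polys {1..n}" "f \<noteq> 0"
    and coprime: "\<And>z. z \<in> Z \<Longrightarrow> keys z \<inter> keys (lm f) = {}"
  shows "a \<in> polys {1..n} \<Longrightarrow> f * a \<in> N \<Longrightarrow> a \<in> N"
    and "generates_initial (adjoin (poly_ring K n) N f) (insert (lm f) Z)"
proof -
  have lead: "leading_monomials_in N Z" using Z by (simp add: generates_initial_def)
  show "a \<in> N" if a: "a \<in> polys {1..n}" "f * a \<in> N" for a
  proof -
    obtain a' where a': "a' \<in> polys {1..n}" "a - a' \<in> N" "a' = 0 \<or> (\<forall>z\<in>Z. \<not> mon_divides z (lm a'))"
      using leading_reduction[OF N lead a(1)] by blast
    have "f * a - f * (a - a') \<in> N"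
      by (intro poly_ideal_diff[OF N] poly_ideal_mult[OF N] a a' f)
    then have fa': "f * a' \<in> N" by (simp add: algebra_simps)
    have "a' = 0"
    proof (rule ccontr)
      assume nz: "a' \<noteq> 0"
      then obtain z where z: "z \<in> Z" "mon_divides z (lm (f * a'))"
        using Z fa' f(2) unfolding generates_initial_def by force
      then have "mon_divides z (lm a')"
        using coprime[OF z(1)] coprime_leading_monomial_dvd_add by (simp add: lm_mult f nz)
      then show False using a'(3) nz z(1) by blast
    qed
    then show ?thesis using a'(2) by simp
  qed
  interpret cring "poly_ring K n" by (rule poly_ring_cring)
  have fc: "f \<in> carrier (poly_ring K n)" using f by simp
  show "generates_initial (adjoin (poly_ring K n) N f) (insert (lm f) Z)"
    unfolding generates_initial_def
  proof (intro conjI ballI impI)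
    show "leading_monomials_in (adjoin (poly_ring K n) N f) (insert (lm f) Z)"
      using lead adjoin_superset[OF N fc] adjoin_self[OF N fc] f(2)
      unfolding leading_monomials_in_def by blast
  next
    fix p assume "p \<in> adjoin (poly_ring K n) N f" and nz: "p \<noteq> 0"
    then obtain u r where u: "u \<in> N" and r: "r \<in> polys {1..n}" and p: "p = u + r * f"
      unfolding adjoin_poly_ring by blast
    obtain a where a: "a \<in> polys {1..n}" "r - a \<in> N" "a = 0 \<or> (\<forall>z\<in>Z. \<not> mon_divides z (lm a))"
      using leading_reduction[OF N lead r] by blast
    define w where "w = u + f * (r - a)"
    have w: "w \<in> N" unfolding w_def
      by (intro poly_ideal_add[OF N] poly_ideal_mult[OF N] u a f)
    have p': "p = w + f * a" by (simp add: p w_def algebra_simps)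
    have Zw: "\<exists>z\<in>Z. mon_divides z (lm w)" if "w \<noteq> 0" using Z w that
      by (simp add: generates_initial_def)
    show "\<exists>z\<in>insert (lm f) Z. mon_divides z (lm p)"
    proof (cases "a = 0")
      case True
      then show ?thesis using Zw p' nz by auto
    next
      case a0: False
      have fa: "f * a \<noteq> 0" "lm (f * a) = lm f + lm a" using f a0 by (auto simp: lm_mult)
      then have div: "mon_divides (lm f) (lm (f * a))" by simp
      show ?thesis
      proof (cases "w = 0")
        case True
        then show ?thesis using p' div by auto
      next
        case False
        then obtain z where z: "z \<in> Z" "mon_divides z (lm w)" using Zw by blast
        have "lm w \<noteq> lm (f * a)"
        proof
          assume "lm w = lm (f * a)"
          then have "mon_divides z (lm a)"
            using z coprime[OF z(1)] coprime_leading_monomial_dvd_add fa(2) by simp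
          then show False using a(3) a0 z(1) by blast
        qed
        then have "lm p = lm w \<or> lm p = lm (f * a)"
          unfolding p' using lm_add_distinct[OF False fa(1)] by (auto simp: max_def)
        then show ?thesis using z div by auto
      qed
    qed
  qed
qed

theorem coprime_leading_monomials_weakly_regular:
  assumes "ideal N (poly_ring K n)" "generates_initial N Z"
    and "set fs \<subseteq> polys {1..n} - {0}"
    and "\<And>z f. z \<in> Z \<Longrightarrow> f \<in> set fs \<Longrightarrow> keys z \<inter> keys (lm f) = {}"
    and "sorted_wrt (\<lambda>f g. keys (lm f) \<inter> keys (lm g) = {}) fs"
  shows "weakly_regular (poly_ring K n) N fs"
  using assms
proof (induction fs arbitrary: N Z)
  case (Cons f fs)
  interpret cring "poly_ring K n" by (rule poly_ring_cring)
  have f: "f \<in> polys {1..n}" "f \<noteq> 0" using Cons.prems by auto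
  note step = coprime_leading_monomial_step[OF Cons.prems(1,2) f]
  have "weakly_regular (poly_ring K n) (adjoin (poly_ring K n) N f) fs"
    by (rule Cons.IH[OF adjoin_ideal[OF Cons.prems(1)] step(2)]) (use Cons.prems in auto)
  moreover have "\<forall>a\<in>carrier (poly_ring K n). f \<otimes>\<^bsub>poly_ring K n\<^esub> a \<in> N \<longrightarrow> a \<in> N"
    using step(1) Cons.prems(4) by simp
  ultimately show ?case by simp
qed simp

section \<open>Monomial ideals\<close>

definition up_closed :: "'a set set \<Rightarrow> bool" where
  "up_closed \<N> \<longleftrightarrow> (\<forall>A B. A \<in> \<N> \<longrightarrow> A \<subseteq> B \<longrightarrow> B \<in> \<N>)"

text \<open>
  The span of the monomials with support in \<open>\<N>\<close>, an ideal if \<open>\<N>\<close> is closed under supersets.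
  All ideals generated by squarefree monomials are of this form, and sums and colon ideals become
  set operations.
\<close>

definition mon_ideal :: "nat \<Rightarrow> nat set set \<Rightarrow> (monomial \<Rightarrow>\<^sub>0 'k::field) set" where
  "mon_ideal n \<N> = {p \<in> polys {1..n}. \<forall>m\<in>keys p. keys m \<in> \<N>}"

definition face_ideal :: "nat \<Rightarrow> nat set \<Rightarrow> (monomial \<Rightarrow>\<^sub>0 'k::field) set" where
  "face_ideal n F = mon_ideal n {A. \<not> A \<subseteq> F}"

lemma up_closed_not_subset [simp]: "up_closed {A. \<not> A \<subseteq> F}"
  by (auto simp: up_closed_def)

lemma mon_ideal_ideal:
  assumes "up_closed \<N>"
  shows "ideal (mon_ideal n \<N>) (poly_ring K n)"
proof (rule poly_idealI)
  show "a + b \<in> mon_ideal n \<N>"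
    if "a \<in> mon_ideal n \<N>" "b \<in> mon_ideal n \<N>" for a b :: "monomial \<Rightarrow>\<^sub>0 'a"
    using that keys_add[of a b] by (auto simp: mon_ideal_def)
next
  fix a r :: "monomial \<Rightarrow>\<^sub>0 'a" assume a: "a \<in> mon_ideal n \<N>" and r: "r \<in> polys {1..n}"
  have "keys m \<in> \<N>" if m: "m \<in> keys (r * a)" for m
  proof -
    obtain u w where uw: "w \<in> keys a" "m = u + w"
      using keys_mult[of r a] m by blast
    have "keys w \<in> \<N>" using a uw(1) by (simp add: mon_ideal_def)
    moreover have "keys w \<subseteq> keys m" using uw(2) by (simp add: keys_monomial_add)
    ultimately show ?thesis using assms unfolding up_closed_def by blast
  qed
  then show "r * a \<in> mon_ideal n \<N>" using a r by (simp add: mon_ideal_def)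
qed (auto simp: mon_ideal_def)

lemma face_ideal_ideal: "ideal (face_ideal n F) (poly_ring K n)"
  unfolding face_ideal_def by (rule mon_ideal_ideal) simp

definition restrict_poly :: "(monomial \<Rightarrow> bool) \<Rightarrow> (monomial \<Rightarrow>\<^sub>0 'k::field) \<Rightarrow> (monomial \<Rightarrow>\<^sub>0 'k)" where
  "restrict_poly P p = (\<Sum>m\<in>{m \<in> keys p. P m}. single m (lookup p m))"

lemma lookup_restrict_poly:
  "lookup (restrict_poly P p) m = (if P m then lookup p m else 0)"
proof -
  have "lookup (restrict_poly P p) m =
    (\<Sum>k\<in>{k \<in> keys p. P k}. if k = m then lookup p k else 0)"
    by (simp add: restrict_poly_def lookup_sum lookup_single when_def)
  also have "\<dots> = (if P m then lookup p m else 0)"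
    by (simp add: sum.delta' in_keys_iff)
  finally show ?thesis .
qed

lemma keys_restrict_poly:
  "keys (restrict_poly P p) = {m \<in> keys p. P m}"
  by (auto simp: in_keys_iff lookup_restrict_poly split: if_splits)

lemma keys_diff_restrict_poly:
  "keys (p - restrict_poly P p) = {m \<in> keys p. \<not> P m}"
  by (auto simp: in_keys_iff lookup_restrict_poly lookup_minus split: if_splits)

lemma restrict_poly_in_polys [simp]: "p \<in> polys A \<Longrightarrow> restrict_poly P p \<in> polys A"
  by (auto simp: polys_def keys_restrict_poly)

lemma diff_restrict_poly_in_mon_ideal:
  "p \<in> polys {1..n} \<Longrightarrow> p - restrict_poly (\<lambda>m. keys m \<notin> \<N>) p \<in> mon_ideal n \<N>"
  by (simp add: mon_ideal_def keys_diff_restrict_poly)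

text \<open>
  Restricting two polynomials to monomials supported on \<open>F\<close> changes neither their classes nor the
  class of their product, and there are no zero divisors among polynomials in the variables of \<open>F\<close>.
\<close>

lemma face_ideal_prime: "primeideal (face_ideal n F) (poly_ring K n)"
proof (rule primeidealI[OF face_ideal_ideal poly_ring_cring])
  have "(1 :: monomial \<Rightarrow>\<^sub>0 'a) \<notin> face_ideal n F" by (simp add: face_ideal_def mon_ideal_def)
  then show "carrier (poly_ring K n) \<noteq> face_ideal n F" by auto
  fix a b assume ab: "a \<in> carrier (poly_ring K n)" "b \<in> carrier (poly_ring K n)"
    "a \<otimes>\<^bsub>poly_ring K n\<^esub> b \<in> face_ideal n F"
  let ?r = "restrict_poly (\<lambda>m. keys m \<subseteq> F)"
  note I = face_ideal_ideal[of n F K]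
  have r: "p - ?r p \<in> face_ideal n F" if "p \<in> polys {1..n}" for p :: "monomial \<Rightarrow>\<^sub>0 'a"
    using diff_restrict_poly_in_mon_ideal[OF that, of "{A. \<not> A \<subseteq> F}"] by (simp add: face_ideal_def)
  have "b * (a - ?r a) + ?r a * (b - ?r b) \<in> face_ideal n F"
    using ab by (intro poly_ideal_add[OF I] poly_ideal_mult[OF I] r) auto
  with ab have "a * b - (b * (a - ?r a) + ?r a * (b - ?r b)) \<in> face_ideal n F"
    by (intro poly_ideal_diff[OF I]) auto
  then have rr: "?r a * ?r b \<in> face_ideal n F" by (simp add: algebra_simps)
  have "?r a * ?r b = 0"
  proof (rule ccontr)
    assume "?r a * ?r b \<noteq> 0"
    then obtain m where m: "m \<in> keys (?r a * ?r b)" using lm_in_keys by blast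
    then obtain u w where "u \<in> keys (?r a)" "w \<in> keys (?r b)" "m = u + w"
      using keys_mult[of "?r a" "?r b"] by blast
    then have "keys m \<subseteq> F" by (auto simp: keys_restrict_poly keys_monomial_add)
    moreover have "\<not> keys m \<subseteq> F" using rr m unfolding face_ideal_def mon_ideal_def by blast
    ultimately show False by blast
  qed
  then have "?r a = 0 \<or> ?r b = 0" by simp
  then show "a \<in> face_ideal n F \<or> b \<in> face_ideal n F"
    using r[of a] r[of b] ab by auto
qed

lemma single_nonzero [simp]: "c \<noteq> 0 \<Longrightarrow> single m c \<noteq> 0"
  by (metis lookup_single_eq lookup_zero)

lemma face_ideal_generates_initial:
  "generates_initial (face_ideal n F) ((\<lambda>j. single j 1) ` ({1..n} - F))"
  unfolding generates_initial_def leading_monomials_in_def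
proof (intro conjI ballI impI)
  fix z assume "z \<in> (\<lambda>j. single j (1::nat)) ` ({1..n} - F)"
  then obtain j where j: "j \<in> {1..n} - F" "z = single j 1" by blast
  then show "\<exists>g\<in>face_ideal n F. g \<noteq> 0 \<and> lm g = z"
    by (intro bexI[of _ "single z 1"]) (auto simp: face_ideal_def mon_ideal_def)
next
  fix p :: "monomial \<Rightarrow>\<^sub>0 'a" assume p: "p \<in> face_ideal n F" "p \<noteq> 0"
  then have "\<not> keys (lm p) \<subseteq> F" "keys (lm p) \<subseteq> {1..n}"
    using lm_in_keys[OF p(2)] unfolding face_ideal_def mon_ideal_def polys_def by blast+
  then obtain j where j: "j \<in> keys (lm p)" "j \<notin> F" "j \<in> {1..n}" by blast
  then have "mon_divides (single j 1) (lm p)"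
    by (auto simp: mon_divides_def lookup_single when_def in_keys_iff)
  then show "\<exists>z\<in>(\<lambda>j. single j 1) ` ({1..n} - F). mon_divides z (lm p)"
    using j by blast
qed

section \<open>Complete homogeneous symmetric polynomials\<close>

text \<open>
  The complete homogeneous symmetric polynomial of degree \<open>r\<close>, evaluated at the entries of a list.
\<close>

fun complete_hom :: "nat \<Rightarrow> 'a::comm_ring_1 list \<Rightarrow> 'a" where
  "complete_hom 0 xs = 1"
| "complete_hom (Suc r) [] = 0"
| "complete_hom (Suc r) (a # xs) = complete_hom (Suc r) xs + a * complete_hom r (a # xs)"

lemma complete_hom_in_polys [simp]: "set xs \<subseteq> polys A \<Longrightarrow> complete_hom r xs \<in> polys A"
  by (induction r xs rule: complete_hom.induct) auto

lemma complete_hom_in_ideal: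
  assumes N: "ideal N (poly_ring K n)" and "set xs \<subseteq> N"
  shows "complete_hom (Suc r) xs \<in> N"
  using assms(2)
proof (induction xs)
  case Nil
  then show ?case using poly_ideal_zero[OF N] by simp
next
  case (Cons a xs)
  then have "complete_hom r (a # xs) \<in> polys {1..n}" using poly_ideal_subset[OF N]
    by (intro complete_hom_in_polys) auto
  then have "complete_hom r (a # xs) * a \<in> N" using Cons.prems by (intro poly_ideal_mult[OF N]) auto
  then show ?case using Cons poly_ideal_add[OF N] by (simp add: mult.commute)
qed

text \<open>
  Modulo an ideal, entries that lie in the ideal do not contribute.
\<close>

lemma complete_hom_filter_cong:
  assumes N: "ideal N (poly_ring K n)" and "\<And>j. j \<in> set l \<Longrightarrow> y j \<in> polys {1..n}"
    and "\<And>j. j \<in> set l \<Longrightarrow> \<not> P j \<Longrightarrow> y j \<in> N"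
  shows "complete_hom r (map y l) - complete_hom r (map y (filter P l)) \<in> N"
  using assms(2-)
proof (induction r "map y l" arbitrary: l rule: complete_hom.induct)
  case (3 r a xs)
  then obtain j l' where l: "l = j # l'" "a = y j" "xs = map y l'" by auto
  have mem: "complete_hom r (map y l) \<in> polys {1..n}" using 3 by (intro complete_hom_in_polys) auto
  have IH1: "complete_hom (Suc r) (map y l') - complete_hom (Suc r) (map y (filter P l')) \<in> N"
    using 3(1)[OF l(3)] 3(4,5) l by auto
  have IH2: "complete_hom r (map y l) - complete_hom r (map y (filter P l)) \<in> N"
    using 3(2)[of l] 3(3-5) by auto
  show ?case
  proof (cases "P j")
    case True
    have "y j * (complete_hom r (map y l) - complete_hom r (map y (filter P l))) \<in> N"
      using poly_ideal_mult[OF N IH2, of "y j"] 3(4) l by simp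
    from poly_ideal_add[OF N IH1 this] show ?thesis using True l by (simp add: algebra_simps)
  next
    case False
    have "complete_hom r (map y l) * y j \<in> N"
      using poly_ideal_mult[OF N _ mem] 3(5) l False by simp
    from poly_ideal_add[OF N IH1 this] show ?thesis using False l by (simp add: algebra_simps)
  qed
qed (use poly_ideal_zero[OF N] in auto)

text \<open>
  The recursion \<open>h\<^sub>r(a, xs) = h\<^sub>r(xs) + a h\<^sub>r\<^sub>-\<^sub>1(a, xs)\<close> shows that each entry dropped changes the
  polynomial by a multiple of one of lower degree, which inductively vanishes modulo the ideal.
  Thus each symmetric polynomial already in the ideal allows one more entry to be dropped.
\<close>

lemma complete_hom_drop_cong:
  assumes N: "ideal N (poly_ring K n)" and zs: "set zs \<subseteq> polys {1..n}"
    and h: "\<And>j. j < k \<Longrightarrow> complete_hom (Suc j) zs \<in> N"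
  shows "t \<le> r \<Longrightarrow> r \<le> k \<Longrightarrow> complete_hom (Suc r) zs - complete_hom (Suc r) (drop t zs) \<in> N"
proof (induction t arbitrary: r)
  case 0
  then show ?case using poly_ideal_zero[OF N] by simp
next
  case (Suc t)
  show ?case
  proof (cases "t < length zs")
    case True
    then have dr: "drop t zs = zs ! t # drop (Suc t) zs" by (simp add: Cons_nth_drop_Suc)
    obtain r' where r': "r = Suc r'" "t \<le> r'" using Suc.prems by (cases r) auto
    have "complete_hom (Suc r') zs - (complete_hom (Suc r') zs - complete_hom (Suc r') (drop t
      zs)) \<in> N"
      using r' Suc.prems by (intro poly_ideal_diff[OF N] h Suc.IH) auto
    then have "zs ! t * complete_hom r (drop t zs) \<in> N"
      using poly_ideal_mult[OF N, of "complete_hom r (drop t zs)" "zs ! t"] r' True zs nth_mem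
        by (auto simp: subset_iff)
    moreover have "complete_hom (Suc r) zs - complete_hom (Suc r) (drop t zs) \<in> N"
      using Suc.prems by (intro Suc.IH) auto
    ultimately have "(complete_hom (Suc r) zs - complete_hom (Suc r) (drop t zs)) + zs ! t *
      complete_hom r (drop t zs) \<in> N"
      by (intro poly_ideal_add[OF N])
    then show ?thesis by (simp add: dr)
  next
    case False
    then show ?thesis using Suc.IH[of r] Suc.prems by simp
  qed
qed

lemma adjoin_poly_cong:
  assumes N: "ideal N (poly_ring K n)" and x: "x \<in> polys {1..n}" "x' \<in> polys {1..n}" "x - x' \<in> N"
  shows "adjoin (poly_ring K n) N x = adjoin (poly_ring K n) N x'"
proof -
  interpret cring "poly_ring K n" by (rule poly_ring_cring)
  have *: "adjoin (poly_ring K n) N x \<subseteq> adjoin (poly_ring K n) N x'"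
    if x: "x \<in> polys {1..n}" "x' \<in> polys {1..n}" "x - x' \<in> N" for x x'
  proof (rule adjoin_minimal)
    have x': "x' \<in> carrier (poly_ring K n)" using x by simp
    show I: "ideal (adjoin (poly_ring K n) N x') (poly_ring K n)" by (rule adjoin_ideal[OF N x'])
    show "N \<subseteq> adjoin (poly_ring K n) N x'" by (rule adjoin_superset[OF N x'])
    then have "(x - x') + x' \<in> adjoin (poly_ring K n) N x'"
      using adjoin_self[OF N x'] x(3) by (intro poly_ideal_add[OF I]) auto
    then show "x \<in> adjoin (poly_ring K n) N x'" by simp
  qed
  have "0 - (x - x') \<in> N" by (intro poly_ideal_diff[OF N] poly_ideal_zero[OF N] x)
  then have "x' - x \<in> N" by simp
  then show ?thesis using *[OF x] *[OF x(2,1)] by blast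
qed

text \<open>
  Replaces the symmetric polynomials by a triangular sequence: the \<open>i\<close>-th one, counted from zero,
  involves only the entries from position \<open>i\<close> on.  The statement is by induction on the remaining part of the
  sequence, whence the parameter \<open>k\<close> and the hypothesis on the first \<open>k\<close> polynomials.
\<close>

lemma weakly_regular_complete_hom_drop:
  assumes "ideal N (poly_ring K n)" and zs: "set zs \<subseteq> polys {1..n}"
    and "\<And>i. i < d \<Longrightarrow> g i \<in> polys {1..n}"
    and "\<And>i. i < d \<Longrightarrow> g i - complete_hom (Suc i) zs \<in> N"
    and "\<And>j. j < k \<Longrightarrow> complete_hom (Suc j) zs \<in> N"
    and "k \<le> d"
    and "weakly_regular (poly_ring K n) N (map (\<lambda>i. complete_hom (Suc i) (drop i zs)) [k..<d])"
  shows "weakly_regular (poly_ring K n) N (map g [k..<d])"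
  using \<open>k \<le> d\<close> assms(1,3-5,7)
proof (induction k arbitrary: N rule: inc_induct)
  case base
  then show ?case by simp
next
  case (step k)
  interpret cring "poly_ring K n" by (rule poly_ring_cring)
  note N = \<open>ideal N (poly_ring K n)\<close>
  define x' where "x' = complete_hom (Suc k) (drop k zs)"
  have x': "x' \<in> polys {1..n}" unfolding x'_def
    using zs set_drop_subset[of k zs] by (intro complete_hom_in_polys) auto
  have x'c: "x' \<in> carrier (poly_ring K n)" using x' by simp
  have zx: "complete_hom (Suc k) zs - x' \<in> N"
    unfolding x'_def by (rule complete_hom_drop_cong[OF N zs step.prems(4)]) auto
  have "g k - complete_hom (Suc k) zs + (complete_hom (Suc k) zs - x') \<in> N"
    by (intro poly_ideal_add[OF N] zx step.prems(3)) (rule step.hyps(2))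
  then have gx: "g k - x' \<in> N" by simp
  have upt: "[k..<d] = k # [Suc k..<d]" using step.hyps by (simp add: upt_conv_Cons)
  have wr: "\<forall>a\<in>polys {1..n}. x' * a \<in> N \<longrightarrow> a \<in> N"
    "weakly_regular (poly_ring K n) (adjoin (poly_ring K n) N x') (map (\<lambda>i. complete_hom (Suc i)
    (drop i zs)) [Suc k..<d])"
    using step.prems(5) unfolding upt x'_def by simp_all
  note N' = adjoin_ideal[OF N x'c] and sub = adjoin_superset[OF N x'c]
  have "weakly_regular (poly_ring K n) (adjoin (poly_ring K n) N x') (map g [Suc k..<d])"
  proof (rule step.IH[OF N'])
    fix j assume "j < Suc k"
    then consider "j < k" | "j = k" by linarith
    then show "complete_hom (Suc j) zs \<in> adjoin (poly_ring K n) N x'"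
    proof cases
      case 1
      then show ?thesis using step.prems(4) sub by blast
    next
      case 2
      have "complete_hom (Suc k) zs - x' + x' \<in> adjoin (poly_ring K n) N x'"
        using zx sub adjoin_self[OF N x'c] by (intro poly_ideal_add[OF N']) auto
      then show ?thesis using 2 by simp
    qed
  qed (use step.prems sub wr(2) in auto)
  then have "weakly_regular (poly_ring K n) (adjoin (poly_ring K n) N (g k)) (map g [Suc k..<d])"
    using adjoin_poly_cong[OF N _ x' gx] step.prems(2) step.hyps by simp
  moreover have "a \<in> N" if a: "a \<in> polys {1..n}" "g k * a \<in> N" for a
  proof -
    have "g k * a - a * (g k - x') \<in> N" by (intro poly_ideal_diff[OF N] poly_ideal_mult[OF N] a gx)
    then have "x' * a \<in> N" by (simp add: algebra_simps)
    then show ?thesis using wr(1) a(1) by blast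
  qed
  ultimately show ?case unfolding upt by simp
qed

text \<open>
  \<open>y j\<close> is a nonzero polynomial in \<open>x\<^sub>j\<close> alone, without constant term; so it vanishes modulo
  every ideal that contains \<open>x\<^sub>j\<close>.
\<close>

definition univariate_family :: "nat \<Rightarrow> (nat \<Rightarrow> (monomial \<Rightarrow>\<^sub>0 'k::field)) \<Rightarrow> bool" where
  "univariate_family n y \<longleftrightarrow>
     (\<forall>j\<in>{1..n}. y j \<noteq> 0 \<and> (\<forall>m\<in>keys (y j). keys m = {j}))"

lemma univariate_family_polys:
  "univariate_family n y \<Longrightarrow> j \<in> {1..n} \<Longrightarrow> j \<in> A \<Longrightarrow> y j \<in> polys A"
  by (auto simp: univariate_family_def polys_def)

text \<open>
  The first variable dominates in the lexicographic order, and by the recursion for \<open>h\<^sub>r\<close> the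
  summand \<open>y\<^sub>a\<^sup>r\<close> contributes the largest monomial.
\<close>

lemma lm_complete_hom:
  assumes y: "univariate_family n y" and "set (a # l) \<subseteq> {1..n}" "sorted_wrt (<) (a # l)"
  shows "complete_hom r (map y (a # l)) \<noteq> 0 \<and>
    keys (lm (complete_hom r (map y (a # l)))) = (if r = 0 then {} else {a})"
proof (induction r)
  case 0
  have "lm (1 :: monomial \<Rightarrow>\<^sub>0 'a) = 0" by (simp add: lm_def)
  then show ?case by simp
next
  case (Suc r)
  let ?p = "complete_hom (Suc r) (map y l)" and ?q = "y a * complete_hom r (map y (a # l))"
  have ya: "y a \<noteq> 0" "keys (lm (y a)) = {a}"
    using y assms(2) lm_in_keys[of "y a"] by (auto simp: univariate_family_def)
  have q: "?q \<noteq> 0" "keys (lm ?q) = {a}"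
    using ya Suc by (simp_all add: lm_mult keys_monomial_add)
  have eq: "complete_hom (Suc r) (map y (a # l)) = ?p + ?q" by simp
  show ?case
  proof (cases "?p = 0")
    case True
    then show ?thesis unfolding eq using q by simp
  next
    case False
    have "?p \<in> polys (set l)"
      using univariate_family_polys[OF y] assms(2) by (intro complete_hom_in_polys) auto
    then have "keys (lm ?p) \<subseteq> set l" using lm_in_keys[OF False] by (simp add: polys_def)
    then have kp: "\<forall>i\<in>keys (lm ?p). a < i" using assms(3) by auto
    have less: "lm ?p < lm ?q"
      unfolding monomial_less_iff
    proof (intro exI[of _ a] conjI allI impI)
      have "lookup (lm ?p) a = 0" using kp in_keys_iff by fastforce
      moreover have "lookup (lm ?q) a \<noteq> 0" using q(2) in_keys_iff by fastforce
      ultimately show "lookup (lm ?p) a < lookup (lm ?q) a" by simp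
      fix i assume "i < a"
      then have "i \<notin> keys (lm ?p)" "i \<notin> keys (lm ?q)" using kp q(2) by auto
      then show "lookup (lm ?p) i = lookup (lm ?q) i" by (simp add: in_keys_iff)
    qed
    then have lm: "lm (?p + ?q) = lm ?q" using lm_add_distinct[OF False q(1)] by simp
    have "?p + ?q \<noteq> 0"
    proof
      assume "?p + ?q = 0"
      then have "lm (?p + ?q) = lm (0 :: monomial \<Rightarrow>\<^sub>0 'a)" by (rule arg_cong)
      have "?p = - ?q" using \<open>?p + ?q = 0\<close> by (rule eq_neg_iff_add_eq_0[THEN iffD2])
      then have "lm ?p = lm ?q" unfolding lm_def by simp
      then show False using less by simp
    qed
    then show ?thesis unfolding eq lm using q by simp
  qed
qed

text \<open>
  After dropping, the polynomial of degree \<open>i + 1\<close> starts at the vertex number \<open>i\<close> of \<open>F\<close>, counted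
  from zero, so that the leading monomials are powers of different variables.
\<close>

theorem complete_hom_weakly_regular_on_face:
  assumes y: "univariate_family n y" and F: "F \<subseteq> {1..n}" "d \<le> card F"
  shows "weakly_regular (poly_ring K n) (face_ideal n F)
    (map (\<lambda>i. complete_hom (Suc i) (map y [1..<Suc n])) [0..<d])"
proof (rule weakly_regular_complete_hom_drop[OF face_ideal_ideal])
  let ?l = "filter (\<lambda>j. j \<in> F) [1..<Suc n]"
  let ?zs = "map y ?l"
  have setl: "set ?l = F" using F(1) by auto
  have len: "d \<le> length ?l" using F(2) distinct_card[of ?l] setl by simp
  have sorted: "sorted_wrt (<) ?l" by (intro sorted_wrt_filter sorted_wrt_upt)
  have ypoly: "y j \<in> polys {1..n}" if "j \<in> {1..n}" for j
    using univariate_family_polys[OF y that that] .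
  show "set ?zs \<subseteq> polys {1..n}" using ypoly by auto
  show "complete_hom (Suc i) (map y [1..<Suc n]) \<in> polys {1..n}" for i
    using ypoly by (intro complete_hom_in_polys) auto
  show "complete_hom (Suc i) (map y [1..<Suc n]) - complete_hom (Suc i) ?zs \<in> face_ideal n F" for i
  proof (rule complete_hom_filter_cong[OF face_ideal_ideal])
    fix j assume j: "j \<in> set [1..<Suc n]"
    then have j': "j \<in> {1..n}" by auto
    show "y j \<in> polys {1..n}" by (rule ypoly[OF j'])
    show "y j \<in> face_ideal n F" if "j \<notin> F"
      using that ypoly[OF j'] y j'
        by (auto simp: face_ideal_def mon_ideal_def univariate_family_def)
  qed
  let ?f = "\<lambda>i. complete_hom (Suc i) (drop i ?zs)"
  have lmf: "?f i \<noteq> 0 \<and> keys (lm (?f i)) = {?l ! i}" if "i < d" for i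
  proof -
    have il: "i < length ?l" using that len by simp
    have dr: "drop i ?zs = map y (?l ! i # drop (Suc i) ?l)"
      using il by (simp only: drop_map Cons_nth_drop_Suc)
    have "sorted_wrt (<) (drop i ?l)" "set (drop i ?l) \<subseteq> {1..n}"
      using sorted_wrt_drop[OF sorted] set_drop_subset[of i ?l] setl F(1) by blast+
    then have "sorted_wrt (<) (?l ! i # drop (Suc i) ?l)" "set (?l ! i # drop (Suc i) ?l) \<subseteq> {1..n}"
      unfolding Cons_nth_drop_Suc[OF il] .
    from lm_complete_hom[OF y this(2,1), of "Suc i"] show ?thesis unfolding dr by simp
  qed
  show "weakly_regular (poly_ring K n) (face_ideal n F) (map ?f [0..<d])"
  proof (rule coprime_leading_monomials_weakly_regular[OF face_ideal_ideal
  face_ideal_generates_initial])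
    have "set ?zs \<subseteq> polys {1..n}" using ypoly by auto
    then have "?f i \<in> polys {1..n}" for i
      using set_drop_subset[of i ?zs] by (intro complete_hom_in_polys) blast
    then show "set (map ?f [0..<d]) \<subseteq> polys {1..n} - {0}" using lmf by auto
    show "keys z \<inter> keys (lm f) = {}"
      if zf: "z \<in> (\<lambda>j. single j (1::nat)) ` ({1..n} - F)" "f \<in> set (map ?f [0..<d])" for z f
    proof -
      obtain i where i: "i < d" "f = ?f i" using zf(2) by auto
      have "i < length ?l" using i(1) len by (rule less_le_trans)
      then have "?l ! i \<in> F" using nth_mem setl by blast
      moreover obtain j where "j \<notin> F" "z = single j 1" using zf(1) by blast
      ultimately have "keys z \<inter> {?l ! i} = {}" by auto
      then show ?thesis unfolding i(2) using lmf[OF i(1)] by metis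
    qed
    show "sorted_wrt (\<lambda>f g. keys (lm f) \<inter> keys (lm g) = {}) (map ?f [0..<d])"
      unfolding sorted_wrt_iff_nth_less
    proof (intro allI impI)
      fix i j assume ij: "i < j" "j < length (map ?f [0..<d])"
      then have ij': "i < d" "j < d" by simp_all
      have "?l ! i < ?l ! j"
        using sorted ij(1) less_le_trans[OF ij'(2) len] by (rule sorted_wrt_nth_less)
      then show "keys (lm (map ?f [0..<d] ! i)) \<inter> keys (lm (map ?f [0..<d] ! j)) = {}"
        using ij' lmf[OF ij'(1)] lmf[OF ij'(2)] by simp
    qed
  qed
qed simp_all

section \<open>Stanley--Reisner ideals\<close>

lemma lookup_squarefree_product:
  "finite G \<Longrightarrow> lookup (squarefree_product G) i = (if i \<in> G then 1 else 0)"
  by (simp add: squarefree_product_def lookup_sum lookup_single when_def sum.delta')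

lemma keys_squarefree_product: "finite G \<Longrightarrow> keys (squarefree_product G) = G"
  by (auto simp: in_keys_iff lookup_squarefree_product split: if_splits)

lemma squarefree_product_divides:
  "finite G \<Longrightarrow> mon_divides (squarefree_product G) m \<longleftrightarrow> G \<subseteq> keys m"
  by (auto simp: mon_divides_def lookup_squarefree_product in_keys_iff Suc_le_eq split: if_splits)

lemma poly_sum_singles:
  fixes p :: "monomial \<Rightarrow>\<^sub>0 'k::field"
  shows "p = (\<Sum>m\<in>keys p. single m (lookup p m))"
proof -
  have "p = restrict_poly (\<lambda>_. True) p" by (rule poly_mapping_eqI) (simp add: lookup_restrict_poly)
  then show ?thesis by (simp add: restrict_poly_def)
qed

lemma lookup_mult_monomial:
  "lookup (a * single w 1) (m + w) = lookup (a :: monomial \<Rightarrow>\<^sub>0 'k::field) m"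
proof -
  have "a * single w 1 =
    (\<Sum>k\<in>keys a. single (k + w) (lookup a k))"
    by (subst poly_sum_singles[of a]) (simp add: sum_distrib_right mult_single)
  then show ?thesis
    by (simp add: lookup_sum lookup_single when_def sum.delta' in_keys_iff)
qed

lemma keys_mult_monomial:
  "keys (a * single w 1) = (\<lambda>m. m + w) ` keys (a :: monomial \<Rightarrow>\<^sub>0 'k::field)"
proof
  show "keys (a * single w 1) \<subseteq> (\<lambda>m. m + w) ` keys a"
    using keys_mult[of a "single w 1"] by auto
  show "(\<lambda>m. m + w) ` keys a \<subseteq> keys (a * single w 1)"
    by (auto simp: in_keys_iff lookup_mult_monomial)
qed

lemma monomial_multiple:
  assumes p: "p \<in> polys A" and w: "\<And>m. m \<in> keys p \<Longrightarrow> mon_divides w m"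
  shows "\<exists>r\<in>polys A. p = r * single w 1"
proof -
  define r where "r = (\<Sum>m\<in>keys p. single (m - w) (lookup p m))"
  have "r * single w 1 = (\<Sum>m\<in>keys p. single (m - w + w) (lookup p m))"
    by (simp add: r_def sum_distrib_right mult_single)
  also have "\<dots> = (\<Sum>m\<in>keys p. single m (lookup p m))"
    using mon_divides_imp_add[OF w] by (intro sum.cong) (simp_all add: add.commute)
  also have "\<dots> = p" using poly_sum_singles[of p] by simp
  finally have eq: "p = r * single w 1" by simp
  have "keys (m - w) \<subseteq> A" if m: "m \<in> keys p" for m
  proof -
    have "keys (m - w) \<subseteq> keys m" by (auto simp: in_keys_iff lookup_minus)
    then show ?thesis using p m by (auto simp: polys_def)
  qed
  then have "r \<in> polys A" unfolding r_def by (intro polys_sum polys_single)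
  then show ?thesis using eq by blast
qed

lemma mon_ideal_cong:
  "(\<And>A. A \<subseteq> {1..n} \<Longrightarrow> A \<in> \<N> \<longleftrightarrow> A \<in> \<N>') \<Longrightarrow> mon_ideal n \<N> = mon_ideal n \<N>'"
  by (auto simp: mon_ideal_def polys_def)

lemma mon_ideal_adjoin:
  assumes \<N>: "up_closed \<N>" and G: "G \<subseteq> {1..n}"
  shows "adjoin (poly_ring K n) (mon_ideal n \<N>) (single (squarefree_product G) 1) =
    mon_ideal n (\<N> \<union> {A. G \<subseteq> A})" (is "?L = ?R")
proof
  interpret cring "poly_ring K n" by (rule poly_ring_cring)
  have finG: "finite G" using G finite_subset by blast
  let ?x = "single (squarefree_product G) (1::'a)"
  have x: "?x \<in> carrier (poly_ring K n)" using G by (simp add: keys_squarefree_product finG)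
  have up: "up_closed (\<N> \<union> {A. G \<subseteq> A})" using \<N> by (auto simp: up_closed_def)
  show "?L \<subseteq> ?R"
  proof (rule adjoin_minimal[OF mon_ideal_ideal[OF up]])
    show "?x \<in> ?R" using x by (simp add: mon_ideal_def keys_squarefree_product finG)
  qed (auto simp: mon_ideal_def)
  show "?R \<subseteq> ?L"
  proof
    fix p :: "monomial \<Rightarrow>\<^sub>0 'a" assume p: "p \<in> ?R"
    let ?p0 = "restrict_poly (\<lambda>m. keys m \<notin> \<N>) p"
    have pp: "p \<in> polys {1..n}" using p by (simp add: mon_ideal_def)
    have "\<exists>r\<in>polys {1..n}. ?p0 = r * ?x"
      by (rule monomial_multiple)
         (use p in \<open>auto simp: keys_restrict_poly mon_ideal_def squarefree_product_divides finG\<close>)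
    then obtain r where r: "r \<in> polys {1..n}" "?p0 = r * ?x" by blast
    have "p - ?p0 \<in> mon_ideal n \<N>" by (rule diff_restrict_poly_in_mon_ideal[OF pp])
    moreover have "p = (p - ?p0) + r * ?x" using r(2) by simp
    ultimately show "p \<in> ?L" unfolding adjoin_poly_ring using r(1) by blast
  qed
qed

lemma mon_ideal_colon:
  assumes G: "G \<subseteq> {1..n}"
  shows "colon (poly_ring K n) (mon_ideal n \<N>) (single (squarefree_product G) 1) =
    mon_ideal n {A. A \<union> G \<in> \<N>}"
proof -
  have finG: "finite G" using G finite_subset by blast
  have "single (squarefree_product G) (1::'a) \<in> polys {1..n}"
    using G by (simp add: keys_squarefree_product finG)
  then show ?thesis
    unfolding colon_poly_ring mon_ideal_def
    by (auto simp: keys_mult_monomial keys_monomial_add keys_squarefree_product finG)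
qed

lemma genideal_monomials:
  fixes K :: "'k::field itself"
  assumes M: "\<And>m. m \<in> M \<Longrightarrow> keys m \<subseteq> {1..n}"
  shows "genideal (poly_ring K n) (monomial_poly K ` M) =
    {p \<in> polys {1..n}. \<forall>m\<in>keys p. \<exists>w\<in>M. mon_divides w m}" (is "?L = ?R")
proof
  interpret cring "poly_ring K n" by (rule poly_ring_cring)
  have Mc: "monomial_poly K ` M \<subseteq> carrier (poly_ring K n)" using M by (auto simp: monomial_poly_def)
  have R: "ideal ?R (poly_ring K n)"
  proof (rule poly_idealI)
    show "a + b \<in> ?R" if "a \<in> ?R" "b \<in> ?R" for a b :: "monomial \<Rightarrow>\<^sub>0 'k"
      using that keys_add[of a b] by auto
    fix a r :: "monomial \<Rightarrow>\<^sub>0 'k" assume a: "a \<in> ?R" and r: "r \<in> polys {1..n}"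
    have "\<exists>w\<in>M. mon_divides w m" if m: "m \<in> keys (r * a)" for m
    proof -
      obtain u w where uw: "w \<in> keys a" "m = u + w"
        using keys_mult[of r a] m by blast
      have "mon_divides w m" unfolding uw(2) by (simp add: add.commute[of u])
      moreover obtain z where "z \<in> M" "mon_divides z w" using a uw(1) by blast
      ultimately show ?thesis using mon_divides_trans by blast
    qed
    then show "r * a \<in> ?R" using a r by simp
  qed auto
  show "?L \<subseteq> ?R"
  proof (rule genideal_minimal[OF R])
    show "monomial_poly K ` M \<subseteq> ?R"
      using Mc by (auto simp: monomial_poly_def mon_divides_def)
  qed
  show "?R \<subseteq> ?L"
  proof
    fix p :: "monomial \<Rightarrow>\<^sub>0 'k" assume p: "p \<in> ?R"
    note L = genideal_ideal[OF Mc]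
    have "single m (lookup p m) \<in> ?L" if m: "m \<in> keys p" for m
    proof -
      obtain w where w: "w \<in> M" "mon_divides w m" using p m by blast
      have "keys m \<subseteq> {1..n}" using p m by (auto simp: polys_def)
      then have "\<exists>r\<in>polys {1..n}. single m (lookup p m) = r * single w 1"
        using w(2) by (intro monomial_multiple polys_single) (auto split: if_splits)
      then obtain r where r: "r \<in> polys {1..n}"
        "single m (lookup p m) = r * single w 1" by blast
      have "single w 1 \<in> ?L" using genideal_self[OF Mc] w(1) by (auto simp: monomial_poly_def)
      then show ?thesis unfolding r(2) by (rule poly_ideal_mult[OF L _ r(1)])
    qed
    then have "(\<Sum>m\<in>keys p. single m (lookup p m)) \<in> ?L"
      by (rule poly_ideal_sum[OF L])
    then show "p \<in> ?L" using poly_sum_singles[of p] by simp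
  qed
qed

lemma up_closed_nonfaces: "simplicial_complex n \<Delta> \<Longrightarrow> up_closed (- \<Delta>)"
  by (auto simp: simplicial_complex_def up_closed_def)

lemma stanley_reisner_ideal_eq:
  assumes "simplicial_complex n \<Delta>"
  shows "stanley_reisner_ideal K n \<Delta> = mon_ideal n (- \<Delta>)"
proof -
  let ?M = "squarefree_product ` {G. G \<subseteq> {1..n} \<and> G \<notin> \<Delta>}"
  have fin: "finite G" if "G \<subseteq> {1..n}" for G :: "nat set" using that finite_subset by blast
  have "{monomial_poly K (squarefree_product G) | G. G \<subseteq> {1..n} \<and> G \<notin> \<Delta>} = monomial_poly K ` ?M"
    by auto
  moreover have "keys m \<subseteq> {1..n}" if "m \<in> ?M" for m
    using that keys_squarefree_product fin by auto
  ultimately have "stanley_reisner_ideal K n \<Delta> =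
    {p \<in> polys {1..n}. \<forall>m\<in>keys p. \<exists>w\<in>?M. mon_divides w m}"
    unfolding stanley_reisner_ideal_def using genideal_monomials[of ?M n K] by simp
  also have "\<dots> = mon_ideal n (- \<Delta>)"
  proof -
    have "(\<exists>w\<in>?M. mon_divides w m) \<longleftrightarrow> keys m \<notin> \<Delta>"
      if m: "keys m \<subseteq> {1..n}" for m
    proof
      assume "\<exists>w\<in>?M. mon_divides w m"
      then obtain G where G: "G \<subseteq> {1..n}" "G \<notin> \<Delta>" "mon_divides (squarefree_product G) m" by blast
      then have "G \<subseteq> keys m" using squarefree_product_divides[OF fin[OF G(1)]] by simp
      then show "keys m \<notin> \<Delta>" using G(2) assms unfolding simplicial_complex_def by blast
    next
      assume "keys m \<notin> \<Delta>"
      then show "\<exists>w\<in>?M. mon_divides w m"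
        using m squarefree_product_divides[OF fin[OF m], of m]
        by (intro bexI[of _ "squarefree_product (keys m)"]) auto
    qed
    then show ?thesis unfolding mon_ideal_def polys_def by auto
  qed
  finally show ?thesis .
qed

section \<open>Shelling shifted complexes\<close>

text \<open>
  Where the tail \<open>{t..n}\<close> begins that is added to \<open>A\<close> in order to obtain a facet; the value is
  \<open>Suc n\<close> if no vertex can be added.
\<close>

definition tail_start :: "nat \<Rightarrow> nat set set \<Rightarrow> nat set \<Rightarrow> nat" where
  "tail_start n \<Delta> A = (LEAST t. A \<union> {t..n} \<in> \<Delta>)"

text \<open>
  In the shelling of a shifted complex, \<open>core n \<Delta> A\<close> is the restriction set of the facet
  \<open>A \<union> {tail_start n \<Delta> A..n}\<close>: the faces \<open>B\<close> with a given core \<open>G\<close> form the interval between \<open>G\<close> and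
  \<open>G \<union> {tail_start n \<Delta> G..n}\<close>.
\<close>

definition core :: "nat \<Rightarrow> nat set set \<Rightarrow> nat set \<Rightarrow> nat set" where
  "core n \<Delta> A = A \<inter> {..<tail_start n \<Delta> A}"

definition shifted :: "nat \<Rightarrow> nat set set \<Rightarrow> bool" where
  "shifted n \<Delta> \<longleftrightarrow>
     (\<forall>A i j. insert i A \<in> \<Delta> \<longrightarrow> i < j \<longrightarrow> j \<le> n \<longrightarrow> i \<notin> A \<longrightarrow> j \<notin> A \<longrightarrow> insert j A \<in> \<Delta>)"

context
  fixes n :: nat and \<Delta> :: "nat set set"
  assumes \<Delta>: "simplicial_complex n \<Delta>"
begin

lemma face_subset: "A \<in> \<Delta> \<Longrightarrow> B \<subseteq> A \<Longrightarrow> B \<in> \<Delta>"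
  using \<Delta> unfolding simplicial_complex_def by blast

lemma face_vertices: "A \<in> \<Delta> \<Longrightarrow> A \<subseteq> {1..n}"
  using \<Delta> unfolding simplicial_complex_def by blast

lemma tail_start_face:
  assumes "A \<in> \<Delta>"
  shows "A \<union> {tail_start n \<Delta> A..n} \<in> \<Delta>" "tail_start n \<Delta> A \<le> Suc n"
proof -
  have *: "A \<union> {Suc n..n} \<in> \<Delta>" using assms by simp
  show "A \<union> {tail_start n \<Delta> A..n} \<in> \<Delta>"
    unfolding tail_start_def by (rule LeastI[of "\<lambda>t. A \<union> {t..n} \<in> \<Delta>", OF *])
  show "tail_start n \<Delta> A \<le> Suc n"
    unfolding tail_start_def by (rule Least_le[of "\<lambda>t. A \<union> {t..n} \<in> \<Delta>", OF *])
qed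

lemma tail_start_least: "A \<union> {t..n} \<in> \<Delta> \<Longrightarrow> tail_start n \<Delta> A \<le> t"
  unfolding tail_start_def by (rule Least_le)

lemma tail_start_mono:
  assumes "A \<subseteq> B" "B \<in> \<Delta>"
  shows "tail_start n \<Delta> A \<le> tail_start n \<Delta> B"
  by (rule tail_start_least, rule face_subset[OF tail_start_face(1)[OF assms(2)]]) (use assms in
  auto)

lemma core_mono: "A \<subseteq> B \<Longrightarrow> B \<in> \<Delta> \<Longrightarrow> core n \<Delta> A \<subseteq> core n \<Delta> B"
  using tail_start_mono[of A B] by (auto simp: core_def)

lemma core_face: "A \<in> \<Delta> \<Longrightarrow> core n \<Delta> A \<in> \<Delta>"
  by (rule face_subset) (auto simp: core_def)

lemma tail_start_core:
  assumes A: "A \<in> \<Delta>"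
  shows "tail_start n \<Delta> (core n \<Delta> A) = tail_start n \<Delta> A"
proof (rule antisym)
  let ?t = "tail_start n \<Delta> A" and ?s = "tail_start n \<Delta> (core n \<Delta> A)"
  show st: "?s \<le> ?t" by (rule tail_start_mono) (use A in \<open>auto simp: core_def\<close>)
  show "?t \<le> ?s"
  proof (rule tail_start_least)
    have "A \<union> {?s..n} \<subseteq> core n \<Delta> A \<union> {?s..n}" using face_vertices[OF A] st by (auto simp: core_def)
    then show "A \<union> {?s..n} \<in> \<Delta>" using face_subset tail_start_face(1)[OF core_face[OF A]] by blast
  qed
qed

lemma core_idem: "A \<in> \<Delta> \<Longrightarrow> core n \<Delta> (core n \<Delta> A) = core n \<Delta> A"
  using tail_start_core by (auto simp: core_def[of n \<Delta> "core n \<Delta> A"]) (simp add: core_def)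

text \<open>
  If a vertex \<open>i\<close> before the tail could be added, then shiftedness would allow its
  replacement by the vertex just before the tail, against the minimality of the tail's start.
\<close>

lemma tail_facet:
  assumes shift: "shifted n \<Delta>" and A: "A \<in> \<Delta>"
  shows "A \<union> {tail_start n \<Delta> A..n} \<in> facets \<Delta>"
proof -
  let ?t = "tail_start n \<Delta> A"
  let ?F = "A \<union> {?t..n}"
  have F: "?F \<in> \<Delta>" by (rule tail_start_face(1)[OF A])
  have "H = ?F" if H: "H \<in> \<Delta>" "?F \<subseteq> H" for H
  proof (rule ccontr)
    assume "H \<noteq> ?F"
    then obtain i where i: "i \<in> H" "i \<notin> ?F" using H(2) by blast
    have iF: "insert i ?F \<in> \<Delta>" by (rule face_subset[OF H(1)]) (use i H(2) in auto)
    have "i \<le> n" "1 \<le> i" using face_vertices[OF H(1)] i(1) by auto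
    then have it: "i < ?t" using i(2) by auto
    have ins: "insert (?t - 1) ?F = A \<union> {?t - 1..n}"
      using it tail_start_face(2)[OF A] by auto
    have no: "insert (?t - 1) ?F \<notin> \<Delta>"
      unfolding ins using tail_start_least[of A "?t - 1"] it by auto
    then have "i \<noteq> ?t - 1" using iF by auto
    then have "i < ?t - 1" "?t - 1 \<le> n" using it tail_start_face(2)[OF A] by auto
    moreover have "?t - 1 \<notin> ?F" using no F by (metis insert_absorb)
    ultimately have "insert (?t - 1) ?F \<in> \<Delta>"
      using shift iF i(2) unfolding shifted_def by blast
    then show False using no by blast
  qed
  with F show ?thesis unfolding facets_def by blast
qed

text \<open>
  Starting from the Stanley--Reisner ideal, adjoin the monomials \<open>x\<^sub>G\<close> for all cores \<open>G\<close>, larger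
  cores first.  At each step the colon ideal by \<open>x\<^sub>G\<close> is the face ideal of the facet \<open>F\<close> belonging to \<open>G\<close>: a
  vertex outside \<open>F\<close> lies before the tail of \<open>G\<close>, so that adding it to \<open>G\<close> leads to a nonface or to a
  face with a larger core.  After the last step, \<open>G = {}\<close>, the quotient is zero.
\<close>

theorem shifted_weakly_regular:
  fixes fs :: "(monomial \<Rightarrow>\<^sub>0 'k::field) list" and K :: "'k itself"
  assumes shift: "shifted n \<Delta>" and fs: "set fs \<subseteq> polys {1..n}"
    and facet: "\<And>F. F \<in> facets \<Delta> \<Longrightarrow> weakly_regular (poly_ring K n) (face_ideal n F) fs"
  shows "weakly_regular (poly_ring K n) (mon_ideal n (- \<Delta>)) fs"
proof -
  interpret cring "poly_ring K n" by (rule poly_ring_cring)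
  define \<G> where "\<G> = {G \<in> \<Delta>. core n \<Delta> G = G}"
  have fin\<Delta>: "finite \<Delta>" using face_vertices by (intro finite_subset[of \<Delta> "Pow {1..n}"]) auto
  have fin\<G>: "finite \<G>" using fin\<Delta> by (simp add: \<G>_def)
  have finG: "finite G" if "G \<in> \<Delta>" for G using face_vertices[OF that] finite_subset by blast
  define \<N> where "\<N> U = - \<Delta> \<union> {A. \<exists>G\<in>U. G \<subseteq> A}" for U
  have up\<N>: "up_closed (\<N> U)" for U
    using up_closed_nonfaces[OF \<Delta>] unfolding \<N>_def up_closed_def by blast
  have "weakly_regular (poly_ring K n) (mon_ideal n (\<N> U)) fs"
    if "U \<subseteq> \<G>" "\<forall>G\<in>U. \<forall>G'\<in>\<G>. card G < card G' \<longrightarrow> G' \<in> U" for U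
    using that
  proof (induction "card (\<G> - U)" arbitrary: U rule: less_induct)
    case less
    show ?case
    proof (cases "U = \<G>")
      case True
      have "A \<in> \<N> U" for A
      proof (cases "A \<in> \<Delta>")
        case A: True
        then have "{} \<in> \<Delta>" by (rule face_subset) simp
        then have "{} \<in> U" by (simp add: True \<G>_def core_def)
        then show ?thesis by (auto simp: \<N>_def)
      qed (simp add: \<N>_def)
      then have "mon_ideal n (\<N> U) = carrier (poly_ring K n)" by (simp add: mon_ideal_def)
      then show ?thesis using weakly_regular_carrier[of fs] fs by simp
    next
      case False
      then have ne: "\<G> - U \<noteq> {}" "finite (\<G> - U)" using less.prems fin\<G> by auto
      then have "Max (card ` (\<G> - U)) \<in> card ` (\<G> - U)" by (intro Max_in) auto
      then obtain G where G: "G \<in> \<G>" "G \<notin> U" and cG: "card G = Max (card ` (\<G> - U))" by auto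
      have max: "card G' \<le> card G" if "G' \<in> \<G>" "G' \<notin> U" for G'
        unfolding cG using that ne(2) by (intro Max_ge) auto
      have G\<Delta>: "G \<in> \<Delta>" and coreG: "core n \<Delta> G = G" using G(1) by (auto simp: \<G>_def)
      note Gn = face_vertices[OF G\<Delta>]
      let ?x = "single (squarefree_product G) (1::'k)"
      let ?t = "tail_start n \<Delta> G"
      let ?F = "G \<union> {?t..n}"
      note F = tail_start_face(1)[OF G\<Delta>]
      have x: "?x \<in> carrier (poly_ring K n)" using Gn finG[OF G\<Delta>]
        by (simp add: keys_squarefree_product)
      have Gt: "G \<subseteq> {..<?t}" using coreG by (auto simp: core_def)
      have "colon (poly_ring K n) (mon_ideal n (\<N> U)) ?x = mon_ideal n {A. A \<union> G \<in> \<N> U}"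
        by (rule mon_ideal_colon[OF Gn])
      also have "\<dots> = face_ideal n ?F"
        unfolding face_ideal_def
      proof (rule mon_ideal_cong)
        fix A assume A: "A \<subseteq> {1..n}"
        have "A \<union> G \<in> \<N> U" if nsub: "\<not> A \<subseteq> ?F"
        proof (cases "A \<union> G \<in> \<Delta>")
          case B: True
          obtain i where i: "i \<in> A" "i \<notin> ?F" using nsub by blast
          then have it: "i < ?t" using A by auto
          have "?t \<le> tail_start n \<Delta> (A \<union> G)" by (rule tail_start_mono[OF _ B]) simp
          then have "insert i G \<subseteq> core n \<Delta> (A \<union> G)" using i(1) it Gt by (auto simp: core_def)
          then have "card (insert i G) \<le> card (core n \<Delta> (A \<union> G))"
            by (intro card_mono finG core_face B)
          then have "card G < card (core n \<Delta> (A \<union> G))" using i(2) finG[OF G\<Delta>] by simp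
          moreover have "core n \<Delta> (A \<union> G) \<in> \<G>" using core_face[OF B] core_idem[OF B]
            by (simp add: \<G>_def)
          ultimately have "core n \<Delta> (A \<union> G) \<in> U" using max by fastforce
          moreover have "core n \<Delta> (A \<union> G) \<subseteq> A \<union> G" by (simp add: core_def)
          ultimately show ?thesis unfolding \<N>_def by blast
        qed (simp add: \<N>_def)
        moreover have "A \<union> G \<notin> \<N> U" if sub: "A \<subseteq> ?F"
        proof
          assume "A \<union> G \<in> \<N> U"
          moreover have "A \<union> G \<in> \<Delta>" by (rule face_subset[OF F]) (use sub in auto)
          ultimately obtain G' where G': "G' \<in> U" "G' \<subseteq> A \<union> G" by (auto simp: \<N>_def)
          have G'F: "G' \<subseteq> ?F" using G'(2) sub by blast
          have coreG': "core n \<Delta> G' = G'" using G'(1) less.prems(1) by (auto simp: \<G>_def)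
          have "tail_start n \<Delta> ?F \<le> ?t" by (rule tail_start_least) (use F in \<open>simp add: Un_assoc\<close>)
          then have "core n \<Delta> ?F \<subseteq> G" by (auto simp: core_def)
          then have "G' \<subseteq> G" using core_mono[OF G'F F] coreG' by blast
          moreover have "\<not> card G' < card G" using less.prems(2) G'(1) G by blast
          ultimately have "G' = G" using finG[OF G\<Delta>] card_mono[of G G'] card_subset_eq[of G G']
            by linarith
          then show False using G'(1) G(2) by blast
        qed
        ultimately show "A \<in> {A. A \<union> G \<in> \<N> U} \<longleftrightarrow> A \<in> {A. \<not> A \<subseteq> ?F}" by blast
      qed
      finally have col: "colon (poly_ring K n) (mon_ideal n (\<N> U)) ?x = face_ideal n ?F" .
      have \<N>ins: "\<N> U \<union> {A. G \<subseteq> A} = \<N> (insert G U)" by (auto simp: \<N>_def)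
      have adj: "adjoin (poly_ring K n) (mon_ideal n (\<N> U)) ?x = mon_ideal n (\<N> (insert G U))"
        using mon_ideal_adjoin[OF up\<N> Gn, of K U] unfolding \<N>ins .
      have ins: "weakly_regular (poly_ring K n) (mon_ideal n (\<N> (insert G U))) fs"
      proof (rule less.hyps)
        have "\<G> - insert G U = (\<G> - U) - {G}" by blast
        then show "card (\<G> - insert G U) < card (\<G> - U)"
          using card_Diff1_less[OF ne(2), of G] G by (metis DiffI)
        show "insert G U \<subseteq> \<G>" using G(1) less.prems(1) by blast
        show "\<forall>H\<in>insert G U. \<forall>G'\<in>\<G>. card H < card G' \<longrightarrow> G' \<in> insert G U"
          using less.prems(2) max by (metis insertE insertI2 not_le)
      qed
      show ?thesis
      proof (rule weakly_regular_extension[OF mon_ideal_ideal[OF up\<N>] x])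
        show "set fs \<subseteq> carrier (poly_ring K n)" using fs by simp
        show "weakly_regular (poly_ring K n) (colon (poly_ring K n) (mon_ideal n (\<N> U)) ?x) fs"
          unfolding col by (rule facet[OF tail_facet[OF shift G\<Delta>]])
        show "weakly_regular (poly_ring K n) (adjoin (poly_ring K n) (mon_ideal n (\<N> U)) ?x) fs"
          unfolding adj by (rule ins)
      qed
    qed
  qed
  from this[of "{}"] show ?thesis by (simp add: \<N>_def)
qed

end

section \<open>Bounding chains of prime ideals by counting monomials\<close>

definition mon_prod :: "'a::comm_ring_1 list \<Rightarrow> nat list \<Rightarrow> 'a" where
  "mon_prod as ks = prod_list (map2 (^) as ks)"

definition scale_poly :: "'k \<Rightarrow> (monomial \<Rightarrow>\<^sub>0 'k) \<Rightarrow> (monomial \<Rightarrow>\<^sub>0 'k::field)" where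
  "scale_poly c p = single 0 c * p"

interpretation poly_vs: vector_space scale_poly
  by unfold_locales
     (simp_all add: scale_poly_def algebra_simps single_add mult_single flip: mult.assoc)

lemma scale_poly_in_polys [simp]: "p \<in> polys A \<Longrightarrow> scale_poly c p \<in> polys A"
  by (simp add: scale_poly_def)

lemma mult_scale_poly: "a * scale_poly c p = scale_poly c (a * p)"
  by (simp add: scale_poly_def algebra_simps)

text \<open>
  Modulo \<open>Q'\<close> only \<open>g 0\<close> survives, so it vanishes; the remaining sum is divisible by \<open>a \<notin> Q\<close>, and one
  may divide.
\<close>

lemma power_sum_in_smaller_prime:
  assumes "ideal Q (poly_ring K n)" and Q: "primeideal Q (poly_ring K n)"
    and Q': "ideal Q' (poly_ring K n)" "Q \<subseteq> Q'" and a: "a \<in> Q'" "a \<notin> Q"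
    and g: "\<And>k. g k \<in> polys {1..n}" "\<And>k. g k \<in> Q' \<Longrightarrow> g k = 0"
    and sum: "(\<Sum>k<e. a ^ k * g k) \<in> Q"
  shows "\<forall>k<e. g k = 0"
  using g sum
proof (induction e arbitrary: g)
  case (Suc e)
  have ac: "a \<in> polys {1..n}" using poly_ideal_subset[OF Q'(1)] a by blast
  let ?s = "\<Sum>k<e. a ^ k * g (Suc k)"
  have s: "?s \<in> polys {1..n}" using ac Suc.prems(1) by (intro polys_sum) auto
  have eq: "(\<Sum>k<Suc e. a ^ k * g k) = g 0 + a * ?s"
    by (subst sum.lessThan_Suc_shift) (simp add: sum_distrib_left mult.assoc)
  have sa: "?s * a \<in> Q'" by (rule poly_ideal_mult[OF Q'(1) a(1) s])
  have "(g 0 + a * ?s) - ?s * a \<in> Q'"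
    using Suc.prems(3) Q'(2) sa unfolding eq by (intro poly_ideal_diff[OF Q'(1)]) auto
  then have "g 0 \<in> Q'" by (simp add: mult.commute)
  then have g0: "g 0 = 0" by (rule Suc.prems(2))
  then have "a * ?s \<in> Q" using Suc.prems(3) unfolding eq by simp
  then have "?s \<in> Q" using primeideal.I_prime[OF Q, of a ?s] ac s a(2) by simp
  then have "\<forall>k<e. g (Suc k) = 0" using Suc.IH[of "\<lambda>k. g (Suc k)"] Suc.prems(1,2) by blast
  then show ?case using g0 by (auto simp: less_Suc_eq_0_disj)
qed simp

definition exponent_lists :: "nat \<Rightarrow> nat \<Rightarrow> nat list set" where
  "exponent_lists e r = {ks. set ks \<subseteq> {..<e} \<and> length ks = r}"

lemma exponent_lists_finite [simp]: "finite (exponent_lists e r)"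
  unfolding exponent_lists_def by (rule finite_lists_length_eq) simp

lemma sum_exponent_lists_Suc:
  "(\<Sum>ks\<in>exponent_lists e (Suc r). f ks) = (\<Sum>k<e. \<Sum>ks\<in>exponent_lists e r. f (k # ks))"
proof -
  have eq: "exponent_lists e (Suc r) = (\<lambda>(k, ks). k # ks) ` ({..<e} \<times> exponent_lists e r)"
    by (auto simp: exponent_lists_def length_Suc_conv image_iff)
  have inj: "inj_on (\<lambda>(k, ks). k # ks) ({..<e} \<times> exponent_lists e r)" by (auto simp: inj_on_def)
  show ?thesis unfolding eq sum.reindex[OF inj] sum.cartesian_product
    by (simp add: case_prod_beta comp_def)
qed

lemma mon_prod_in_polys: "set as \<subseteq> polys A \<Longrightarrow> mon_prod as ks \<in> polys A"
proof (induction as arbitrary: ks)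
  case Nil
  then show ?case by (simp add: mon_prod_def)
next
  case (Cons a as)
  then show ?case by (cases ks) (auto simp: mon_prod_def)
qed

text \<open>
  Algebraic independence modulo \<open>P 0\<close> of elements that witness the strict inclusions.
\<close>

lemma prime_chain_independent:
  assumes "prime_chain (poly_ring K n) (length as) P"
    and "\<And>i. i < length as \<Longrightarrow> as ! i \<in> P (Suc i) - P i"
    and "(\<Sum>ks\<in>exponent_lists e (length as). scale_poly (c ks) (mon_prod as ks)) \<in> P 0"
  shows "\<forall>ks\<in>exponent_lists e (length as). c ks = 0"
  using assms
proof (induction as arbitrary: P c)
  case Nil
  have P: "primeideal (P 0) (poly_ring K n)" using Nil.prems(1) by (simp add: prime_chain_def)
  note I = primeideal.axioms(1)[OF P]
  have "single 0 (c []) \<in> P 0"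
    using Nil.prems(3) by (simp add: exponent_lists_def mon_prod_def scale_poly_def cong: conj_cong)
  then have in0: "r * single 0 (c []) \<in> P 0" if "r \<in> polys {1..n}" for r
    by (rule poly_ideal_mult[OF I _ that])
  have "c [] = 0"
  proof (rule ccontr)
    assume nz: "c [] \<noteq> 0"
    have "single 0 (1 / c []) * single 0 (c []) \<in> P 0"
      by (rule in0) simp
    then have "1 \<in> P 0" using nz by (simp add: mult_single)
    then show False using ideal.one_imp_carrier[OF I] primeideal.I_notcarr[OF P] by simp
  qed
  then show ?case by (simp add: exponent_lists_def)
next
  case (Cons a as)
  let ?r = "length as"
  have pr: "primeideal (P i) (poly_ring K n)" if "i \<le> Suc ?r" for i
    using Cons.prems(1) that by (simp add: prime_chain_def)
  have chain': "prime_chain (poly_ring K n) ?r (\<lambda>i. P (Suc i))"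
    using Cons.prems(1) by (simp add: prime_chain_def)
  have mem': "as ! i \<in> P (Suc (Suc i)) - P (Suc i)" if "i < ?r" for i
    using Cons.prems(2)[of "Suc i"] that by simp
  have a: "a \<in> P 1" "a \<notin> P 0" using Cons.prems(2)[of 0] by auto
  have sub: "P 0 \<subseteq> P 1" using Cons.prems(1) by (auto simp: prime_chain_def)
  have as: "set as \<subseteq> polys {1..n}"
  proof
    fix x assume "x \<in> set as"
    then obtain i where "i < ?r" "x = as ! i" by (auto simp: in_set_conv_nth)
    then show "x \<in> polys {1..n}"
      using mem'[of i] poly_ideal_subset[OF primeideal.axioms(1)[OF pr[of "Suc (Suc i)"]]] by auto
  qed
  define g where "g k = (\<Sum>ks\<in>exponent_lists e ?r. scale_poly (c (k # ks)) (mon_prod as ks))" for k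
  have IH: "\<forall>ks\<in>exponent_lists e ?r. c (k # ks) = 0" if "g k \<in> P 1" for k
    using Cons.IH[OF chain' mem', of "\<lambda>ks. c (k # ks)"] that unfolding g_def by simp
  have "(\<Sum>ks\<in>exponent_lists e (length (a # as)). scale_poly (c ks) (mon_prod (a # as) ks)) =
     (\<Sum>k<e. a ^ k * g k)"
    by (simp add: sum_exponent_lists_Suc g_def sum_distrib_left mult_scale_poly mon_prod_def)
  then have sum: "(\<Sum>k<e. a ^ k * g k) \<in> P 0" using Cons.prems(3) by simp
  have gz: "\<forall>k<e. g k = 0"
  proof (rule power_sum_in_smaller_prime[OF _ pr[of 0] _ sub a _ _ sum])
    show "g k \<in> polys {1..n}" for k
      unfolding g_def using mon_prod_in_polys[OF as] by (intro polys_sum) auto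
    show "g k = 0" if "g k \<in> P 1" for k
      unfolding g_def using IH[OF that] by (intro sum.neutral) simp
  qed (use pr[of 0] pr[of 1] primeideal.axioms(1) in auto)
  have "0 \<in> P 1" using poly_ideal_zero[OF primeideal.axioms(1)[OF pr[of 1]]] by simp
  then have "\<forall>ks\<in>exponent_lists e ?r. c (k # ks) = 0" if "k < e" for k
    using IH[of k] gz that by simp
  then show ?case
    by (auto simp: exponent_lists_def length_Suc_conv)
qed

definition exponents_le :: "nat \<Rightarrow> (monomial \<Rightarrow>\<^sub>0 'k::field) \<Rightarrow> bool" where
  "exponents_le D p \<longleftrightarrow> (\<forall>m\<in>keys p. \<forall>i. lookup m i \<le> D)"

lemma exponents_le_mult:
  assumes "exponents_le D p" "exponents_le E q"
  shows "exponents_le (D + E) (p * q)"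
  unfolding exponents_le_def
proof (intro ballI allI)
  fix m i assume m: "m \<in> keys (p * q)"
  obtain a b where "a \<in> keys p" "b \<in> keys q" "m = a + b"
    using keys_mult[of p q] m by blast
  then show "lookup m i \<le> D + E"
    using assms by (auto simp: exponents_le_def lookup_add intro!: add_mono)
qed

lemma exponents_le_mono: "exponents_le D p \<Longrightarrow> D \<le> E \<Longrightarrow> exponents_le E p"
  by (meson exponents_le_def order_trans)

lemma exponents_le_1: "exponents_le D 1"
  by (simp add: exponents_le_def)

lemma exponents_le_power: "exponents_le D p \<Longrightarrow> exponents_le (k * D) (p ^ k)"
  by (induction k) (auto simp: exponents_le_1 intro: exponents_le_mult)

lemma exponents_le_mon_prod:
  "\<forall>a\<in>set as. exponents_le D a \<Longrightarrow> set ks \<subseteq> {..<e}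
  \<Longrightarrow> exponents_le (length as * (e * D)) (mon_prod as ks)"
proof (induction as arbitrary: ks)
  case Nil
  then show ?case by (simp add: mon_prod_def exponents_le_1)
next
  case (Cons a as)
  show ?case
  proof (cases ks)
    case Nil
    then show ?thesis by (simp add: mon_prod_def exponents_le_1)
  next
    case (Cons k ks')
    have "exponents_le (k * D + length as * (e * D)) (a ^ k * mon_prod as ks')"
      using Cons.prems Cons by (intro exponents_le_mult exponents_le_power Cons.IH) auto
    moreover have "k * D \<le> e * D" using Cons.prems Cons by auto
    ultimately show ?thesis
      using Cons by (auto simp: mon_prod_def intro: exponents_le_mono)
  qed
qed

lemma ex_exponents_le: "\<exists>D. exponents_le D p"
proof -
  let ?V = "\<Union>m\<in>keys p. Poly_Mapping.range m \<union> {0}"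
  have fin: "finite ?V" by simp
  have "exponents_le (Max ?V) p"
    unfolding exponents_le_def
  proof (intro ballI allI)
    fix m i assume m: "m \<in> keys p"
    have "lookup m i \<in> Poly_Mapping.range m \<union> {0}"
      by (cases "i \<in> keys m") (auto simp: in_keys_iff)
    then show "lookup m i \<le> Max ?V" using m by (intro Max_ge[OF fin]) blast
  qed
  then show ?thesis by blast
qed

lemma ex_common_exponents_le:
  assumes "finite B"
  shows "\<exists>D. \<forall>p\<in>B. exponents_le D p"
  using assms
proof (induction B)
  case (insert p B)
  then obtain D where D: "\<forall>p\<in>B. exponents_le D p" by blast
  obtain E where E: "exponents_le E p" using ex_exponents_le by blast
  show ?case using D E by (intro exI[of _ "D + E"]) (auto intro: exponents_le_mono)
qed simp

lemma card_monomials_le: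
  assumes A: "finite A"
  shows "finite {m :: monomial. keys m \<subseteq> A \<and> (\<forall>i. lookup m i \<le> E)}"
    and "card {m :: monomial. keys m \<subseteq> A \<and> (\<forall>i. lookup m i \<le> E)} \<le> Suc E ^ card A"
proof -
  let ?M = "{m :: monomial. keys m \<subseteq> A \<and> (\<forall>i. lookup m i \<le> E)}"
  let ?f = "\<lambda>m :: monomial. restrict (lookup m) A"
  have inj: "inj_on ?f ?M"
  proof (rule inj_onI)
    fix m m' assume m: "m \<in> ?M" "m' \<in> ?M" and eq: "?f m = ?f m'"
    show "m = m'"
    proof (rule poly_mapping_eqI)
      fix i
      show "lookup m i = lookup m' i"
      proof (cases "i \<in> A")
        case True
        then show ?thesis using fun_cong[OF eq, of i] by simp
      next
        case False
        then have "i \<notin> keys m" "i \<notin> keys m'" using m by auto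
        then show ?thesis by (simp add: in_keys_iff)
      qed
    qed
  qed
  have sub: "?f ` ?M \<subseteq> PiE A (\<lambda>_. {..E})" by auto
  have fin: "finite (PiE A (\<lambda>_. {..E}))" using A by (intro finite_PiE) auto
  show "finite ?M" using inj finite_subset[OF sub fin] by (rule finite_imageD[rotated])
  have "card ?M \<le> card (PiE A (\<lambda>_. {..E}))" by (rule card_inj_on_le[OF inj sub fin])
  then show "card ?M \<le> Suc E ^ card A" using A by (simp add: card_PiE)
qed

text \<open>
  The \<open>e\<^sup>r\<close> products of powers below \<open>e\<close> stay independent after the monomials in \<open>\<N>\<close> are deleted,
  since these lie in \<open>P 0\<close>.  What is left involves monomials with support of size at most \<open>d\<close> and
  exponents at most \<open>r e D\<close>, of which there are at most \<open>2\<^sup>n (r e D + 1)\<^sup>d\<close>.  For large \<open>e\<close> this excludes \<open>r > d\<close>.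
\<close>

theorem prime_chain_length_le:
  fixes K :: "'k::field itself"
  assumes \<N>: "\<And>A. A \<subseteq> {1..n} \<Longrightarrow> A \<notin> \<N> \<Longrightarrow> card A \<le> d"
    and chain: "prime_chain (poly_ring K n) r P" and P0: "mon_ideal n \<N> \<subseteq> P 0"
  shows "r \<le> d"
proof (rule ccontr)
  assume "\<not> r \<le> d"
  then have rd: "Suc d \<le> r" by simp
  have "\<exists>a. a \<in> P (Suc i) - P i" if "i < r" for i
    using chain that by (auto simp: prime_chain_def)
  then obtain a where a: "\<And>i. i < r \<Longrightarrow> a i \<in> P (Suc i) - P i" by metis
  define as where "as = map a [0..<r]"
  have as: "length as = r" "\<And>i. i < r \<Longrightarrow> as ! i \<in> P (Suc i) - P i" using a by (auto simp: as_def)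
  have P: "ideal (P i) (poly_ring K n)" if "i \<le> r" for i
    using chain that primeideal.axioms(1) by (auto simp: prime_chain_def)
  have aspoly: "set as \<subseteq> polys {1..n}"
  proof
    fix x assume "x \<in> set as"
    then obtain i where i: "i < r" "x = a i" by (auto simp: as_def)
    then have "x \<in> P (Suc i)" "Suc i \<le> r" using a by auto
    then show "x \<in> polys {1..n}" using poly_ideal_subset[OF P] by blast
  qed
  obtain D where D: "\<forall>a\<in>set as. exponents_le D a" using ex_common_exponents_le[of "set as"] by auto
  \<comment> \<open>The bound below is at most \<open>C e\<^sup>d\<close> for \<open>e \<ge> 1\<close>, so \<open>e = C + 1\<close> is large enough.\<close>
  define C where "C = 2 ^ n * Suc (r * D) ^ d"
  have bound: "e ^ r \<le> 2 ^ n * Suc (r * (e * D)) ^ d" for e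
  proof -
    define E where "E = r * (e * D)"
    define M where "M = {m :: monomial. keys m \<subseteq> {1..n} \<and> keys m \<notin> \<N> \<and> (\<forall>i. lookup m i \<le> E)}"
    let ?MA = "\<lambda>A. {m :: monomial. keys m \<subseteq> A \<and> (\<forall>i. lookup m i \<le> E)}"
    let ?As = "{A. A \<subseteq> {1..n} \<and> A \<notin> \<N>}"
    have finAs: "finite ?As" by (rule finite_subset[of _ "Pow {1..n}"]) auto
    have finA: "finite A" if "A \<in> ?As" for A using that finite_subset by blast
    have MU: "M \<subseteq> (\<Union>A\<in>?As. ?MA A)" by (auto simp: M_def)
    have finMU: "finite (\<Union>A\<in>?As. ?MA A)" using finAs card_monomials_le(1)[OF finA] by blast
    have finM: "finite M" by (rule finite_subset[OF MU finMU])
    have "card M \<le> card (\<Union>A\<in>?As. ?MA A)" by (rule card_mono[OF finMU MU])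
    also have "\<dots> \<le> (\<Sum>A\<in>?As. card (?MA A))" by (rule card_UN_le[OF finAs])
    also have "\<dots> \<le> (\<Sum>A\<in>?As. Suc E ^ d)"
    proof (rule sum_mono)
      fix A assume A: "A \<in> ?As"
      have "card (?MA A) \<le> Suc E ^ card A" by (rule card_monomials_le(2)[OF finA[OF A]])
      also have "\<dots> \<le> Suc E ^ d" using \<N> A by (intro power_increasing) auto
      finally show "card (?MA A) \<le> Suc E ^ d" .
    qed
    also have "\<dots> = card ?As * Suc E ^ d" by simp
    also have "\<dots> \<le> 2 ^ n * Suc E ^ d"
    proof (rule mult_right_mono)
      have "card ?As \<le> card (Pow {1..n})" by (rule card_mono) auto
      then show "card ?As \<le> 2 ^ n" by (simp add: card_Pow)
    qed simp
    finally have cM: "card M \<le> 2 ^ n * Suc E ^ d" .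
    let ?\<phi> = "restrict_poly (\<lambda>m. keys m \<notin> \<N>)"
    let ?T = "exponent_lists e r"
    let ?b = "\<lambda>ks. ?\<phi> (mon_prod as ks)"
    have indep0: "\<forall>ks\<in>?T. c ks = 0" if zero: "(\<Sum>ks\<in>?T. scale_poly (c ks) (?b ks)) = 0" for c
    proof -
      let ?s = "\<lambda>f. \<Sum>ks\<in>?T. scale_poly (c ks) (f ks)"
      have mp: "mon_prod as ks \<in> polys {1..n}" for ks by (rule mon_prod_in_polys[OF aspoly])
      have "scale_poly (c ks) (mon_prod as ks - ?b ks) \<in> P 0" for ks
        unfolding scale_poly_def
        using diff_restrict_poly_in_mon_ideal[OF mp] P0 by (intro poly_ideal_mult[OF P[of 0]]) auto
      then have "?s (\<lambda>ks. mon_prod as ks - ?b ks) \<in> P 0" by (intro poly_ideal_sum[OF P[of 0]]) auto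
      moreover have "?s (\<lambda>ks. mon_prod as ks - ?b ks) = ?s (mon_prod as) - ?s ?b"
        by (simp add: poly_vs.scale_right_diff_distrib sum_subtractf)
      ultimately have "?s (mon_prod as) \<in> P 0" using zero by simp
      then show ?thesis
        using prime_chain_independent[of K n as P c e] chain as by simp
    qed
    have inj: "inj_on ?b ?T"
    proof (rule inj_onI, rule ccontr)
      fix ks ls assume kl: "ks \<in> ?T" "ls \<in> ?T" "?b ks = ?b ls" "ks \<noteq> ls"
      define c :: "nat list \<Rightarrow> 'k" where "c xs = (if xs = ks then 1 else
      if xs = ls then -1 else 0)" for xs
      have "(\<Sum>xs\<in>?T. scale_poly (c xs) (?b xs)) = (\<Sum>xs\<in>{ks, ls}. scale_poly (c xs) (?b xs))"
        using kl by (intro sum.mono_neutral_right) (auto simp: c_def)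
      also have "\<dots> = 0" using kl(3,4) by (simp add: c_def)
      finally have "c ks = 0" using indep0[of c] kl(1) by blast
      then show False by (simp add: c_def)
    qed
    have ind: "poly_vs.independent (?b ` ?T)"
    proof
      assume "poly_vs.dependent (?b ` ?T)"
      then obtain u v where u: "v \<in> ?b ` ?T" "u v \<noteq> 0" "(\<Sum>v\<in>?b ` ?T. scale_poly (u v) v) = 0"
        using poly_vs.dependent_finite[of "?b ` ?T"] by auto
      then have "(\<Sum>ks\<in>?T. scale_poly (u (?b ks)) (?b ks)) = 0"
        by (simp add: sum.reindex[OF inj])
      then have "\<forall>ks\<in>?T. u (?b ks) = 0" by (rule indep0)
      then show False using u(1,2) by auto
    qed
    let ?S = "(\<lambda>m. single m (1::'k)) ` M"
    have "?b ks \<in> poly_vs.span ?S" if ks: "ks \<in> ?T" for ks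
    proof -
      have le: "exponents_le E (mon_prod as ks)"
        using exponents_le_mon_prod[OF D, of ks e] ks as(1) unfolding E_def exponent_lists_def
          by simp
      have kM: "m \<in> M" if m: "m \<in> keys (?b ks)" for m
        using m le mon_prod_in_polys[OF aspoly, of ks]
        unfolding M_def keys_restrict_poly exponents_le_def polys_def by blast
      have "single m c \<in> poly_vs.span ?S" if m: "m \<in> keys (?b ks)" for m c
      proof -
        have eq: "single m c = scale_poly c (single m 1)"
          by (simp add: scale_poly_def mult_single)
        show ?thesis
          unfolding eq by (rule poly_vs.span_scale, rule poly_vs.span_base) (use kM[OF m] in blast)
      qed
      then have "(\<Sum>m\<in>keys (?b ks). single m (lookup (?b ks) m)) \<in> poly_vs.span ?S"
        by (intro poly_vs.span_sum) auto
      then show ?thesis using poly_sum_singles[of "?b ks"] by simp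
    qed
    then have "card (?b ` ?T) \<le> card ?S"
      using poly_vs.independent_span_bound[OF _ ind, of ?S] finM by blast
    also have "\<dots> \<le> card M" by (rule card_image_le[OF finM])
    finally have "card ?T \<le> card M" by (simp add: card_image[OF inj])
    moreover have "card ?T = e ^ r"
      unfolding exponent_lists_def by (subst card_lists_length_eq) auto
    ultimately show ?thesis using cM unfolding E_def by simp
  qed
  define e where "e = Suc C"
  have "e * e ^ d = e ^ Suc d" by simp
  also have "\<dots> \<le> e ^ r" using rd by (intro power_increasing) (auto simp: e_def)
  also have "\<dots> \<le> 2 ^ n * Suc (r * (e * D)) ^ d" by (rule bound)
  also have "\<dots> \<le> 2 ^ n * (e * Suc (r * D)) ^ d"
  proof (intro mult_left_mono power_mono)
    show "Suc (r * (e * D)) \<le> e * Suc (r * D)" by (simp add: e_def algebra_simps)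
  qed simp_all
  also have "\<dots> = C * e ^ d" by (simp only: C_def power_mult_distrib mult_ac)
  finally have "e \<le> C" by (simp add: e_def)
  then show False by (simp add: e_def)
qed

section \<open>Zariski's lemma\<close>

text \<open>
  The submodule generated by \<open>B\<close> over the polynomials in the variables \<open>Y\<close>, modulo \<open>M\<close>.
\<close>

definition span_mod :: "nat set \<Rightarrow> (monomial \<Rightarrow>\<^sub>0 'k::field) set \<Rightarrow> (monomial \<Rightarrow>\<^sub>0 'k) set \<Rightarrow> (monomial
  \<Rightarrow>\<^sub>0 'k) set" where
  "span_mod Y M B = {(\<Sum>b\<in>B. v b * b) + u | v u. (\<forall>b. v b \<in> polys Y) \<and> u \<in> M}"

lemma span_modI:
  assumes "x = (\<Sum>b\<in>B. v b * b) + u" "\<forall>b. v b \<in> polys Y" "u \<in> M"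
  shows "x \<in> span_mod Y M B"
  unfolding span_mod_def by (intro CollectI exI[of _ v] exI[of _ u] conjI assms)

context
  fixes M :: "(monomial \<Rightarrow>\<^sub>0 'k::field) set" and K :: "'k itself" and n :: nat and Y :: "nat set"
  assumes M: "ideal M (poly_ring K n)" and Y: "Y \<subseteq> {1..n}"
begin

lemma span_mod_add:
  assumes "x \<in> span_mod Y M B" "x' \<in> span_mod Y M B"
  shows "x + x' \<in> span_mod Y M B"
proof -
  obtain v u v' u' where *: "x = (\<Sum>b\<in>B. v b * b) + u" "x' = (\<Sum>b\<in>B. v' b * b) + u'"
    "\<forall>b. v b \<in> polys Y" "\<forall>b. v' b \<in> polys Y" "u \<in> M" "u' \<in> M"
    using assms unfolding span_mod_def by blast
  have "x + x' = (\<Sum>b\<in>B. (v b + v' b) * b) + (u + u')"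
    by (simp add: * sum.distrib algebra_simps)
  moreover have "\<forall>b. v b + v' b \<in> polys Y" using * by simp
  moreover have "u + u' \<in> M" using * by (intro poly_ideal_add[OF M])
  ultimately show ?thesis by (rule span_modI)
qed

lemma span_mod_mult:
  assumes "x \<in> span_mod Y M B" "r \<in> polys Y"
  shows "r * x \<in> span_mod Y M B"
proof -
  obtain v u where *: "x = (\<Sum>b\<in>B. v b * b) + u" "\<forall>b. v b \<in> polys Y" "u \<in> M"
    using assms unfolding span_mod_def by blast
  have "r * x = (\<Sum>b\<in>B. (r * v b) * b) + r * u"
    by (simp add: * sum_distrib_left algebra_simps)
  moreover have "\<forall>b. r * v b \<in> polys Y" using * assms(2) by simp
  moreover have "r * u \<in> M" using assms(2) polys_mono[OF Y] *(3)
    by (intro poly_ideal_mult[OF M]) auto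
  ultimately show ?thesis by (rule span_modI)
qed

lemma span_mod_ideal: "u \<in> M \<Longrightarrow> u \<in> span_mod Y M B"
  unfolding span_mod_def by (intro CollectI exI[of _ "\<lambda>_. 0"] exI[of _ u]) simp

lemma span_mod_base:
  assumes "finite B" "b \<in> B"
  shows "b \<in> span_mod Y M B"
proof -
  have "b = (\<Sum>b'\<in>B. (if b' = b then 1 else 0) * b') + 0"
    using assms by (simp add: if_distrib[of "\<lambda>x. x * _"] cong: if_cong)
  then show ?thesis unfolding span_mod_def using poly_ideal_zero[OF M]
    by (intro CollectI exI[of _ "\<lambda>b'. if b' = b then 1 else 0"] exI[of _ 0]) auto
qed

lemma span_mod_sum: "(\<And>i. i \<in> I \<Longrightarrow> f i \<in> span_mod Y M B) \<Longrightarrow> sum f I \<in> span_mod Y M B"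
  by (induction I rule: infinite_finite_induct)
     (auto intro: span_mod_add span_mod_ideal poly_ideal_zero[OF M])

lemma span_mod_remove:
  assumes "x \<in> span_mod Y M B" "finite B" "b \<in> B"
  obtains v w where "v \<in> polys Y" "w \<in> span_mod Y M (B - {b})" "x = w + v * b"
proof -
  obtain v u where *: "x = (\<Sum>b\<in>B. v b * b) + u" "\<forall>b. v b \<in> polys Y" "u \<in> M"
    using assms unfolding span_mod_def by blast
  have "x = ((\<Sum>b\<in>B - {b}. v b * b) + u) + v b * b"
    using assms *(1) by (simp add: sum.remove[of B b])
  moreover have "(\<Sum>b\<in>B - {b}. v b * b) + u \<in> span_mod Y M (B - {b})"
    using * unfolding span_mod_def by blast
  ultimately show thesis using that *(2) by blast
qed

lemma span_mod_map:
  assumes h: "h \<in> polys {1..n}" and gen: "\<And>b. b \<in> B \<Longrightarrow> h * b \<in> span_mod Y M B'"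
    and x: "x \<in> span_mod Y M B"
  shows "h * x \<in> span_mod Y M B'"
proof -
  obtain v u where *: "x = (\<Sum>b\<in>B. v b * b) + u" "\<forall>b. v b \<in> polys Y" "u \<in> M"
    using x unfolding span_mod_def by blast
  have "h * x = (\<Sum>b\<in>B. v b * (h * b)) + h * u"
    by (simp add: * sum_distrib_left algebra_simps)
  also have "\<dots> \<in> span_mod Y M B'"
  proof (rule span_mod_add)
    show "(\<Sum>b\<in>B. v b * (h * b)) \<in> span_mod Y M B'"
      by (rule span_mod_sum, rule span_mod_mult) (use *(2) gen in auto)
    show "h * u \<in> span_mod Y M B'" by (intro span_mod_ideal poly_ideal_mult[OF M] h *(3))
  qed
  finally show ?thesis .
qed

text \<open>
  Nakayama's lemma over the localization \<open>k[Y]\<^sub>c\<close>: if the ring modulo \<open>M\<close> is a finite module over it and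
  \<open>g\<close> is invertible modulo \<open>M\<close>, then the module equals \<open>g\<close> times itself, so an element congruent to a unit
  modulo \<open>g\<close> annihilates it.  The generators are removed one after the other.  Powers of \<open>c\<close> clear the
  denominators.
\<close>

lemma nakayama_elimination:
  assumes B: "finite B" "B \<subseteq> polys {1..n}" "1 \<in> span_mod Y M B" and c: "c \<in> polys Y"
    and fg: "\<And>f. f \<in> polys {1..n} \<Longrightarrow> \<exists>N. c ^ N * f \<in> span_mod Y M B"
    and g: "g \<in> polys Y" and u: "u \<in> polys {1..n}" "g * u - 1 \<in> M"
  shows "\<exists>N. \<exists>v\<in>polys Y. c ^ N + g * v \<in> M"
proof -
  have Yn: "p \<in> polys {1..n}" if "p \<in> polys Y" for p :: "monomial \<Rightarrow>\<^sub>0 'k"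
    using that polys_mono[OF Y] by blast
  have "\<exists>N. \<exists>v\<in>polys Y. \<forall>x\<in>span_mod Y M B. (c ^ N + g * v) * x \<in> span_mod Y M (B - C)"
    if "finite C" "C \<subseteq> B" for C
    using that
  proof (induction C)
    case empty
    have "\<forall>x\<in>span_mod Y M B. (c ^ 0 + g * 0) * x \<in> span_mod Y M (B - {})" by simp
    then show ?case using polys_0 by blast
  next
    case (insert \<beta> C)
    then obtain N v0 where v0: "v0 \<in> polys Y"
      and IH: "\<And>x. x \<in> span_mod Y M B \<Longrightarrow> (c ^ N + g * v0) * x \<in> span_mod Y M (B - C)" by auto
    define a where "a = c ^ N + g * v0"
    have aY: "a \<in> polys Y" unfolding a_def using c g v0 by simp
    have \<beta>: "\<beta> \<in> B - C" and \<beta>n: "\<beta> \<in> polys {1..n}" using insert B(2) by auto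
    have BC: "finite (B - C)" "B - C - {\<beta>} = B - insert \<beta> C" using B(1) by auto
    obtain N' where "c ^ N' * (u * \<beta>) \<in> span_mod Y M B" using fg[of "u * \<beta>"] u \<beta>n by auto
    from IH[OF this] have "a * (c ^ N' * (u * \<beta>)) \<in> span_mod Y M (B - C)" unfolding a_def .
    then obtain v w where v: "v \<in> polys Y" and w: "w \<in> span_mod Y M (B - insert \<beta> C)"
      and eq: "a * (c ^ N' * (u * \<beta>)) = w + v * \<beta>"
      using span_mod_remove[OF _ BC(1) \<beta>] unfolding BC(2) by blast
    define h where "h = a * c ^ N' - g * v"
    have hY: "h \<in> polys Y" unfolding h_def using aY c g v by simp
    have "h * \<beta> = g * w - (a * c ^ N' * \<beta>) * (g * u - 1)"
    proof -
      have "g * (a * (c ^ N' * (u * \<beta>))) = g * w + g * (v * \<beta>)" unfolding eq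
        by (simp add: algebra_simps)
      then show ?thesis unfolding h_def by (simp add: algebra_simps)
    qed
    also have "\<dots> = g * w + (- (a * c ^ N' * \<beta>)) * (g * u - 1)" by simp
    also have "\<dots> \<in> span_mod Y M (B - insert \<beta> C)"
      using aY c \<beta>n Yn
      by (intro span_mod_add span_mod_mult[OF w g] span_mod_ideal poly_ideal_mult[OF M u(2)]) simp
    finally have h\<beta>: "h * \<beta> \<in> span_mod Y M (B - insert \<beta> C)" .
    have res: "(h * a) * x \<in> span_mod Y M (B - insert \<beta> C)" if x: "x \<in> span_mod Y M B" for x
    proof -
      have "a * x \<in> span_mod Y M (B - C)" using IH[OF x] unfolding a_def .
      then obtain v1 w1 where v1: "v1 \<in> polys Y" and w1: "w1 \<in> span_mod Y M (B - insert \<beta> C)"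
        and ax: "a * x = w1 + v1 * \<beta>"
        using span_mod_remove[OF _ BC(1) \<beta>] unfolding BC(2) by blast
      have "(h * a) * x = h * w1 + v1 * (h * \<beta>)" unfolding mult.assoc ax
        by (simp add: algebra_simps)
      then show ?thesis using span_mod_add span_mod_mult w1 hY h\<beta> v1 by simp
    qed
    have "h * a = c ^ (N + N' + N) + g * (v0 * c ^ N' * a + c ^ N * c ^ N' * v0 - v * a)"
      unfolding h_def a_def by (simp add: algebra_simps power_add)
    moreover have "v0 * c ^ N' * a + c ^ N * c ^ N' * v0 - v * a \<in> polys Y" using v0 c aY v by simp
    ultimately show ?case using res by metis
  qed
  from this[OF B(1) order_refl] obtain N v where v: "v \<in> polys Y"
    "\<And>x. x \<in> span_mod Y M B \<Longrightarrow> (c ^ N + g * v) * x \<in> span_mod Y M (B - B)" by blast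
  have "(c ^ N + g * v) * 1 \<in> span_mod Y M (B - B)" by (rule v(2)[OF B(3)])
  then have "c ^ N + g * v \<in> M" by (simp add: span_mod_def)
  then show ?thesis using v(1) by blast
qed

end

definition var_power :: "nat \<Rightarrow> nat \<Rightarrow> (monomial \<Rightarrow>\<^sub>0 'k::field)" where
  "var_power z i = single (single z i) 1"

lemma var_power_in_polys [simp]: "z \<in> A \<Longrightarrow> var_power z i \<in> polys A"
  by (simp add: var_power_def)

lemma var_power_add: "var_power z (i + j) = var_power z i * var_power z j"
  by (simp add: var_power_def mult_single single_add)

lemma expand_in_variable:
  fixes p :: "monomial \<Rightarrow>\<^sub>0 'k::field"
  assumes p: "p \<in> polys (insert z Y)" and z: "z \<notin> Y"
  obtains q N where "\<And>i. q i \<in> polys Y" "p = (\<Sum>i\<le>N. q i * var_power z i)"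
proof -
  let ?e = "\<lambda>k. lookup k z"
  let ?t = "\<lambda>k. single (k - single z (?e k)) (lookup p k)"
  define q where "q i = (\<Sum>k\<in>{k \<in> keys p. ?e k = i}. ?t k)" for i
  define N where "N = Max (insert 0 (?e ` keys p))"
  have "q i \<in> polys Y" for i
    unfolding q_def
  proof (intro polys_sum polys_single)
    fix k assume k: "k \<in> {k \<in> keys p. ?e k = i}"
    then have "keys k \<subseteq> insert z Y" using p by (auto simp: polys_def)
    moreover have "keys (k - single z (?e k)) \<subseteq> keys k - {z}"
      by (auto simp: in_keys_iff lookup_minus lookup_single when_def split: if_splits)
    ultimately show "keys (k - single z (?e k)) \<subseteq> Y" by blast
  qed
  moreover have "p = (\<Sum>i\<le>N. q i * var_power z i)"
  proof -
    have "?t k * var_power z (?e k) = single k (lookup p k)" for k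
    proof -
      have "mon_divides (single z (?e k)) k"
        by (simp add: mon_divides_def lookup_single when_def)
      then show ?thesis
        using mon_divides_imp_add by (simp add: var_power_def mult_single add.commute)
    qed
    then have "(\<Sum>k\<in>keys p. ?t k * var_power z (?e k)) = p"
      using poly_sum_singles[of p] by simp
    moreover have "(\<Sum>i\<in>{..N}. \<Sum>k\<in>{k \<in> keys p. ?e k = i}. ?t k * var_power z (?e k)) =
       (\<Sum>k\<in>keys p. ?t k * var_power z (?e k))"
      by (rule sum.group) (auto simp: N_def)
    moreover have "(\<Sum>k\<in>{k \<in> keys p. ?e k = i}. ?t k * var_power z (?e k))
      = q i * var_power z i" for i
      unfolding q_def sum_distrib_right by (rule sum.cong) auto
    ultimately show ?thesis by simp
  qed
  ultimately show thesis by (rule that)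
qed

lemma leading_relation:
  fixes p :: "monomial \<Rightarrow>\<^sub>0 'k::field"
  assumes p: "p \<in> polys (insert z Y)" and z: "z \<notin> Y" and np: "p \<notin> polys Y"
  shows "\<exists>q m. (\<forall>i. q i \<in> polys Y) \<and> 0 < m \<and> q m \<noteq> 0 \<and>
    p = q m * var_power z m + (\<Sum>i<m. q i * var_power z i)"
proof -
  obtain q N where q: "\<And>i. q i \<in> polys Y" and pN: "p = (\<Sum>i\<le>N. q i * var_power z i)"
    using expand_in_variable[OF p z] by blast
  let ?S = "{i. i \<le> N \<and> q i \<noteq> 0}"
  have v0: "var_power z 0 = (1 :: monomial \<Rightarrow>\<^sub>0 'k)" by (simp add: var_power_def)
  have ne: "?S \<noteq> {}"
  proof
    assume "?S = {}"
    then have "p = 0" unfolding pN by (intro sum.neutral) auto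
    then show False using np by simp
  qed
  define m where "m = Max ?S"
  have m: "m \<in> ?S" unfolding m_def using ne by (intro Max_in) auto
  have mx: "i \<le> m" if "i \<le> N" "q i \<noteq> 0" for i unfolding m_def using that by (intro Max_ge) auto
  have pm: "p = (\<Sum>i\<le>m. q i * var_power z i)"
    unfolding pN using m mx by (intro sum.mono_neutral_right) force+
  have "m \<noteq> 0"
  proof
    assume "m = 0"
    then have "p = q 0" using pm by (simp add: v0)
    then show False using np q by simp
  qed
  moreover have "p = q m * var_power z m + (\<Sum>i<m. q i * var_power z i)"
    unfolding pm by (simp add: lessThan_Suc_atMost[symmetric] add.commute)
  ultimately show ?thesis using q m by (intro exI[of _ q] exI[of _ m]) simp
qed

lemma single_sum_induct:
  fixes p :: "monomial \<Rightarrow>\<^sub>0 'k::field"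
  assumes p: "p \<in> polys A" and zero: "T 0" and add: "\<And>p q. T p \<Longrightarrow> T q \<Longrightarrow> T (p + q)"
    and single: "\<And>m c. keys m \<subseteq> A \<Longrightarrow> T (single m c)"
  shows "T p"
proof -
  have sum: "T (sum f J)" if "\<And>i. i \<in> J \<Longrightarrow> T (f i)" for f and J :: "monomial set"
    using that by (induction J rule: infinite_finite_induct) (auto intro: zero add)
  have "T (\<Sum>m\<in>keys p. single m (lookup p m))"
    by (rule sum, rule single) (use p in \<open>auto simp: polys_def\<close>)
  then show ?thesis using poly_sum_singles[of p] by simp
qed

text \<open>
  \<open>1 + x\<close> is coprime to \<open>x\<close>, hence would be a unit; but its leading monomial is that of \<open>x\<close>.
\<close>

lemma one_plus_not_dvd_power:
  fixes x :: "monomial \<Rightarrow>\<^sub>0 'k::field"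
  assumes "(1 + x) dvd x ^ N" "x \<noteq> 0" "lm x \<noteq> 0"
  shows False
proof -
  have "(1 + x) dvd 1"
    using assms(1)
  proof (induction N)
    case (Suc N)
    have "x ^ N = x ^ N * (1 + x) - x ^ Suc N" by (simp add: algebra_simps)
    then have "(1 + x) dvd x ^ N" using Suc.prems by (metis dvd_diff dvd_triv_right)
    then show ?case by (rule Suc.IH)
  qed simp
  then obtain h where h: "1 = (1 + x) * h" by (elim dvdE)
  have one: "lm (1 :: monomial \<Rightarrow>\<^sub>0 'k) = 0" by (simp add: lm_def)
  have "1 + x \<noteq> 0" "h \<noteq> 0" using h by auto
  then have "lm (1 + x) + lm h = 0" using lm_mult(1)[of "1 + x" h] h one by simp
  moreover have "lm (1 + x) = lm x"
    using lm_add_distinct[of 1 x] assms(2,3) one monomial_nonneg[of "lm x"] by (simp add: max_def)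
  ultimately have "lm x + lm h = 0" by simp
  then have "keys (lm x) \<union> keys (lm h) = {}"
    by (metis keys_monomial_add keys_zero)
  then show False using assms(3) by simp
qed

text \<open>
  Let \<open>Y\<close> be a largest set of variables that is algebraically independent modulo \<open>M\<close>.  Every other
  variable satisfies a polynomial relation over \<open>k[Y]\<close>, and the product \<open>c\<close> of the leading coefficients is
  nonzero, so that the field \<open>S / M\<close> is a finite module over \<open>k[Y]\<^sub>c\<close>.  If there were some \<open>y \<in> Y\<close>, the
  element \<open>1 + y c\<close> would be invertible in \<open>S / M\<close>, hence by Nakayama's lemma in \<open>k[Y]\<^sub>c\<close>, so it would
  divide a power of \<open>c\<close>; but it is coprime to \<open>c\<close>.  So \<open>Y\<close> is empty, and each variable is algebraic.
\<close>

theorem zariski: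
  fixes M :: "(monomial \<Rightarrow>\<^sub>0 'k::field) set" and K :: "'k itself"
  assumes M: "ideal M (poly_ring K n)" and one: "1 \<notin> M"
    and inv: "\<And>g. g \<in> polys {1..n} \<Longrightarrow> g \<notin> M \<Longrightarrow> \<exists>u\<in>polys {1..n}. g * u - 1 \<in> M"
    and z: "z \<in> {1..n}"
  shows "\<exists>p\<in>M. p \<in> polys {z} \<and> p \<noteq> 0"
proof -
  let ?Ys = "{Y. Y \<subseteq> {1..n} \<and> polys Y \<inter> M \<subseteq> {0}}"
  have fin: "finite ?Ys" by (rule finite_subset[of _ "Pow {1..n}"]) auto
  have "{} \<in> ?Ys"
  proof -
    have "p = 0" if p: "p \<in> polys {}" "p \<in> M" for p :: "monomial \<Rightarrow>\<^sub>0 'k"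
    proof (rule ccontr)
      assume nz: "p \<noteq> 0"
      have k: "keys p \<subseteq> {0}" using p(1) by (auto simp: polys_def)
      define c where "c = lookup p 0"
      have pc: "p = single 0 c"
        by (rule poly_mapping_eqI) (use k in \<open>auto simp: c_def lookup_single when_def in_keys_iff\<close>)
      then have "c \<noteq> 0" using nz by auto
      then have "single 0 (1 / c) * p = 1" by (simp add: pc mult_single)
      moreover have "single 0 (1 / c) * p \<in> M" by (rule poly_ideal_mult[OF M p(2)]) simp
      ultimately show False using one by simp
    qed
    then show ?thesis by auto
  qed
  then have "Max (card ` ?Ys) \<in> card ` ?Ys" using fin by (intro Max_in) auto
  then obtain Y where Y: "Y \<subseteq> {1..n}" "polys Y \<inter> M \<subseteq> {0}" and cY: "card Y = Max (card ` ?Ys)"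
    by auto
  have finY: "finite Y" using Y(1) finite_subset by blast
  have rel: "\<exists>p\<in>M. p \<in> polys (insert x Y) \<and> p \<noteq> 0" if x: "x \<in> {1..n}" "x \<notin> Y" for x
  proof (rule ccontr)
    assume "\<not> ?thesis"
    then have "insert x Y \<in> ?Ys" using x Y(1) by blast
    then have "card (insert x Y) \<le> card Y" unfolding cY using fin by (intro Max_ge) auto
    then show False using x finY by simp
  qed
  have "Y = {}"
  proof (rule ccontr)
    assume "Y \<noteq> {}"
    then obtain y where y: "y \<in> Y" by blast
    let ?Z = "{1..n} - Y"
    define good where "good x q m \<longleftrightarrow> (\<forall>i. q i \<in> polys Y) \<and> 0 < m \<and> q m \<noteq> 0 \<and>
       q m * var_power x m + (\<Sum>i<m. q i * var_power x i) \<in> M" for x and q :: "nat \<Rightarrow> monomial \<Rightarrow>\<^sub>0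
       'k" and m
    have "\<exists>q m. good x q m" if x: "x \<in> ?Z" for x
    proof -
      obtain p where p: "p \<in> M" "p \<in> polys (insert x Y)" "p \<noteq> 0" using rel x by blast
      have "x \<notin> Y" "p \<notin> polys Y" using x p Y(2) by blast+
      then obtain q m where "(\<forall>i. q i \<in> polys Y) \<and> 0 < m \<and> q m \<noteq> 0 \<and>
        p = q m * var_power x m + (\<Sum>i<m. q i * var_power x i)"
        by (elim leading_relation[OF p(2), THEN exE] exE)
      then have "good x q m" unfolding good_def using p(1) by simp
      then show ?thesis by blast
    qed
    then obtain q m where good: "\<And>x. x \<in> ?Z \<Longrightarrow> good x (q x) (m x)" by metis
    then have q: "\<And>x i. x \<in> ?Z \<Longrightarrow> q x i \<in> polys Y"
      and m: "\<And>x. x \<in> ?Z \<Longrightarrow> 0 < m x" and qm: "\<And>x. x \<in> ?Z \<Longrightarrow> q x (m x) \<noteq> 0"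
      and qM: "\<And>x. x \<in> ?Z \<Longrightarrow> q x (m x) * var_power x (m x) + (\<Sum>i<m x. q x i * var_power x i) \<in> M"
      unfolding good_def by blast+
    define c where "c = (\<Prod>x\<in>?Z. q x (m x))"
    have prodY: "(\<Prod>x\<in>Z'. q x (m x)) \<in> polys Y" if "Z' \<subseteq> ?Z" for Z'
      using that by (induction Z' rule: infinite_finite_induct) (use q in auto)
    have c: "c \<in> polys Y" "c \<noteq> 0" unfolding c_def using prodY qm by auto
    \<comment> \<open>The monomials in the other variables with exponents below the degrees of the relations.\<close>
    define Bm where "Bm = {k :: monomial. keys k \<subseteq> ?Z \<and> (\<forall>x\<in>?Z. lookup k x < m x)}"
    define B where "B = (\<lambda>k. single k (1::'k)) ` Bm"
    have finBm: "finite Bm"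
    proof (rule finite_subset)
      show "Bm \<subseteq> {k. keys k \<subseteq> ?Z \<and> (\<forall>i. lookup k i \<le> (\<Sum>x\<in>?Z. m x))}"
      proof safe
        fix k i assume k: "k \<in> Bm"
        then show "i \<in> keys k \<Longrightarrow> i \<in> {1..n}" "i \<in> keys k \<Longrightarrow> i \<in> Y \<Longrightarrow> False"
          by (auto simp: Bm_def)
        show "lookup k i \<le> (\<Sum>x\<in>?Z. m x)"
        proof (cases "i \<in> ?Z")
          case True
          then have "lookup k i \<le> m i" using k by (auto simp: Bm_def intro: less_imp_le)
          also have "\<dots> \<le> (\<Sum>x\<in>?Z. m x)" using True by (intro member_le_sum) auto
          finally show ?thesis .
        next
          case False
          then have "i \<notin> keys k" using k by (auto simp: Bm_def)
          then show ?thesis by (simp add: in_keys_iff)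
        qed
      qed
      show "finite {k :: monomial. keys k \<subseteq> ?Z \<and> (\<forall>i. lookup k i \<le> (\<Sum>x\<in>?Z. m x))}"
        by (rule card_monomials_le(1)) simp
    qed
    then have B: "finite B" by (simp add: B_def)
    have Bn: "B \<subseteq> polys {1..n}"
      unfolding B_def by (intro image_subsetI polys_single) (auto simp: Bm_def)
    have "0 \<in> Bm" using m by (simp add: Bm_def)
    then have oneB: "1 \<in> span_mod Y M B"
      by (intro span_mod_base[OF M Y(1) B]) (auto simp: B_def image_iff intro!: bexI[of _ 0])
    note add = span_mod_add[OF M Y(1)] and mult = span_mod_mult[OF M Y(1)]
      and sum = span_mod_sum[OF M Y(1)] and idl = span_mod_ideal[OF M Y(1)]
      and base = span_mod_base[OF M Y(1) B]
    \<comment> \<open>If the exponent of \<open>x\<close> becomes too large, the relation for \<open>x\<close> lowers it at the cost of one factor \<open>c\<close>.\<close>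
    have step: "(c * var_power x 1) * w \<in> span_mod Y M B"
      if x: "x \<in> ?Z" and w: "w \<in> span_mod Y M B" for x w
    proof (rule span_mod_map[OF M Y(1) _ _ w])
      show "c * var_power x 1 \<in> polys {1..n}" using c(1) polys_mono[OF Y(1)] x by auto
      fix b assume "b \<in> B"
      then obtain k where k: "k \<in> Bm" "b = single k 1" by (auto simp: B_def)
      let ?e = "lookup k x"
      define k' where "k' = k - single x ?e"
      have "mon_divides (single x ?e) k"
        by (simp add: mon_divides_def lookup_single when_def)
      then have kk': "k = single x ?e + k'" unfolding k'_def
        using mon_divides_imp_add by simp
      have inB: "var_power x i * single k' 1 \<in> B" if "i < m x" for i
      proof -
        have lk: "lookup (single x i + k') j =
            (if j = x then i else lookup k j)" for j
          unfolding k'_def by (simp add: lookup_add lookup_minus lookup_single when_def)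
        have "keys (single x i + k') \<subseteq> insert x (keys k)"
          by (auto simp: in_keys_iff lk split: if_splits)
        then have "single x i + k' \<in> Bm"
          using k(1) x that unfolding Bm_def by (auto simp: lk)
        then show ?thesis by (auto simp: B_def var_power_def mult_single)
      qed
      have b: "b = var_power x ?e * single k' 1"
        unfolding k(2) by (subst kk') (simp add: var_power_def mult_single)
      have xb: "var_power x 1 * b = var_power x (Suc ?e) * single k' 1"
      proof -
        have "var_power x (Suc ?e) = var_power x 1 * (var_power x ?e :: monomial \<Rightarrow>\<^sub>0 'k)"
          using var_power_add[of x 1 ?e] by (simp only: plus_1_eq_Suc)
        then show ?thesis unfolding b by (simp only: mult.assoc)
      qed
      show "c * var_power x 1 * b \<in> span_mod Y M B"
      proof (cases "Suc ?e < m x")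
        case True
        then have "var_power x 1 * b \<in> B" unfolding xb by (rule inB)
        then have "c * (var_power x 1 * b) \<in> span_mod Y M B" by (intro mult base c)
        then show ?thesis by (simp add: mult.assoc)
      next
        case False
        have "?e < m x" using k(1) x by (auto simp: Bm_def)
        then have em: "Suc ?e = m x" using False by simp
        define c' where "c' = (\<Prod>x\<in>?Z - {x}. q x (m x))"
        have c': "c' \<in> polys Y" unfolding c'_def by (rule prodY) auto
        have cc': "c = q x (m x) * c'" unfolding c_def c'_def using x by (intro prod.remove) auto
        let ?s = "\<Sum>i<m x. q x i * var_power x i"
        let ?k = "single k' (1::'k)"
        have k'n: "?k \<in> polys {1..n}"
        proof (rule polys_single)
          have "keys k' \<subseteq> keys k" unfolding k'_def by (auto simp: in_keys_iff lookup_minus)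
          then show "keys k' \<subseteq> {1..n}" using k(1) by (auto simp: Bm_def)
        qed
        have c'n: "c' \<in> polys {1..n}" using c' polys_mono[OF Y(1)] by auto
        have "c * var_power x 1 * b = c' * (q x (m x) * var_power x (m x)) * ?k"
          using xb unfolding cc' em by (simp add: mult_ac)
        also have "\<dots>
          = (c' * ?k) * (q x (m x) * var_power x (m x) + ?s) + (\<Sum>i<m x. (- (c' * q x i)) *
          (var_power x i * ?k))"
          by (simp add: sum_negf sum_distrib_left sum_distrib_right algebra_simps)
        also have "\<dots> \<in> span_mod Y M B"
          using c' q[OF x]
            by (intro add sum mult base idl inB poly_ideal_mult[OF M qM[OF x]] polys_mult c'n k'n
            polys_uminus) auto
        finally show ?thesis .
      qed
    qed
    have fg: "\<exists>N. c ^ N * f \<in> span_mod Y M B" if f: "f \<in> polys {1..n}" for f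
      using f
    proof (rule single_sum_induct)
      show "\<exists>N. c ^ N * 0 \<in> span_mod Y M B" using idl[OF poly_ideal_zero[OF M]] by simp
    next
      fix p p' assume "\<exists>N. c ^ N * p \<in> span_mod Y M B" "\<exists>N. c ^ N * p' \<in> span_mod Y M B"
      then obtain N N' where *: "c ^ N * p \<in> span_mod Y M B" "c ^ N' * p' \<in> span_mod Y M B" by blast
      have "c ^ (N + N') * (p + p') = c ^ N' * (c ^ N * p) + c ^ N * (c ^ N' * p')"
        by (simp add: algebra_simps power_add)
      also have "\<dots> \<in> span_mod Y M B" using c by (intro add mult *) auto
      finally show "\<exists>N. c ^ N * (p + p') \<in> span_mod Y M B" by blast
    next
      fix k :: monomial and a :: 'k
      assume "keys k \<subseteq> {1..n}"
      then show "\<exists>N. c ^ N * single k a \<in> span_mod Y M B"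
      proof (induction "\<Sum>i\<in>{1..n}. lookup k i" arbitrary: k rule: less_induct)
        case less
        show ?case
        proof (cases "keys k \<subseteq> Y")
          case True
          then have "single k a * 1 \<in> span_mod Y M B" by (intro mult oneB polys_single)
          then show ?thesis by (intro exI[of _ 0]) simp
        next
          case False
          then obtain x where x: "x \<in> keys k" "x \<in> ?Z" using less.prems by blast
          define k' where "k' = k - single x 1"
          have "mon_divides (single x 1) k"
            using x(1) by (auto simp: mon_divides_def lookup_single when_def in_keys_iff)
          then have kk': "k = single x 1 + k'" unfolding k'_def
            using mon_divides_imp_add by simp
          have "keys k' \<subseteq> {1..n}" using less.prems kk' keys_monomial_add by blast
          moreover have "(\<Sum>i\<in>{1..n}. lookup k' i) < (\<Sum>i\<in>{1..n}. lookup k i)"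
          proof (rule sum_strict_mono_ex1)
            show "\<forall>i\<in>{1..n}. lookup k' i \<le> lookup k i"
              by (subst kk') (simp add: lookup_add)
            show "\<exists>i\<in>{1..n}. lookup k' i < lookup k i"
              using x(2) by (intro bexI[of _ x], subst kk') (auto simp: lookup_add)
          qed simp
          ultimately obtain N where "c ^ N * single k' a \<in> span_mod Y M B"
            using less.hyps by blast
          from step[OF x(2) this]
          have "(c * var_power x 1) * (c ^ N * single k' a) \<in> span_mod Y M B" .
          also have "(c * var_power x 1) * (c ^ N * single k' a) =
              c ^ Suc N * (var_power x 1 * single k' a)"
            by (simp only: power_Suc mult_ac)
          also have "var_power x 1 * single k' a = single k a"
            by (subst kk') (simp add: var_power_def mult_single)
          finally have "c ^ Suc N * single k a \<in> span_mod Y M B" .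
          then show ?thesis by blast
        qed
      qed
    qed
    let ?x = "var_power y 1 * c"
    have vy: "var_power y 1 \<noteq> (0 :: monomial \<Rightarrow>\<^sub>0 'k)" by (simp add: var_power_def)
    have x: "?x \<in> polys Y" "?x \<noteq> 0" using y c vy by auto
    have "lm ?x = single y 1 + lm c" using lm_mult(1)[OF vy c(2)] by (simp add: var_power_def)
    then have "y \<in> keys (lm ?x)" by (simp add: keys_monomial_add)
    then have lmx: "lm ?x \<noteq> 0" by auto
    have gY: "1 + ?x \<in> polys Y" using x by simp
    have gn: "1 + ?x \<in> polys {1..n}" using gY polys_mono[OF Y(1)] by blast
    have "1 + ?x \<noteq> 0"
    proof
      assume "1 + ?x = 0"
      then have "1 = - ?x" by (rule eq_neg_iff_add_eq_0[THEN iffD2])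
      then have "keys (1 :: monomial \<Rightarrow>\<^sub>0 'k) = keys (- ?x)" by (rule arg_cong)
      then have "keys ?x = {0}" by simp
      then show False using lmx by (simp add: lm_def)
    qed
    then have "1 + ?x \<notin> M" using gY Y(2) by blast
    then obtain u where u: "u \<in> polys {1..n}" "(1 + ?x) * u - 1 \<in> M" using inv[OF gn] by blast
    obtain N v where v: "v \<in> polys Y" "c ^ N + (1 + ?x) * v \<in> M"
      using nakayama_elimination[OF M Y(1) B Bn oneB c(1) fg gY u] by blast
    have "c ^ N + (1 + ?x) * v \<in> polys Y"
      by (intro polys_add[OF polys_power polys_mult] c(1) gY v(1))
    with v(2) have "c ^ N + (1 + ?x) * v = 0" using Y(2) by blast
    then have "c ^ N = (1 + ?x) * (- v)" by (simp add: eq_neg_iff_add_eq_0)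
    then have "(1 + ?x) dvd c ^ N" by (rule dvdI)
    then have "(1 + ?x) dvd ?x ^ N" by (simp add: power_mult_distrib)
    then show False using one_plus_not_dvd_power[OF _ x(2) lmx] by blast
  qed
  then show ?thesis using rel[OF z] by auto
qed

section \<open>Faces of the complex of a lexsegment ideal\<close>

text \<open>
  The lexicographic order of the squarefree monomials with supports \<open>W\<close> and \<open>J\<close>.
\<close>

definition lex_ge :: "nat set \<Rightarrow> nat set \<Rightarrow> bool" where
  "lex_ge W J \<longleftrightarrow> W = J \<or> (\<exists>k\<in>W - J. \<forall>i<k. i \<in> W \<longleftrightarrow> i \<in> J)"

lemma squarefree_product_ge_iff:
  assumes "finite W" "finite J"
  shows "squarefree_product W \<ge> squarefree_product J \<longleftrightarrow> lex_ge W J"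
proof -
  have eq: "squarefree_product J = squarefree_product W \<longleftrightarrow> J = W"
    using keys_squarefree_product assms by metis
  have "squarefree_product J < squarefree_product W \<longleftrightarrow> (\<exists>k\<in>W - J. \<forall>i<k. i \<in> W \<longleftrightarrow> i \<in> J)"
    unfolding monomial_less_iff lookup_squarefree_product[OF assms(1)]
    lookup_squarefree_product[OF assms(2)]
    by (auto split: if_splits)
  then show ?thesis unfolding lex_ge_def le_less eq by blast
qed

lemma monomial_degree_squarefree_product:
  "finite W \<Longrightarrow> monomial_degree (squarefree_product W) = card W"
  by (simp add: monomial_degree_def keys_squarefree_product lookup_squarefree_product)

lemma squarefree_monomials_eq:
  "squarefree_monomials n q = squarefree_product ` {W. W \<subseteq> {1..n} \<and> card W = q}"
proof (intro equalityI subsetI)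
  fix m assume m: "m \<in> squarefree_monomials n q"
  let ?W = "keys m"
  have "lookup m i = (if i \<in> ?W then 1 else 0)" for i
  proof -
    have "lookup m i \<le> 1" using m by (simp add: squarefree_monomials_def)
    then show ?thesis by (auto simp: in_keys_iff)
  qed
  then have eq: "m = squarefree_product ?W"
    by (intro poly_mapping_eqI) (simp add: lookup_squarefree_product)
  have "card ?W = q"
    using m monomial_degree_squarefree_product[of ?W] eq by (simp add: squarefree_monomials_def)
  then show "m \<in> squarefree_product ` {W. W \<subseteq> {1..n} \<and> card W = q}"
    using m eq by (intro image_eqI[of _ _ ?W]) (auto simp: squarefree_monomials_def)
next
  fix m assume "m \<in> squarefree_product ` {W. W \<subseteq> {1..n} \<and> card W = q}"
  then obtain W where W: "W \<subseteq> {1..n}" "card W = q" "m = squarefree_product W" by blast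
  have "finite W" using W(1) finite_subset by blast
  then show "m \<in> squarefree_monomials n q"
    using W by (simp add: squarefree_monomials_def keys_squarefree_product
        lookup_squarefree_product monomial_degree_squarefree_product)
qed

lemma nonfaces_of_lexsegment:
  fixes K :: "'k::field itself"
  assumes \<Delta>: "simplicial_complex n \<Delta>" and J: "J \<subseteq> {1..n}"
    and eq: "initial_lexsegment_ideal K n (squarefree_product J) = stanley_reisner_ideal K n \<Delta>"
    and A: "A \<subseteq> {1..n}"
  shows "A \<notin> \<Delta> \<longleftrightarrow> (\<exists>W\<subseteq>A. card W = card J \<and> lex_ge W J)"
proof -
  have fin: "finite W" if "W \<subseteq> {1..n}" for W :: "nat set" using that finite_subset by blast
  let ?L = "initial_lexsegment n (squarefree_product J)"
  have L: "?L = squarefree_product ` {W. W \<subseteq> {1..n} \<and> card W = card J \<and> lex_ge W J}"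
    unfolding initial_lexsegment_def squarefree_monomials_eq monomial_degree_squarefree_product[OF
    fin[OF J]]
    using squarefree_product_ge_iff[OF fin fin[OF J]] by auto
  have Lk: "keys m \<subseteq> {1..n}" if "m \<in> ?L" for m
    using that by (auto simp: initial_lexsegment_def squarefree_monomials_def)
  let ?x = "single (squarefree_product A) (1::'k)"
  have x: "?x \<in> polys {1..n}" using A by (simp add: keys_squarefree_product fin)
  have gen: "genideal (poly_ring K n) (monomial_poly K ` ?L) =
    {p \<in> polys {1..n}. \<forall>m\<in>keys p. \<exists>w\<in>?L. mon_divides w m}"
    by (rule genideal_monomials[OF Lk])
  have "A \<notin> \<Delta> \<longleftrightarrow> ?x \<in> stanley_reisner_ideal K n \<Delta>"
    using A x by (simp add: stanley_reisner_ideal_eq[OF \<Delta>] mon_ideal_def keys_squarefree_product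
      fin)
  also have "\<dots> \<longleftrightarrow> (\<exists>w\<in>?L. mon_divides w (squarefree_product A))"
    unfolding eq[symmetric] initial_lexsegment_ideal_def gen using x by simp
  also have "\<dots> \<longleftrightarrow> (\<exists>W\<subseteq>A. card W = card J \<and> lex_ge W J)"
  proof
    assume "\<exists>w\<in>?L. mon_divides w (squarefree_product A)"
    then obtain W where "W \<subseteq> {1..n}" "card W = card J" "lex_ge W J"
      "mon_divides (squarefree_product W) (squarefree_product A)" unfolding L by blast
    then show "\<exists>W\<subseteq>A. card W = card J \<and> lex_ge W J"
      using squarefree_product_divides[OF fin, of W] keys_squarefree_product[OF fin[OF A]] by auto
  next
    assume "\<exists>W\<subseteq>A. card W = card J \<and> lex_ge W J"
    then obtain W where W: "W \<subseteq> A" "card W = card J" "lex_ge W J" by blast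
    have Wn: "W \<subseteq> {1..n}" using W(1) A by blast
    have "mon_divides (squarefree_product W) (squarefree_product A)"
      using squarefree_product_divides[OF fin[OF Wn]] keys_squarefree_product[OF fin[OF A]] W(1)
        by simp
    then show "\<exists>w\<in>?L. mon_divides w (squarefree_product A)" unfolding L using W Wn by blast
  qed
  finally show ?thesis .
qed

text \<open>
  \<open>J\<close> is the support of \<open>v\<close>, and \<open>a = j\<^sub>1\<close> is its smallest element.
\<close>

locale lexsegment_complex =
  fixes n q a :: nat and J :: "nat set" and \<Delta> :: "nat set set"
  assumes complex: "simplicial_complex n \<Delta>"
    and q: "2 \<le> q" "card J = q" and a: "2 \<le> a" "a \<in> J" and J: "J \<subseteq> {a..n}"
    and nonface: "\<And>A. A \<subseteq> {1..n} \<Longrightarrow> A \<notin> \<Delta> \<longleftrightarrow> (\<exists>W\<subseteq>A. card W = q \<and> lex_ge W J)"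
begin

lemmas vertices = face_vertices[OF complex]
lemmas subface = face_subset[OF complex]

lemma finite_face: "A \<in> \<Delta> \<Longrightarrow> finite A"
  using vertices finite_subset by blast

lemma finite_complex: "finite \<Delta>"
  by (rule finite_subset[of _ "Pow {1..n}"]) (use vertices in auto)

lemma a_le: "a \<le> n" and q_le: "q \<le> Suc n - a" and q_less: "q < n"
proof -
  show an: "a \<le> n" using a(2) J by auto
  have "card J \<le> card {a..n}" using J by (intro card_mono) auto
  then show "q \<le> Suc n - a" using q(2) by simp
  then show "q < n" using a(1) an by linarith
qed

lemma small_face:
  assumes "A \<subseteq> {1..n}" "card A < q"
  shows "A \<in> \<Delta>"
proof (rule ccontr)
  assume "A \<notin> \<Delta>"
  then obtain W where "W \<subseteq> A" "card W = q" using nonface[OF assms(1)] by blast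
  then show False using assms card_mono[of A W] finite_subset[OF assms(1)] by simp
qed

text \<open>
  A \<open>q\<close>-element set that starts before \<open>a\<close> is lexicographically larger than \<open>J\<close>.
\<close>

lemma early_vertex_nonface:
  assumes A: "A \<subseteq> {1..n}" "q \<le> card A" and i: "i \<in> A" "i < a"
  shows "A \<notin> \<Delta>"
proof -
  have finA: "finite A" using A(1) finite_subset by blast
  obtain W where W: "{i} \<subseteq> W" "W \<subseteq> A" "card W = q"
    using exists_subset_between[of "{i}" q A] A i(1) q(1) finA by auto
  have finW: "finite W" using W(2) finA finite_subset by blast
  let ?k = "Min W"
  have k: "?k \<in> W" "?k \<le> i" using W(1) finW by (auto intro: Min_in)
  have "?k \<in> W - J" using k i(2) J by auto
  moreover have "l \<in> W \<longleftrightarrow> l \<in> J" if "l < ?k" for l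
  proof -
    have "l \<notin> W" using that Min_le[OF finW, of l] by fastforce
    moreover have "l \<notin> J" using that k i(2) J by auto
    ultimately show ?thesis by simp
  qed
  ultimately have "lex_ge W J" unfolding lex_ge_def by blast
  then show ?thesis using nonface[OF A(1)] W by blast
qed

lemma top_face: "{Suc a..n} \<in> \<Delta>"
proof (rule ccontr)
  have sub: "{Suc a..n} \<subseteq> {1..n}" by auto
  assume "{Suc a..n} \<notin> \<Delta>"
  then obtain W where W: "W \<subseteq> {Suc a..n}" "lex_ge W J" using nonface[OF sub] by blast
  have "a \<notin> W" using W(1) by auto
  then obtain k where "k \<in> W" "\<forall>i<k. i \<in> W \<longleftrightarrow> i \<in> J" using W(2) a(2) by (auto simp: lex_ge_def)
  then show False using W(1) \<open>a \<notin> W\<close> a(2) by (auto simp: Suc_le_eq subset_iff)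
qed

lemma card_face_le:
  assumes A: "A \<in> \<Delta>"
  shows "card A \<le> n - a"
proof (rule ccontr)
  assume "\<not> card A \<le> n - a"
  then have cA: "Suc n - a \<le> card A" using a_le by linarith
  note An = vertices[OF A]
  show False
  proof (cases "A \<subseteq> {a..n}")
    case True
    then have "A = {a..n}" using cA by (intro card_seteq) auto
    then have "J \<subseteq> A" using J by simp
    moreover have "lex_ge J J" by (simp add: lex_ge_def)
    ultimately show False using nonface[OF An] A q(2) by blast
  next
    case False
    then obtain i where "i \<in> A" "i \<notin> {a..n}" by blast
    moreover from this have "i < a" using An by auto
    ultimately show False using early_vertex_nonface[OF An] A cA q_le by auto
  qed
qed

text \<open>
  Replacing an element of a \<open>q\<close>-element set by a smaller one makes the set lexicographically larger; so if the set
  with the later vertex contains a generator, then so does the one with the earlier vertex.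
\<close>

lemma shifted: "shifted n \<Delta>"
  unfolding shifted_def
proof (intro allI impI, rule ccontr)
  fix A i j assume iA: "insert i A \<in> \<Delta>" and ij: "i < j" "j \<le> n" "i \<notin> A" "j \<notin> A"
    and njA: "insert j A \<notin> \<Delta>"
  have sub: "insert j A \<subseteq> {1..n}" "insert i A \<subseteq> {1..n}" using vertices[OF iA] ij by auto
  obtain W where W: "W \<subseteq> insert j A" "card W = q" "lex_ge W J"
    using njA nonface[OF sub(1)] by blast
  have finW: "finite W" using W(1) sub(1) finite_subset by (meson finite_atLeastAtMost)
  show False
  proof (cases "j \<in> W")
    case False
    then have "W \<subseteq> insert i A" using W(1) by blast
    then show False using nonface[OF sub(2)] iA W by blast
  next
    case True
    have iW: "i \<notin> W" using W(1) ij by auto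
    define W' where "W' = insert i (W - {j})"
    have "card W' = q" using W(2) True iW finW q(1) by (simp add: W'_def)
    moreover have "W' \<subseteq> insert i A" using W(1) by (auto simp: W'_def)
    moreover have "lex_ge W' J"
    proof -
      have W'W: "l \<in> W' \<longleftrightarrow> l \<in> W" if "l < i" for l using that ij(1) by (auto simp: W'_def)
      have ii: "i \<in> W'" by (simp add: W'_def)
      show ?thesis
      proof (cases "W = J")
        case True
        then show ?thesis unfolding lex_ge_def using iW ii W'W by blast
      next
        case False
        then obtain k where k: "k \<in> W - J" "\<forall>l<k. l \<in> W \<longleftrightarrow> l \<in> J" using W(3)
          by (auto simp: lex_ge_def)
        show ?thesis
        proof (cases "k < i")
          case True
          then have "k \<in> W' - J" "\<forall>l<k. l \<in> W' \<longleftrightarrow> l \<in> J" using k W'W by auto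
          then show ?thesis unfolding lex_ge_def by blast
        next
          case False
          moreover have "k \<noteq> i" using k(1) iW by auto
          ultimately have ik: "i < k" by simp
          then have "i \<in> W' - J" "\<forall>l<i. l \<in> W' \<longleftrightarrow> l \<in> J" using k(2) iW ii W'W by auto
          then show ?thesis unfolding lex_ge_def by blast
        qed
      qed
    qed
    ultimately show False using nonface[OF sub(2)] iA by blast
  qed
qed

lemma card_facet_ge:
  assumes F: "F \<in> facets \<Delta>"
  shows "q - 1 \<le> card F"
proof (rule ccontr)
  assume "\<not> q - 1 \<le> card F"
  then have c: "Suc (card F) < q" by simp
  have F\<Delta>: "F \<in> \<Delta>" using F by (simp add: facets_def)
  have "F \<noteq> {1..n}" using c q_less by auto
  then obtain x where x: "x \<in> {1..n}" "x \<notin> F" using vertices[OF F\<Delta>] by blast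
  have "insert x F \<in> \<Delta>"
    using x vertices[OF F\<Delta>] c finite_face[OF F\<Delta>] by (intro small_face) auto
  then have "insert x F = F" using F unfolding facets_def by blast
  then show False using x(2) by blast
qed

lemma ex_small_facet: "\<exists>F\<in>facets \<Delta>. card F = q - 1"
proof
  \<comment> \<open>The vertex 1 comes before \<open>a\<close>, so no set with \<open>q\<close> elements that contains it is a face.\<close>
  let ?F = "insert 1 {n + 3 - q..n}"
  have notin: "1 \<notin> {n + 3 - q..n}" using q_less by auto
  have "card {n + 3 - q..n} = q - 2" using q_less q(1) by auto
  then show c: "card ?F = q - 1" using notin q(1) by simp
  have sub: "?F \<subseteq> {1..n}" using q_less by auto
  have "?F \<in> \<Delta>" using c q(1) by (intro small_face[OF sub]) simp
  moreover have "H = ?F" if H: "H \<in> \<Delta>" "?F \<subseteq> H" for H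
  proof (rule ccontr)
    assume "H \<noteq> ?F"
    then have "card ?F < card H" using H finite_face by (intro psubset_card_mono) auto
    then have "q \<le> card H" using c by linarith
    moreover have "1 \<in> H" using H(2) by simp
    ultimately show False using early_vertex_nonface[OF vertices[OF H(1)], of 1] H(1) a(1) by simp
  qed
  ultimately show "?F \<in> facets \<Delta>" unfolding facets_def by blast
qed

lemma ex_facet_above:
  assumes "A \<in> \<Delta>"
  shows "\<exists>F\<in>facets \<Delta>. A \<subseteq> F"
proof -
  obtain F where F: "F \<in> \<Delta>" "A \<subseteq> F" "\<forall>G\<in>\<Delta>. F \<subseteq> G \<longrightarrow> F = G"
    using finite_has_maximal2[OF finite_complex assms] by (elim bexE conjE)
  then have "F \<in> facets \<Delta>" unfolding facets_def by blast
  then show ?thesis using F(2) by (rule bexI[rotated])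
qed

lemma pure_iff: "pure \<Delta> \<longleftrightarrow> n - a = q - 1"
proof
  assume p: "pure \<Delta>"
  obtain F where F: "F \<in> facets \<Delta>" "{Suc a..n} \<subseteq> F" using ex_facet_above[OF top_face] by blast
  obtain F' where F': "F' \<in> facets \<Delta>" "card F' = q - 1" using ex_small_facet by blast
  have F\<Delta>: "F \<in> \<Delta>" using F(1) by (simp add: facets_def)
  have "card {Suc a..n} \<le> card F" using F(2) finite_face[OF F\<Delta>] by (intro card_mono)
  moreover have "face_dim F = face_dim F'" using p F(1) F'(1) unfolding pure_def by blast
  then have "card F = q - 1" using F'(2) by (simp add: face_dim_def)
  ultimately show "n - a = q - 1" using q_le q(1) by simp
next
  assume eq: "n - a = q - 1"
  have "card F = q - 1" if "F \<in> facets \<Delta>" for F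
    using card_facet_ge[OF that] card_face_le[of F] that eq by (auto simp: facets_def)
  then show "pure \<Delta>" unfolding pure_def face_dim_def by simp
qed

lemma last_generator_iff: "J = {n - q + 1..n} \<longleftrightarrow> n - a = q - 1"
proof
  assume eq: "J = {n - q + 1..n}"
  have "n - q + 1 \<in> {n - q + 1..n}" using q(1) q_less by simp
  then have "n - q + 1 \<in> {a..n}" using J unfolding eq by blast
  moreover have "a \<in> {n - q + 1..n}" using a(2) unfolding eq .
  ultimately have "a = n - q + 1" by simp
  then show "n - a = q - 1" using q_less q(1) by simp
next
  assume eq: "n - a = q - 1"
  then have "a = n - q + 1" using a_le q_less q(1) by linarith
  moreover have "J = {a..n}" using J q eq by (intro card_seteq) auto
  ultimately show "J = {n - q + 1..n}" by simp
qed

end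

section \<open>Dimension, depth and Cohen--Macaulayness\<close>

lemma Sup_enat_eq:
  assumes "\<And>r. P r \<Longrightarrow> r \<le> d" "P d"
  shows "Sup {enat r | r. P r} = enat d"
proof (rule antisym)
  show "Sup {enat r | r. P r} \<le> enat d" using assms(1) by (intro Sup_least) auto
  show "enat d \<le> Sup {enat r | r. P r}" using assms(2) by (intro Sup_upper) blast
qed

text \<open>
  A regular sequence in \<open>m\<close> yields a chain of primes inside \<open>m\<close>; its last member may be
  replaced by \<open>m\<close> itself.
\<close>

lemma (in cring) grade_le_height:
  assumes noeth: "noetherian_ring R" and m: "primeideal m R"
  shows "grade R m \<le> height R m"
  unfolding grade_def
proof (rule Sup_least)
  interpret m: primeideal m R by fact
  fix e assume "e \<in> {enat (length xs) | xs. regular_sequence R xs \<and> set xs \<subseteq> m}"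
  then obtain xs where e: "e = enat (length xs)" and xs: "regular_sequence R xs" "set xs \<subseteq> m"
    by blast
  have wr: "weakly_regular R {\<zero>} xs"
    using xs regular_sequence_iff_weakly_regular[of xs] m.Icarr by blast
  have sub: "colon R {\<zero>} \<one> \<subseteq> m" using ideal_zero[OF m.is_ideal] by (auto simp: colon_def)
  obtain z where z: "z \<in> carrier R" "colon R {\<zero>} \<one> \<subseteq> colon R {\<zero>} z"
    "colon R {\<zero>} z \<subseteq> m" "primeideal (colon R {\<zero>} z) R"
    by (rule ex_prime_colon[OF noeth m zeroideal one_closed sub])
  obtain Q where Q: "prime_chain R (length xs) Q" "Q (length xs) \<subseteq> m"
    using weakly_regular_prime_chain[OF noeth m zeroideal z(1,4,3) wr xs(2)] by (elim exE conjE)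
  define Q' where "Q' i = (if i < length xs then Q i else m)" for i
  have "prime_chain R (length xs) Q'"
    unfolding prime_chain_def
  proof (intro conjI allI impI)
    fix i
    show "primeideal (Q' i) R" using Q(1) m by (auto simp: Q'_def prime_chain_def)
    assume i: "i < length xs"
    then have "Q i \<subset> Q (Suc i)" using Q(1) by (simp add: prime_chain_def)
    moreover have "Q (Suc i) \<subseteq> m" if "\<not> Suc i < length xs"
      using that i Q(2) by (metis Suc_lessI)
    ultimately show "Q' i \<subset> Q' (Suc i)" using i by (auto simp: Q'_def)
  qed
  moreover have "Q' (length xs) = m" by (simp add: Q'_def)
  ultimately show "e \<le> height R m" unfolding e height_def by (intro Sup_upper) blast
qed

lemma height_le_krull_dim: "height R m \<le> krull_dim R"
  unfolding height_def krull_dim_def by (rule Sup_subset_mono) blast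

lemma (in surjective_ring_hom) image_genideal:
  assumes X: "X \<subseteq> carrier R"
  shows "h ` genideal R X = genideal S (h ` X)"
proof
  have hX: "h ` X \<subseteq> carrier S" using X by auto
  have "X \<subseteq> contract (genideal S (h ` X))" using X S.genideal_self[OF hX]
    by (auto simp: contract_def)
  then have "genideal R X \<subseteq> contract (genideal S (h ` X))"
    by (rule R.genideal_minimal[OF contract_ideal[OF S.genideal_ideal[OF hX]]])
  then show "h ` genideal R X \<subseteq> genideal S (h ` X)" by (auto simp: contract_def)
  show "genideal S (h ` X) \<subseteq> h ` genideal R X"
    by (rule S.genideal_minimal[OF image_ideal[OF R.genideal_ideal[OF X]]])
       (rule image_mono[OF R.genideal_self[OF X]])
qed

lemma face_ideal_empty_eq:
  fixes K :: "'k::field itself"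
  shows "face_ideal n {}
    = genideal (poly_ring K n) (monomial_poly K ` {single i 1 | i. i \<in> {1..n}})"
proof -
  let ?M = "{single i (1::nat) | i. i \<in> {1..n}}"
  have M: "keys m \<subseteq> {1..n}" if "m \<in> ?M" for m using that by auto
  have *: "(\<exists>w\<in>?M. mon_divides w m) \<longleftrightarrow> \<not> keys m \<subseteq> {}" if "keys m \<subseteq> {1..n}" for m
  proof
    assume "\<exists>w\<in>?M. mon_divides w m"
    then obtain i where "mon_divides (single i (1::nat)) m" by blast
    then have "1 \<le> lookup m i" unfolding mon_divides_def by (metis lookup_single_eq)
    then have "i \<in> keys m" by (simp add: in_keys_iff)
    then show "\<not> keys m \<subseteq> {}" by blast
  next
    assume "\<not> keys m \<subseteq> {}"
    then obtain i where i: "i \<in> keys m" by blast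
    then have "mon_divides (single i 1) m"
      by (auto simp: mon_divides_def lookup_single when_def in_keys_iff)
    then show "\<exists>w\<in>?M. mon_divides w m" using i that by blast
  qed
  have "genideal (poly_ring K n) (monomial_poly K ` ?M) =
    {p \<in> polys {1..n}. \<forall>m\<in>keys p. \<exists>w\<in>?M. mon_divides w m}"
    by (rule genideal_monomials[OF M])
  also have "\<dots> = face_ideal n {}"
    unfolding face_ideal_def mon_ideal_def
    by (rule Collect_cong, rule conj_cong[OF refl], rule ball_cong[OF refl])
       (use * in \<open>simp add: polys_def\<close>)
  finally show ?thesis by simp
qed

locale stanley_reisner_lexsegment = lexsegment_complex n q a J \<Delta>
  for n q a :: nat and J :: "nat set" and \<Delta> :: "nat set set" +
  fixes K :: "'k::field itself"
begin

abbreviation "S \<equiv> poly_ring K n"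
abbreviation "I \<equiv> mon_ideal n (- \<Delta>) :: (monomial \<Rightarrow>\<^sub>0 'k) set"
abbreviation "R \<equiv> S Quot I"
abbreviation "\<pi> \<equiv> (+>\<^bsub>S\<^esub>) I"

lemma stanley_reisner_ring_eq: "stanley_reisner_ring K n \<Delta> = R"
  by (simp add: stanley_reisner_ring_def stanley_reisner_ideal_eq[OF complex])

lemma I_ideal: "ideal I S"
  by (rule mon_ideal_ideal[OF up_closed_nonfaces[OF complex]])

sublocale S: cring S
  by (rule poly_ring_cring)

sublocale \<pi>: surjective_ring_hom S R \<pi>
  by (rule S.quotient_surjective_ring_hom[OF I_ideal])

lemma kernel: "a_kernel S R \<pi> = I"
  by (rule S.quotient_kernel[OF I_ideal])

lemma noetherian: "noetherian_ring R"
  by (rule \<pi>.image_noetherian[OF poly_ring_noetherian])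

lemma contract_zero: "\<pi>.contract {\<zero>\<^bsub>R\<^esub>} = I"
  using kernel unfolding \<pi>.contract_def a_kernel_def' by auto

lemma I_subset_contract:
  assumes "ideal N R"
  shows "I \<subseteq> \<pi>.contract N"
proof -
  have "\<zero>\<^bsub>R\<^esub> \<in> N" by (rule \<pi>.S.ideal_zero[OF assms])
  then have "\<pi>.contract {\<zero>\<^bsub>R\<^esub>} \<subseteq> \<pi>.contract N" by (auto simp: \<pi>.contract_def)
  then show ?thesis unfolding contract_zero .
qed

lemma I_subset_face_ideal: "F \<in> \<Delta> \<Longrightarrow> I \<subseteq> face_ideal n F"
  unfolding face_ideal_def mon_ideal_def using subface by auto

lemma prime_chain_le:
  assumes "prime_chain R r P"
  shows "r \<le> n - a"
proof (rule prime_chain_length_le[OF _ \<pi>.contract_prime_chain[OF assms]])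
  show "card A \<le> n - a" if "A \<subseteq> {1..n}" "A \<notin> - \<Delta>" for A
    using that card_face_le by simp
  show "mon_ideal n (- \<Delta>) \<subseteq> \<pi>.contract (P 0)"
    using assms I_subset_contract primeideal.axioms(1) unfolding prime_chain_def by blast
qed

text \<open>
  The graded maximal ideal of the Stanley--Reisner ring, as the image of the face ideal of the
  empty face.
\<close>

definition vertex_ideal :: "(monomial \<Rightarrow>\<^sub>0 'k) set set" where
  "vertex_ideal = \<pi> ` face_ideal n {}"

lemma empty_face: "{} \<in> \<Delta>"
  using small_face[of "{}"] q(1) by simp

lemma graded_maximal_ideal_eq: "graded_maximal_ideal K n \<Delta> = vertex_ideal"
proof -
  let ?X = "monomial_poly K ` {single i 1 | i. i \<in> {1..n}}"
  have X: "?X \<subseteq> carrier S" by (auto simp: monomial_poly_def)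
  have "{stanley_reisner_ideal K n \<Delta> +>\<^bsub>poly_ring K n\<^esub> monomial_poly K (single i 1) | i. i \<in>
    {1..n}} = \<pi> ` ?X"
    unfolding stanley_reisner_ideal_eq[OF complex] by blast
  then show ?thesis
    unfolding graded_maximal_ideal_def stanley_reisner_ring_eq vertex_ideal_def
    face_ideal_empty_eq[of n K]
      \<pi>.image_genideal[OF X] by simp
qed

lemma vertex_ideal_prime: "primeideal vertex_ideal R"
  unfolding vertex_ideal_def
  by (rule \<pi>.image_prime[OF face_ideal_prime]) (simp add: kernel I_subset_face_ideal[OF empty_face])

lemma contract_vertex_ideal: "\<pi>.contract vertex_ideal = face_ideal n {}"
  unfolding vertex_ideal_def
  by (rule \<pi>.contract_image[OF face_ideal_ideal]) (simp add: kernel I_subset_face_ideal[OF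
  empty_face])

lemma vertex_ideal_maximal: "maximalideal vertex_ideal R"
proof (rule maximalidealI)
  interpret P: primeideal vertex_ideal R by (rule vertex_ideal_prime)
  show "ideal vertex_ideal R" by (rule P.is_ideal)
  show "carrier R \<noteq> vertex_ideal" by (rule P.I_notcarr)
  fix N assume N: "ideal N R" "vertex_ideal \<subseteq> N"
  note cN = \<pi>.contract_ideal[OF N(1)]
  show "N = vertex_ideal \<or> N = carrier R"
  proof (cases "N = vertex_ideal")
    case False
    then have "\<pi>.contract vertex_ideal \<subset> \<pi>.contract N"
      by (intro \<pi>.contract_strict_mono P.is_ideal N) (use N(2) in blast)
    then obtain p where p: "p \<in> \<pi>.contract N"
      "p \<notin> face_ideal n {}" and sub: "face_ideal n {} \<subseteq> \<pi>.contract N"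
      unfolding contract_vertex_ideal by blast
    have pn: "p \<in> polys {1..n}" using p(1) by (simp add: \<pi>.contract_def)
    let ?p0 = "restrict_poly (\<lambda>m. keys m \<notin> {A. \<not> A \<subseteq> {}}) p"
    have d: "p - ?p0 \<in> face_ideal n {}"
      unfolding face_ideal_def by (rule diff_restrict_poly_in_mon_ideal[OF pn])
    have "p - (p - ?p0) \<in> \<pi>.contract N" by (rule poly_ideal_diff[OF cN p(1) subsetD[OF sub d]])
    then have p0N: "?p0 \<in> \<pi>.contract N" by simp
    have p00: "?p0 \<noteq> 0" using d p(2) by auto
    define c where "c = lookup ?p0 0"
    have pc: "?p0 = single 0 c"
    proof (rule poly_mapping_eqI)
      fix m
      show "lookup ?p0 m = lookup (single 0 c) m"
        by (auto simp: c_def lookup_restrict_poly lookup_single when_def)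
    qed
    have c0: "c \<noteq> 0" using p00 unfolding pc by auto
    have "single 0 (1 / c) * ?p0 \<in> \<pi>.contract N"
      by (rule poly_ideal_mult[OF cN p0N]) simp
    then have "1 \<in> \<pi>.contract N" unfolding pc using c0 by (simp add: mult_single)
    then have "\<pi> 1 \<in> N" by (simp add: \<pi>.contract_def)
    then have "\<one>\<^bsub>R\<^esub> \<in> N" using \<pi>.hom_one by simp
    then show ?thesis using ideal.one_imp_carrier[OF N(1)] by simp
  qed simp
qed

lemma ex_long_prime_chain: "\<exists>P. prime_chain R (n - a) P \<and> P (n - a) = vertex_ideal"
proof -
  define P where "P i = (face_ideal n {Suc a + i..n} :: (monomial \<Rightarrow>\<^sub>0 'k) set)" for i
  have "prime_chain S (n - a) P"
    unfolding prime_chain_def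
  proof (intro conjI allI impI)
    fix i
    show "primeideal (P i) S" unfolding P_def by (rule face_ideal_prime)
    assume i: "i < n - a"
    let ?x = "single (single (Suc a + i) 1) (1::'k)"
    have "?x \<in> P (Suc i)" "?x \<notin> P i" using i by (auto simp: P_def face_ideal_def mon_ideal_def)
    moreover have "{Suc a + Suc i..n} \<subseteq> {Suc a + i..n}" by auto
    then have "P i \<subseteq> P (Suc i)"
      unfolding P_def face_ideal_def mon_ideal_def by blast
    ultimately show "P i \<subset> P (Suc i)" by blast
  qed
  moreover have "I \<subseteq> P 0" unfolding P_def using I_subset_face_ideal[OF top_face] by simp
  ultimately have "prime_chain R (n - a) (\<lambda>i. \<pi> ` P i)"
    by (intro \<pi>.image_prime_chain) (simp_all add: kernel)
  moreover have "P (n - a) = face_ideal n {}" using a_le by (simp add: P_def)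
  ultimately show ?thesis unfolding vertex_ideal_def by (intro exI[of _ "\<lambda>i. \<pi> ` P i"]) simp
qed

lemma krull_dim_eq: "krull_dim R = enat (n - a)"
  unfolding krull_dim_def using prime_chain_le ex_long_prime_chain by (intro Sup_enat_eq) blast+

lemma height_vertex_ideal: "enat (n - a) \<le> height R vertex_ideal"
  unfolding height_def using ex_long_prime_chain by (intro Sup_upper) blast

text \<open>
  The freedom in the choice of \<open>y\<close> makes the bound available for every maximal ideal, not only for
  the graded one.
\<close>

lemma le_grade:
  assumes y: "univariate_family n y" and N: "ideal N R" "N \<noteq> carrier R"
    and yN: "\<And>i. i \<in> {1..n} \<Longrightarrow> y i \<in> \<pi>.contract N"
  shows "enat (q - 1) \<le> grade R N"
proof -
  let ?fs = "map (\<lambda>i. complete_hom (Suc i) (map y [1..<Suc n])) [0..<q - 1]"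
  note cN = \<pi>.contract_ideal[OF N(1)]
  have "set (map y [1..<Suc n]) \<subseteq> \<pi>.contract N" using yN by auto
  then have "complete_hom (Suc i) (map y [1..<Suc n]) \<in> \<pi>.contract N" for i
    by (rule complete_hom_in_ideal[OF cN])
  then have fsN: "set ?fs \<subseteq> \<pi>.contract N" unfolding set_map by blast
  then have fs: "set ?fs \<subseteq> polys {1..n}" using poly_ideal_subset[OF cN] by blast
  have "weakly_regular S I ?fs"
  proof (rule shifted_weakly_regular[OF complex shifted fs])
    fix F assume F: "F \<in> facets \<Delta>"
    then have "F \<subseteq> {1..n}" using vertices by (simp add: facets_def)
    then show "weakly_regular S (face_ideal n F) ?fs"
      by (rule complete_hom_weakly_regular_on_face[OF y _ card_facet_ge[OF F]])
  qed
  then have wr: "weakly_regular R {\<zero>\<^bsub>R\<^esub>} (map \<pi> ?fs)"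
    using \<pi>.weakly_regular_contract[OF \<pi>.S.zeroideal, of ?fs] fs unfolding contract_zero by simp
  have xsN: "set (map \<pi> ?fs) \<subseteq> N" using fsN by (auto simp: \<pi>.contract_def)
  then have xsc: "set (map \<pi> ?fs) \<subseteq> carrier R" using \<pi>.S.ideal_carrier[OF N(1)] by blast
  have "genideal R (set (map \<pi> ?fs)) \<subseteq> N" by (rule \<pi>.S.genideal_minimal[OF N(1) xsN])
  then have "genideal R (set (map \<pi> ?fs)) \<noteq> carrier R"
    using N(2) \<pi>.S.ideal_carrier[OF N(1)] by blast
  then have "regular_sequence R (map \<pi> ?fs)"
    using \<pi>.S.regular_sequence_iff_weakly_regular[OF xsc] wr by simp
  then have "enat (length (map \<pi> ?fs)) \<le> grade R N"
    unfolding grade_def using xsN by (intro Sup_upper) blast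
  then show ?thesis by simp
qed

text \<open>
  For the upper bound, the small facet \<open>F\<close> supplies the associated prime: the annihilator of \<open>x\<^sub>F\<close>
  is the face ideal of \<open>F\<close>, and chains of primes above it have length at most \<open>card F\<close>.
\<close>

lemma grade_vertex_ideal: "grade R vertex_ideal = enat (q - 1)"
proof (rule antisym)
  interpret P: primeideal vertex_ideal R by (rule vertex_ideal_prime)
  show "enat (q - 1) \<le> grade R vertex_ideal"
  proof (rule le_grade[OF _ P.is_ideal])
    show "univariate_family n (\<lambda>i. var_power i 1 :: monomial \<Rightarrow>\<^sub>0 'k)"
      by (simp add: univariate_family_def var_power_def)
    show "vertex_ideal \<noteq> carrier R" using P.I_notcarr by simp
    show "var_power i 1 \<in> \<pi>.contract vertex_ideal" if "i \<in> {1..n}" for i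
      unfolding contract_vertex_ideal using that
      by (simp add: face_ideal_def mon_ideal_def var_power_def)
  qed
  show "grade R vertex_ideal \<le> enat (q - 1)"
    unfolding grade_def
  proof (rule Sup_least)
    fix e assume "e \<in> {enat (length xs) | xs. regular_sequence R xs \<and> set xs \<subseteq> vertex_ideal}"
    then obtain xs where e: "e = enat (length xs)" and xs: "regular_sequence R xs"
      "set xs \<subseteq> vertex_ideal" by blast
    have wr: "weakly_regular R {\<zero>\<^bsub>R\<^esub>} xs"
      using xs \<pi>.S.regular_sequence_iff_weakly_regular[of xs] P.Icarr by blast
    obtain F where F: "F \<in> facets \<Delta>" "card F = q - 1" using ex_small_facet by blast
    have F\<Delta>: "F \<in> \<Delta>" using F(1) by (simp add: facets_def)
    note Fn = vertices[OF F\<Delta>]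
    let ?x = "single (squarefree_product F) (1::'k)"
    let ?C = "colon R {\<zero>\<^bsub>R\<^esub>} (\<pi> ?x)"
    have x: "?x \<in> carrier S" using Fn finite_face[OF F\<Delta>] by (simp add: keys_squarefree_product)
    have "\<pi>.contract ?C = colon S I ?x" using \<pi>.contract_colon[OF x, of "{\<zero>\<^bsub>R\<^esub>}"]
      unfolding contract_zero .
    also have "\<dots> = mon_ideal n {A. A \<union> F \<in> - \<Delta>}" by (rule mon_ideal_colon[OF Fn])
    also have "\<dots> = face_ideal n F"
      unfolding face_ideal_def
    proof (rule mon_ideal_cong)
      fix A assume "A \<subseteq> {1..n}"
      have "A \<union> F \<in> \<Delta> \<longleftrightarrow> A \<subseteq> F"
      proof
        assume "A \<union> F \<in> \<Delta>"
        then have "A \<union> F = F" using F(1) unfolding facets_def by blast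
        then show "A \<subseteq> F" by blast
      next
        assume "A \<subseteq> F"
        then show "A \<union> F \<in> \<Delta>" using F\<Delta> by (simp add: Un_absorb1)
      qed
      then show "A \<in> {A. A \<union> F \<in> - \<Delta>} \<longleftrightarrow> A \<in> {A. \<not> A \<subseteq> F}" by simp
    qed
    finally have cC: "\<pi>.contract ?C = face_ideal n F" .
    have \<pi>x: "\<pi> ?x \<in> carrier R" using x by (rule \<pi>.hom_closed)
    have C: "?C = \<pi> ` face_ideal n F"
      using \<pi>.image_contract[OF \<pi>.S.colon_ideal[OF \<pi>.S.zeroideal \<pi>x]] unfolding cC by simp
    have Cprime: "primeideal ?C R"
      unfolding C by (rule \<pi>.image_prime[OF face_ideal_prime]) (simp add: kernel
      I_subset_face_ideal[OF F\<Delta>])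
    have "face_ideal n F \<subseteq> (face_ideal n {} :: (monomial \<Rightarrow>\<^sub>0 'k) set)"
      by (auto simp: face_ideal_def mon_ideal_def)
    then have Csub: "?C \<subseteq> vertex_ideal" unfolding C vertex_ideal_def by (rule image_mono)
    obtain Q where Q: "prime_chain R (length xs) Q" "Q 0 = ?C"
      using \<pi>.S.weakly_regular_prime_chain[OF noetherian vertex_ideal_prime \<pi>.S.zeroideal \<pi>x
        Cprime Csub wr xs(2)]
      by blast
    have "length xs \<le> q - 1"
    proof (rule prime_chain_length_le[OF _ \<pi>.contract_prime_chain[OF Q(1)]])
      show "card A \<le> q - 1" if "A \<subseteq> {1..n}" "A \<notin> {A. \<not> A \<subseteq> F}" for A
        using that F(2) card_mono[OF finite_face[OF F\<Delta>], of A] by simp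
      show "mon_ideal n {A. \<not> A \<subseteq> F} \<subseteq> \<pi>.contract (Q 0)"
        unfolding Q(2) cC face_ideal_def ..
    qed
    then show "e \<le> enat (q - 1)" by (simp add: e)
  qed
qed

lemma le_grade_maximal:
  assumes N: "maximalideal N R"
  shows "enat (q - 1) \<le> grade R N"
proof -
  interpret N: maximalideal N R by fact
  let ?M = "\<pi>.contract N"
  note M = \<pi>.contract_ideal[OF N.is_ideal]
  have one: "1 \<notin> ?M"
  proof
    assume "1 \<in> ?M"
    then have "\<pi> 1 \<in> N" by (simp add: \<pi>.contract_def)
    then have "\<one>\<^bsub>R\<^esub> \<in> N" using \<pi>.hom_one by simp
    then show False using N.one_imp_carrier N.I_notcarr by simp
  qed
  have inv: "\<exists>u\<in>polys {1..n}. g * u - 1 \<in> ?M" if g: "g \<in> polys {1..n}" "g \<notin> ?M" for g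
  proof -
    have gc: "g \<in> carrier S" using g by simp
    have \<pi>g: "\<pi> g \<in> carrier R" "\<pi> g \<notin> N" using g \<pi>.hom_closed[OF gc] by (auto simp: \<pi>.contract_def)
    note adj = \<pi>.S.adjoin_ideal[OF N.is_ideal \<pi>g(1)]
    have "adjoin R N (\<pi> g) = carrier R"
      using N.I_maximal[OF adj] \<pi>.S.adjoin_superset[OF N.is_ideal \<pi>g(1)] \<pi>.S.adjoin_self[OF
        N.is_ideal \<pi>g(1)]
        \<pi>.S.ideal_carrier[OF adj] \<pi>g(2) by blast
    then have "1 \<in> \<pi>.contract (adjoin R N (\<pi> g))"
      using \<pi>.hom_closed[of 1] by (simp add: \<pi>.contract_def)
    then have "1 \<in> adjoin S ?M g" unfolding \<pi>.contract_adjoin[OF N.is_ideal gc] .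
    then obtain m u where mu: "m \<in> ?M" "u \<in> polys {1..n}" "1 = m + u * g"
      unfolding adjoin_poly_ring by blast
    have "0 - m \<in> ?M" by (intro poly_ideal_diff[OF M] poly_ideal_zero[OF M] mu(1))
    moreover have "g * u - 1 = 0 - m" using mu(3) by (simp add: algebra_simps)
    ultimately show ?thesis using mu(2) by metis
  qed
  have "\<exists>p\<in>?M. p \<in> polys {i} \<and> p \<noteq> 0" if "i \<in> {1..n}" for i
    by (rule zariski[OF M one inv that])
  then obtain p where p: "\<And>i. i \<in> {1..n} \<Longrightarrow> p i \<in> ?M \<and> p i \<in> polys {i} \<and> p i \<noteq> 0" by metis
  \<comment> \<open>Multiplying by the variable removes the constant term.\<close>
  define y where "y i = p i * single (single i 1) 1" for i
  show ?thesis
  proof (rule le_grade[OF _ N.is_ideal])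
    show "N \<noteq> carrier R" using N.I_notcarr by simp
    show "univariate_family n y"
      unfolding univariate_family_def
    proof (intro ballI conjI)
      fix i assume i: "i \<in> {1..n}"
      show "y i \<noteq> 0" using p[OF i] by (simp add: y_def)
      fix m assume "m \<in> keys (y i)"
      then obtain k where "k \<in> keys (p i)" "m = k + single i 1"
        unfolding y_def keys_mult_monomial by blast
      then show "keys m = {i}" using p[OF i] by (auto simp: polys_def keys_monomial_add)
    qed
    fix i assume i: "i \<in> {1..n}"
    have "single (single i 1) 1 * p i \<in> ?M"
      by (rule poly_ideal_mult[OF M]) (use p[OF i] i in auto)
    then show "y i \<in> ?M" by (simp add: y_def mult.commute)
  qed
qed

lemma cohen_macaulay_iff: "cohen_macaulay_ring R \<longleftrightarrow> n - a = q - 1"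
proof
  assume "cohen_macaulay_ring R"
  then have "grade R vertex_ideal = height R vertex_ideal"
    using vertex_ideal_maximal by (simp add: cohen_macaulay_ring_def)
  then have "enat (n - a) \<le> enat (q - 1)" using height_vertex_ideal grade_vertex_ideal by simp
  then show "n - a = q - 1" using q_le q(1) by simp
next
  assume eq: "n - a = q - 1"
  show "cohen_macaulay_ring R"
    unfolding cohen_macaulay_ring_def
  proof (intro conjI allI impI)
    show "cring R" by (rule \<pi>.S.is_cring)
    show "noetherian_ring R" by (rule noetherian)
    fix N assume N: "maximalideal N R"
    have "enat (q - 1) \<le> grade R N" by (rule le_grade_maximal[OF N])
    moreover have "grade R N \<le> height R N"
      by (rule \<pi>.S.grade_le_height[OF noetherian \<pi>.S.maximalideal_prime[OF N]])
    moreover have "height R N \<le> enat (q - 1)"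
      using height_le_krull_dim[of R N] unfolding krull_dim_eq eq .
    ultimately show "grade R N = height R N" by simp
  qed
qed

end

theorem corollary2p1p3:
  fixes K :: "'k::field itself"
    and n q :: nat
    and j :: "nat \<Rightarrow> nat"
    and v :: monomial
    and \<Delta> :: "nat set set"
  assumes "q \<ge> 2"
    and "2 \<le> j 1" and "strict_mono_on {1..q} j" and "j q \<le> n"
    and "v = (\<Sum>i=1..q. Poly_Mapping.single (j i) 1)"
    and "simplicial_complex n \<Delta>"
    and "initial_lexsegment_ideal K n v = stanley_reisner_ideal K n \<Delta>"
  shows "krull_dim (stanley_reisner_ring K n \<Delta>) = enat (n - j 1) \<and>
    stanley_reisner_depth K n \<Delta> = enat (q - 1) \<and>
    (pure \<Delta> \<longleftrightarrow> v = (\<Sum>i=n-q+1..n. Poly_Mapping.single i 1)) \<and>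
    (pure \<Delta> \<longleftrightarrow> cohen_macaulay_complex K n \<Delta>)"
proof -
  let ?J = "j ` {1..q}"
  have inj: "inj_on j {1..q}" by (rule strict_mono_on_imp_inj_on[OF assms(3)])
  have v: "v = squarefree_product ?J"
    unfolding assms(5) squarefree_product_def sum.reindex[OF inj] comp_def ..
  have J: "?J \<subseteq> {j 1..n}"
  proof
    fix x assume "x \<in> ?J"
    then obtain i where i: "i \<in> {1..q}" "x = j i" by blast
    have "j 1 \<le> j i" "j i \<le> j q"
      using strict_mono_on_leD[OF assms(3), of 1 i] strict_mono_on_leD[OF assms(3), of i q] i(1)
        assms(1) by auto
    then show "x \<in> {j 1..n}" using i(2) assms(4) by simp
  qed
  have Jn: "?J \<subseteq> {1..n}" using J assms(2) by force
  have cJ: "card ?J = q" unfolding card_image[OF inj] by simp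
  interpret stanley_reisner_lexsegment n q "j 1" ?J \<Delta> K
  proof
    show "simplicial_complex n \<Delta>" by fact
    show "j 1 \<in> ?J" using assms(1) by auto
    show "A \<notin> \<Delta> \<longleftrightarrow> (\<exists>W\<subseteq>A. card W = q \<and> lex_ge W ?J)" if "A \<subseteq> {1..n}" for A
      using nonfaces_of_lexsegment[OF assms(6) Jn assms(7)[unfolded v] that] unfolding cJ .
  qed (use assms J cJ in auto)
  have fin: "finite ?J" "finite {n - q + 1..n}" by simp_all
  have "v = (\<Sum>i=n-q+1..n. single i 1) \<longleftrightarrow> ?J = {n - q + 1..n}"
  proof
    assume "v = (\<Sum>i=n-q+1..n. single i 1)"
    then have "squarefree_product ?J = squarefree_product {n - q + 1..n}"
      unfolding v squarefree_product_def[of "{n - q + 1..n}"] .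
    then have "keys (squarefree_product ?J) = keys (squarefree_product {n - q + 1..n})"
      by (rule arg_cong)
    then show "?J = {n - q + 1..n}"
      unfolding keys_squarefree_product[OF fin(1)] keys_squarefree_product[OF fin(2)] .
  next
    assume eq: "?J = {n - q + 1..n}"
    show "v = (\<Sum>i=n-q+1..n. single i 1)" unfolding v eq by (simp add: squarefree_product_def)
  qed
  then show ?thesis
    using krull_dim_eq grade_vertex_ideal pure_iff last_generator_iff cohen_macaulay_iff
    unfolding stanley_reisner_depth_def cohen_macaulay_complex_def stanley_reisner_ring_eq
    graded_maximal_ideal_eq
    by simp
qed

end
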